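(* Let $\mathbf A$ be a finite supernilpotent algebra of prime power order $q^h$ ($q$ prime) belonging to a congruence modular variety, and let $m$ be the maximal arity of the basic operations of $\mathbf A$. Then there exists a black-box algorithm solving $\mathrm{CSAT}(\mathbf A)$ in time $O(n^d k)$, where $d=|A|^{\log_q m+1}$, $n$ is the number of input variables of the given circuit and $k$ is the input size.
   Context: A circuit over an algebra $\mathbf A$ is a directed acyclic graph whose source nodes (input gates) are variables (or constants from $A$) and whose other gates are labeled by basic operations of $\mathbf A$ of matching arity; each gate computes a function of the input variables. $\mathrm{CSAT}(\mathbf A)$ is the problem: given a circuit over $\mathbf A$ with two output gates $g_1,g_2$, decide whether there is a valuation $\bar x$ of the input gates with $g_1(\bar x)=g_2(\bar x)$. A black-box algorithm is one that only evaluates the given circuit on a set of candidate valuations (a hitting set) and answers "yes" iff one of them is a solution. For congruences $\alpha_1,\dots,\alpha_k,\beta,\gamma$ of $\mathbf A$, we write $C(\alpha_1,\dots,\alpha_k,\beta;\gamma)$ if for every polynomial $f$ of $\mathbf A$ and all tuples $\bar a_i\equiv_{\alpha_i}\bar b_i$ ($i\le k$) and $\bar u\equiv_\beta\bar v$ such that $f(\bar x_1,\dots,\bar x_k,\bar u)\equiv_\gamma f(\bar x_1,\dots,\bar x_k,\bar v)$ for all $(\bar x_1,\dots,\bar x_k)\in\{\bar a_1,\bar b_1\}\times\cdots\times\{\bar a_k,\bar b_k\}$ other than $(\bar b_1,\dots,\bar b_k)$, also $f(\bar b_1,\dots,\bar b_k,\bar u)\equiv_\gamma f(\bar b_1,\dots,\bar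 b_k,\bar v)$. The $(k+1)$-ary commutator $[\alpha_1,\dots,\alpha_{k+1}]$ is the least $\gamma$ with $C(\alpha_1,\dots,\alpha_k,\alpha_{k+1};\gamma)$. $\mathbf A$ is $k$-supernilpotent if $[1_A,\dots,1_A]=0_A$ ($k+1$ entries), and supernilpotent if it is $k$-supernilpotent for some $k$. *)

theory Defs
  imports Complex_Main "HOL-Computational_Algebra.Primes"
begin

section \<open>Algebras, terms, congruences\<close>

text \<open>
  A signature is a type \<open>'f\<close> of operation symbols with an arity function
  \<open>ar :: 'f \<Rightarrow> nat\<close>. The value of \<open>opn A f\<close> on lists of a length other than \<open>ar f\<close>
  or with entries outside the universe is irrelevant.
\<close>

record ('f, 'a) ualg =
  uni :: "'a set"
  opn :: "'f \<Rightarrow> 'a list \<Rightarrow> 'a"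

definition is_ualg :: "('f \<Rightarrow> nat) \<Rightarrow> ('f, 'a) ualg \<Rightarrow> bool" where
  "is_ualg ar A \<longleftrightarrow> uni A \<noteq> {} \<and>
     (\<forall>f xs. length xs = ar f \<and> set xs \<subseteq> uni A \<longrightarrow> opn A f xs \<in> uni A)"

datatype ('f, 'v) utrm = UVar 'v | UApp 'f "('f, 'v) utrm list"

fun utrm_vars :: "('f, 'v) utrm \<Rightarrow> 'v set" where
  "utrm_vars (UVar x) = {x}"
| "utrm_vars (UApp f ts) = (\<Union>t\<in>set ts. utrm_vars t)"

fun wf_utrm :: "('f \<Rightarrow> nat) \<Rightarrow> ('f, 'v) utrm \<Rightarrow> bool" where
  "wf_utrm ar (UVar x) \<longleftrightarrow> True"
| "wf_utrm ar (UApp f ts) \<longleftrightarrow> length ts = ar f \<and> (\<forall>t\<in>set ts. wf_utrm ar t)"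

fun utrm_eval :: "('f, 'a) ualg \<Rightarrow> ('v \<Rightarrow> 'a) \<Rightarrow> ('f, 'v) utrm \<Rightarrow> 'a" where
  "utrm_eval A \<rho> (UVar x) = \<rho> x"
| "utrm_eval A \<rho> (UApp f ts) = opn A f (map (utrm_eval A \<rho>) ts)"

definition ucong :: "('f \<Rightarrow> nat) \<Rightarrow> ('f, 'a) ualg \<Rightarrow> ('a \<times> 'a) set \<Rightarrow> bool" where
  "ucong ar A r \<longleftrightarrow> equiv (uni A) r \<and>
     (\<forall>f xs ys. length xs = ar f \<and> list_all2 (\<lambda>x y. (x, y) \<in> r) xs ys
        \<longrightarrow> (opn A f xs, opn A f ys) \<in> r)"

definition ucong_join ::
    "('f \<Rightarrow> nat) \<Rightarrow> ('f, 'a) ualg \<Rightarrow> ('a \<times> 'a) set \<Rightarrow> ('a \<times> 'a) set \<Rightarrow> ('a \<times> 'a) set" where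
  "ucong_join ar A \<alpha> \<beta> = \<Inter>{r. ucong ar A r \<and> \<alpha> \<subseteq> r \<and> \<beta> \<subseteq> r}"

definition ucong_modular :: "('f \<Rightarrow> nat) \<Rightarrow> ('f, 'a) ualg \<Rightarrow> bool" where
  "ucong_modular ar A \<longleftrightarrow>
     (\<forall>\<alpha> \<beta> \<gamma>. ucong ar A \<alpha> \<and> ucong ar A \<beta> \<and> ucong ar A \<gamma> \<and> \<alpha> \<subseteq> \<gamma> \<longrightarrow>
        ucong_join ar A \<alpha> (\<beta> \<inter> \<gamma>) = ucong_join ar A \<alpha> \<beta> \<inter> \<gamma>)"


section \<open>Congruence modular varieties\<close>

text \<open>A variety is given by a set of identities, i.e. pairs of terms over countably many variables.\<close>

type_synonym 'f identities = "(('f, nat) utrm \<times> ('f, nat) utrm) set"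

definition satisfies_ids :: "('f, 'a) ualg \<Rightarrow> 'f identities \<Rightarrow> bool" where
  "satisfies_ids A E \<longleftrightarrow>
     (\<forall>(s, t)\<in>E. \<forall>\<rho>. range \<rho> \<subseteq> uni A \<longrightarrow> utrm_eval A \<rho> s = utrm_eval A \<rho> t)"

text \<open>
  HOL cannot quantify over types inside a formula, so ``every algebra of the variety'' is
  read as ``every algebra whose universe is a set of terms over countably many variables''.
  This universe is large enough: \<open>cm_variety_imp_ucong_modular\<close> below shows that
  it already gives modularity for the members of the variety over an arbitrary type.
\<close>

definition cm_variety :: "('f \<Rightarrow> nat) \<Rightarrow> 'f identities \<Rightarrow> bool" where
  "cm_variety ar E \<longleftrightarrow>
     (\<forall>B :: ('f, ('f, nat) utrm) ualg. is_ualg ar B \<and> satisfies_ids B E \<longrightarrow> ucong_modular ar B)"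

definition in_cm_variety :: "('f \<Rightarrow> nat) \<Rightarrow> ('f, 'a) ualg \<Rightarrow> bool" where
  "in_cm_variety ar A \<longleftrightarrow>
     (\<exists>E. (\<forall>(s, t)\<in>E. wf_utrm ar s \<and> wf_utrm ar t) \<and> satisfies_ids A E \<and> cm_variety ar E)"


lemma utrm_eval_closed:
  assumes "is_ualg ar A" "range \<rho> \<subseteq> uni A" "wf_utrm ar t"
  shows "utrm_eval A \<rho> t \<in> uni A"
  using assms(3)
proof (induction t)
  case (UVar x)
  then show ?case using assms(2) by auto
next
  case (UApp f ts)
  then have "set (map (utrm_eval A \<rho>) ts) \<subseteq> uni A" by auto
  then show ?case using assms(1) UApp.prems by (simp add: is_ualg_def)
qed

lemma ucong_trancl_Un:
  assumes "is_ualg ar A" and a: "ucong ar A \<alpha>" and b: "ucong ar A \<beta>"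
  shows "ucong ar A ((\<alpha> \<union> \<beta>)\<^sup>+)"
proof -
  let ?R = "(\<alpha> \<union> \<beta>)\<^sup>+"
  have sub: "\<alpha> \<union> \<beta> \<subseteq> uni A \<times> uni A" and refl: "refl_on (uni A) \<alpha>"
    and sy: "sym (\<alpha> \<union> \<beta>)"
    using a b by (auto simp: ucong_def equiv_def intro: sym_Un)
  have subR: "?R \<subseteq> uni A \<times> uni A" using trancl_subset_Sigma[OF sub] .
  have reflR: "(x, x) \<in> ?R" if "x \<in> uni A" for x
    using refl that by (auto simp: refl_on_def)
  have equiv: "equiv (uni A) ?R"
    using subR reflR sy by (auto simp: equiv_def refl_on_def intro: sym_trancl)
  have step1: "(opn A f (us @ x # vs), opn A f (us @ y # vs)) \<in> ?R"
    if "(x, y) \<in> \<alpha> \<union> \<beta>" "set us \<subseteq> uni A" "set vs \<subseteq> uni A" "length us + 1 + length vs = ar f"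
    for f us vs x y
  proof -
    have "(opn A f (us @ x # vs), opn A f (us @ y # vs)) \<in> r"
      if r: "ucong ar A r" "(x, y) \<in> r" for r
    proof -
      have "list_all2 (\<lambda>x y. (x, y) \<in> r) zs zs" if "set zs \<subseteq> uni A" for zs
        using r(1) that by (auto simp: ucong_def equiv_def refl_on_def list_all2_same)
      then have "list_all2 (\<lambda>x y. (x, y) \<in> r) (us @ x # vs) (us @ y # vs)"
        using \<open>set us \<subseteq> uni A\<close> \<open>set vs \<subseteq> uni A\<close> r(2) by (auto intro!: list_all2_appendI)
      then show ?thesis
        using r(1) \<open>length us + 1 + length vs = ar f\<close> by (auto simp: ucong_def)
    qed
    then show ?thesis using a b \<open>(x, y) \<in> \<alpha> \<union> \<beta>\<close> by blast
  qed
  have step: "(opn A f (us @ x # vs), opn A f (us @ y # vs)) \<in> ?R"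
    if "(x, y) \<in> ?R" "set us \<subseteq> uni A" "set vs \<subseteq> uni A" "length us + 1 + length vs = ar f"
    for f us vs x y
    using that(1)
  proof (induction rule: trancl_induct)
    case (base y)
    then show ?case using step1 that by blast
  next
    case (step y z)
    then show ?case using step1[OF step(2) that(2-4)] by (meson trancl_trans)
  qed
  have main: "(opn A f (us @ xs), opn A f (us @ ys)) \<in> ?R"
    if "list_all2 (\<lambda>x y. (x, y) \<in> ?R) xs ys" "set us \<subseteq> uni A" "length us + length xs = ar f"
    for f us xs ys
    using that
  proof (induction xs ys arbitrary: us rule: list_all2_induct)
    case Nil
    then show ?case using assms(1) reflR by (auto simp: is_ualg_def)
  next
    case (Cons x xs y ys)
    have xs: "set xs \<subseteq> uni A" and y: "y \<in> uni A"
      using Cons(1,2) subR by (fastforce simp: list_all2_conv_all_nth in_set_conv_nth)+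
    have "(opn A f (us @ x # xs), opn A f (us @ y # xs)) \<in> ?R"
      using step[OF Cons(1)] Cons.prems xs by auto
    moreover have "(opn A f ((us @ [y]) @ xs), opn A f ((us @ [y]) @ ys)) \<in> ?R"
      using Cons.prems y by (intro Cons.IH) auto
    ultimately show ?case by (auto intro: trancl_trans)
  qed
  show ?thesis
    unfolding ucong_def using equiv main[where us = "[]"] by auto
qed

lemma ucong_join_eq_trancl:
  assumes "is_ualg ar A" "ucong ar A \<alpha>" "ucong ar A \<beta>"
  shows "ucong_join ar A \<alpha> \<beta> = (\<alpha> \<union> \<beta>)\<^sup>+"
proof
  show "ucong_join ar A \<alpha> \<beta> \<subseteq> (\<alpha> \<union> \<beta>)\<^sup>+"
    using ucong_trancl_Un[OF assms] by (auto simp: ucong_join_def)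
  have "(\<alpha> \<union> \<beta>)\<^sup>+ \<subseteq> r" if "ucong ar A r" "\<alpha> \<subseteq> r" "\<beta> \<subseteq> r" for r
    using that trancl_mono_subset[of "\<alpha> \<union> \<beta>" r] by (auto simp: ucong_def equiv_def)
  then show "(\<alpha> \<union> \<beta>)\<^sup>+ \<subseteq> ucong_join ar A \<alpha> \<beta>"
    by (auto simp: ucong_join_def)
qed

theorem cm_variety_imp_ucong_modular:
  fixes B :: "('f, 'b) ualg"
  assumes E: "\<forall>(s, t)\<in>E. wf_utrm ar s \<and> wf_utrm ar t" and cm: "cm_variety ar E"
    and B: "is_ualg ar B" and sat: "satisfies_ids B E"
  shows "ucong_modular ar B"
  unfolding ucong_modular_def
proof (intro allI impI equalityI; elim conjE)
  fix \<alpha> \<beta> \<gamma> assume c: "ucong ar B \<alpha>" "ucong ar B \<beta>" "ucong ar B \<gamma>" and le: "\<alpha> \<subseteq> \<gamma>"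
  show "ucong_join ar B \<alpha> (\<beta> \<inter> \<gamma>) \<subseteq> ucong_join ar B \<alpha> \<beta> \<inter> \<gamma>"
    using c le by (auto simp: ucong_join_def)
next
  fix \<alpha> \<beta> \<gamma> assume c: "ucong ar B \<alpha>" "ucong ar B \<beta>" "ucong ar B \<gamma>" and le: "\<alpha> \<subseteq> \<gamma>"
  show "ucong_join ar B \<alpha> \<beta> \<inter> \<gamma> \<subseteq> ucong_join ar B \<alpha> (\<beta> \<inter> \<gamma>)"
  proof safe
    fix x y assume "(x, y) \<in> ucong_join ar B \<alpha> \<beta>" and xy\<gamma>: "(x, y) \<in> \<gamma>"
    then have "(x, y) \<in> (\<alpha> \<union> \<beta>)\<^sup>+" using ucong_join_eq_trancl[OF B c(1,2)] by simp
    then obtain N where "(x, y) \<in> (\<alpha> \<union> \<beta>) ^^ N" by (auto simp: trancl_power)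
    then obtain z where z: "z 0 = x" "z N = y" "\<And>i. i < N \<Longrightarrow> (z i, z (Suc i)) \<in> \<alpha> \<union> \<beta>"
      by (auto simp: relpow_fun_conv)
    have xyB: "x \<in> uni B" "y \<in> uni B" using xy\<gamma> c(3) by (auto simp: ucong_def equiv_def)
    define g where "g i = z (min i N)" for i :: nat
    have gB: "range g \<subseteq> uni B"
    proof safe
      fix i
      show "g i \<in> uni B"
      proof (cases "i < N")
        case True
        then show ?thesis using z(3)[OF True] c(1,2) by (auto simp: g_def ucong_def equiv_def)
      next
        case False
        then show ?thesis using z(2) xyB by (auto simp: g_def min_def)
      qed
    qed
    let ?W = "{t :: ('f, nat) utrm. wf_utrm ar t}"
    let ?ev = "utrm_eval B g"
    define S where "S = ?ev ` ?W"
    define r where "r b = (SOME t. t \<in> ?W \<and> ?ev t = b)" for b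
    have r: "wf_utrm ar (r b)" "?ev (r b) = b" if "b \<in> S" for b
    proof -
      have "\<exists>t. t \<in> ?W \<and> ?ev t = b" using that by (auto simp: S_def)
      from someI_ex[OF this] show "wf_utrm ar (r b)" "?ev (r b) = b" by (auto simp: r_def)
    qed
    have SB: "S \<subseteq> uni B" using utrm_eval_closed[OF B gB] by (auto simp: S_def)
    have Sop: "opn B f bs \<in> S" if "length bs = ar f" "set bs \<subseteq> S" for f bs
    proof -
      have "opn B f bs = ?ev (UApp f (map r bs))"
        using that r by (auto intro!: arg_cong[of _ _ "opn B f"] map_idI[symmetric])
      moreover have "UApp f (map r bs) \<in> ?W" using that r by auto
      ultimately show ?thesis unfolding S_def by (rule image_eqI)
    qed
    have gS: "g i \<in> S" for i
      using image_eqI[of "g i" ?ev "UVar i" ?W] by (auto simp: S_def)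
    define D where "D = \<lparr>uni = r ` S, opn = (\<lambda>f ts. r (opn B f (map ?ev ts)))\<rparr>"
    have evS: "?ev t \<in> S" "r (?ev t) = t" if "t \<in> uni D" for t
      using that r by (auto simp: D_def)
    have evop: "?ev (opn D f ts) = opn B f (map ?ev ts)"
      if "length ts = ar f" "set ts \<subseteq> uni D" for f ts
    proof -
      have "set (map ?ev ts) \<subseteq> S" using that(2) evS(1) by auto
      then show ?thesis using that(1) r(2) Sop by (simp add: D_def)
    qed
    have D: "is_ualg ar D"
      using gS evS by (auto simp: is_ualg_def D_def subset_iff intro!: imageI Sop)
    have hom: "?ev (utrm_eval D \<rho> t) = utrm_eval B (?ev \<circ> \<rho>) t"
      if "range \<rho> \<subseteq> uni D" "wf_utrm ar t" for \<rho> :: "nat \<Rightarrow> _" and t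
      using that(2)
    proof (induction t)
      case (UVar x)
      then show ?case by simp
    next
      case (UApp f ts)
      have "?ev (utrm_eval D \<rho> (UApp f ts)) = opn B f (map ?ev (map (utrm_eval D \<rho>) ts))"
        using UApp utrm_eval_closed[OF D that(1)] by (auto intro!: evop simp del: map_map)
      also have "map ?ev (map (utrm_eval D \<rho>) ts) = map (utrm_eval B (?ev \<circ> \<rho>)) ts"
        using UApp by (simp add: o_def)
      finally show ?case by (simp add: o_def)
    qed
    have "satisfies_ids D E"
      unfolding satisfies_ids_def
    proof (intro ballI allI impI, clarify)
      fix s t and \<rho> :: "nat \<Rightarrow> _" assume st: "(s, t) \<in> E" and \<rho>: "range \<rho> \<subseteq> uni D"
      have wf: "wf_utrm ar s" "wf_utrm ar t" using E st by auto
      have "range (?ev \<circ> \<rho>) \<subseteq> uni B" using \<rho> evS SB by auto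
      then have "utrm_eval B (?ev \<circ> \<rho>) s = utrm_eval B (?ev \<circ> \<rho>) t"
        using sat st by (auto simp: satisfies_ids_def)
      then have "?ev (utrm_eval D \<rho> s) = ?ev (utrm_eval D \<rho> t)" using hom[OF \<rho>] wf by simp
      then show "utrm_eval D \<rho> s = utrm_eval D \<rho> t"
        using evS utrm_eval_closed[OF D \<rho>] wf by metis
    qed
    then have mod: "ucong_modular ar D" using cm D by (auto simp: cm_variety_def)
    define P where "P \<theta> = {(s, t). s \<in> uni D \<and> t \<in> uni D \<and> (?ev s, ?ev t) \<in> \<theta>}" for \<theta>
    have P: "ucong ar D (P \<theta>)" if \<theta>: "ucong ar B \<theta>" for \<theta>
      unfolding ucong_def
    proof (intro conjI allI impI; (elim conjE)?)
      have "equiv (uni B) \<theta>" using \<theta> by (simp add: ucong_def)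
      then show "equiv (uni D) (P \<theta>)"
        using evS(1) SB
        unfolding equiv_def P_def refl_on_def sym_def trans_def by fast
    next
      fix f ss ts assume l: "length ss = ar f" and al: "list_all2 (\<lambda>s t. (s, t) \<in> P \<theta>) ss ts"
      then have sub: "set ss \<subseteq> uni D" "set ts \<subseteq> uni D" "length ts = ar f"
        by (auto simp: P_def list_all2_conv_all_nth in_set_conv_nth)
      have "list_all2 (\<lambda>s t. (s, t) \<in> \<theta>) (map ?ev ss) (map ?ev ts)"
        using al by (auto simp: P_def list_all2_conv_all_nth)
      then have "(opn B f (map ?ev ss), opn B f (map ?ev ts)) \<in> \<theta>"
        using \<theta> l by (auto simp: ucong_def)
      then show "(opn D f ss, opn D f ts) \<in> P \<theta>"
        using D sub l by (auto simp: P_def evop is_ualg_def)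
    qed
    have P_mono: "P \<alpha> \<subseteq> P \<gamma>" using le by (auto simp: P_def)
    have "(r (g 0), r (g i)) \<in> (P \<alpha> \<union> P \<beta>)\<^sup>*" if "i \<le> N" for i
      using that
    proof (induction i)
      case 0
      then show ?case by simp
    next
      case (Suc i)
      have "(g i, g (Suc i)) \<in> \<alpha> \<union> \<beta>" using z(3)[of i] Suc.prems by (auto simp: g_def min_def)
      then have "(r (g i), r (g (Suc i))) \<in> P \<alpha> \<union> P \<beta>"
        using gS r(2) by (auto simp: P_def D_def)
      then show ?case using Suc by (meson Suc_leD rtrancl.rtrancl_into_rtrancl)
    qed
    from this[of N] have "(r x, r y) \<in> (P \<alpha> \<union> P \<beta>)\<^sup>*" using z by (simp add: g_def)
    moreover have xS: "x \<in> S" "y \<in> S" using gS[of 0] gS[of N] z by (auto simp: g_def)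
    have "(r x, r x) \<in> P \<alpha>"
      using xS r(2) c(1) xyB by (auto simp: P_def D_def ucong_def equiv_def refl_on_def)
    ultimately have "(r x, r y) \<in> (P \<alpha> \<union> P \<beta>)\<^sup>+"
      by (metis UnI1 r_into_trancl trancl_rtrancl_trancl)
    then have "(r x, r y) \<in> ucong_join ar D (P \<alpha>) (P \<beta>) \<inter> P \<gamma>"
      using ucong_join_eq_trancl[OF D P[OF c(1)] P[OF c(2)]] xy\<gamma> xS r(2)
      by (auto simp: P_def D_def)
    also have "\<dots> = ucong_join ar D (P \<alpha>) (P \<beta> \<inter> P \<gamma>)"
      using mod P[OF c(1)] P[OF c(2)] P[OF c(3)] P_mono by (simp add: ucong_modular_def)
    finally have *: "(r x, r y) \<in> ucong_join ar D (P \<alpha>) (P \<beta> \<inter> P \<gamma>)" .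
    show "(x, y) \<in> ucong_join ar B \<alpha> (\<beta> \<inter> \<gamma>)"
      unfolding ucong_join_def
    proof safe
      fix \<theta> assume \<theta>: "ucong ar B \<theta>" "\<alpha> \<subseteq> \<theta>" "\<beta> \<inter> \<gamma> \<subseteq> \<theta>"
      have "(r x, r y) \<in> P \<theta>"
        using * P[OF \<theta>(1)] \<theta>(2,3) by (auto simp: ucong_join_def P_def)
      then show "(x, y) \<in> \<theta>" using xS r(2) by (auto simp: P_def)
    qed
  qed
qed


section \<open>Higher commutators and supernilpotency\<close>

text \<open>Polynomial operations: term operations with some variables replaced by constants \<open>Inr c\<close>.\<close>

definition poly_op :: "('f \<Rightarrow> nat) \<Rightarrow> ('f, 'a) ualg \<Rightarrow> (('v \<Rightarrow> 'a) \<Rightarrow> 'a) \<Rightarrow> bool" where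
  "poly_op ar A f \<longleftrightarrow>
     (\<exists>t :: ('f, 'v + 'a) utrm. wf_utrm ar t \<and> (\<forall>c. Inr c \<in> utrm_vars t \<longrightarrow> c \<in> uni A) \<and>
        f = (\<lambda>\<rho>. utrm_eval A (case_sum \<rho> (\<lambda>c. c)) t))"

text \<open>
  Variables are indexed by pairs (block, position). With \<open>k\<close> the number of leading
  blocks, \<open>block_env k S a b w\<close> puts \<open>b i\<close> into block \<open>i < k\<close> if \<open>i \<in> S\<close> and \<open>a i\<close> otherwise;
  all variables with block index \<open>\<ge> k\<close> belong to the last tuple \<open>w\<close>. Tuples are infinite
  sequences, of which a polynomial reads only finitely many entries.
\<close>

definition block_env ::
    "nat \<Rightarrow> nat set \<Rightarrow> (nat \<Rightarrow> nat \<Rightarrow> 'a) \<Rightarrow> (nat \<Rightarrow> nat \<Rightarrow> 'a) \<Rightarrow> (nat \<times> nat \<Rightarrow> 'a)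
      \<Rightarrow> nat \<times> nat \<Rightarrow> 'a" where
  "block_env k S a b w = (\<lambda>(i, j). if i < k then (if i \<in> S then b i j else a i j) else w (i, j))"

text \<open>
  \<open>centralizes ar A \<alpha>s \<beta> \<gamma>\<close> is \<open>C(\<alpha>\<^sub>1,\<dots>,\<alpha>\<^sub>k,\<beta>;\<gamma>)\<close>. The premise ranges over all
  choices of \<open>a\<^sub>i\<close> or \<open>b\<^sub>i\<close> in each block except the choice of \<open>b\<^sub>i\<close> everywhere; choices are
  distinguished by the set \<open>S\<close> of blocks in which \<open>b\<^sub>i\<close> is chosen, even if \<open>a\<^sub>i = b\<^sub>i\<close>
  for some \<open>i\<close>.
\<close>

definition centralizes ::
    "('f \<Rightarrow> nat) \<Rightarrow> ('f, 'a) ualg \<Rightarrow> ('a \<times> 'a) set list \<Rightarrow> ('a \<times> 'a) set \<Rightarrow> ('a \<times> 'a) set \<Rightarrow> bool"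
  where
  "centralizes ar A \<alpha>s \<beta> \<gamma> \<longleftrightarrow>
     (\<forall>f a b u v.
        poly_op ar A f \<and>
        (\<forall>i<length \<alpha>s. \<forall>j. (a i j, b i j) \<in> \<alpha>s ! i) \<and>
        (\<forall>ij. (u ij, v ij) \<in> \<beta>) \<and>
        (\<forall>S. S \<subset> {..<length \<alpha>s} \<longrightarrow>
           (f (block_env (length \<alpha>s) S a b u), f (block_env (length \<alpha>s) S a b v)) \<in> \<gamma>)
        \<longrightarrow> (f (block_env (length \<alpha>s) {..<length \<alpha>s} a b u),
             f (block_env (length \<alpha>s) {..<length \<alpha>s} a b v)) \<in> \<gamma>)"

definition hcommutator ::
    "('f \<Rightarrow> nat) \<Rightarrow> ('f, 'a) ualg \<Rightarrow> ('a \<times> 'a) set list \<Rightarrow> ('a \<times> 'a) set \<Rightarrow> ('a \<times> 'a) set" where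
  "hcommutator ar A \<alpha>s \<beta> = (LEAST \<gamma>. ucong ar A \<gamma> \<and> centralizes ar A \<alpha>s \<beta> \<gamma>)"

text \<open>The least congruence in the definition of the commutator always exists.\<close>

lemma hcommutator_is_least:
  assumes "is_ualg ar A" "set \<alpha>s \<subseteq> Collect (ucong ar A)" "ucong ar A \<beta>"
  shows "ucong ar A (hcommutator ar A \<alpha>s \<beta>)"
    and "centralizes ar A \<alpha>s \<beta> (hcommutator ar A \<alpha>s \<beta>)"
    and "\<lbrakk>ucong ar A \<gamma>; centralizes ar A \<alpha>s \<beta> \<gamma>\<rbrakk> \<Longrightarrow> hcommutator ar A \<alpha>s \<beta> \<subseteq> \<gamma>"
proof -
  let ?Q = "\<lambda>\<gamma>. ucong ar A \<gamma> \<and> centralizes ar A \<alpha>s \<beta> \<gamma>"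
  let ?G = "\<Inter>{\<gamma>. ?Q \<gamma>}"
  have one: "ucong ar A (uni A \<times> uni A)"
    unfolding ucong_def
  proof (intro conjI allI impI)
    show "equiv (uni A) (uni A \<times> uni A)" by (auto simp: equiv_def refl_on_def sym_def trans_def)
  next
    fix f xs ys assume *: "length xs = ar f \<and> list_all2 (\<lambda>x y. (x, y) \<in> uni A \<times> uni A) xs ys"
    then have "set xs \<subseteq> uni A" "set ys \<subseteq> uni A" "length ys = ar f"
      by (auto simp: list_all2_conv_all_nth in_set_conv_nth)
    then show "(opn A f xs, opn A f ys) \<in> uni A \<times> uni A"
      using assms(1) * by (auto simp: is_ualg_def)
  qed
  have env: "range (block_env (length \<alpha>s) S a b u) \<subseteq> uni A"
    if "\<forall>i<length \<alpha>s. \<forall>j. (a i j, b i j) \<in> \<alpha>s ! i" "\<forall>ij. u ij \<in> uni A" for S a b u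
  proof -
    have "a i j \<in> uni A \<and> b i j \<in> uni A" if "i < length \<alpha>s" for i j
    proof -
      have "ucong ar A (\<alpha>s ! i)" using assms(2) that by (auto simp: subset_iff)
      moreover have "(a i j, b i j) \<in> \<alpha>s ! i"
        using \<open>\<forall>i<length \<alpha>s. \<forall>j. (a i j, b i j) \<in> \<alpha>s ! i\<close> that by blast
      ultimately show ?thesis by (auto simp: ucong_def equiv_def)
    qed
    then show ?thesis using that(2) by (auto simp: block_env_def)
  qed
  have clo: "f \<rho> \<in> uni A" if f: "poly_op ar A f" and \<rho>: "range \<rho> \<subseteq> uni A"
    for f and \<rho> :: "nat \<times> nat \<Rightarrow> 'b"
  proof -
    from f obtain t :: "('a, nat \<times> nat + 'b) utrm" where t: "wf_utrm ar t"
      "\<forall>c. Inr c \<in> utrm_vars t \<longrightarrow> c \<in> uni A" "f = (\<lambda>\<rho>. utrm_eval A (case_sum \<rho> (\<lambda>c. c)) t)"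
      unfolding poly_op_def by blast
    have "utrm_eval A (case_sum \<rho> (\<lambda>c. c)) t \<in> uni A"
      using t(1,2)
    proof (induction t)
      case (UVar x)
      then show ?case using \<rho> by (cases x) auto
    next
      case (UApp g ts)
      then have "set (map (utrm_eval A (case_sum \<rho> (\<lambda>c. c))) ts) \<subseteq> uni A" by fastforce
      then show ?case using assms(1) UApp.prems by (simp add: is_ualg_def)
    qed
    then show ?thesis using t(3) by simp
  qed
  have "centralizes ar A \<alpha>s \<beta> (uni A \<times> uni A)"
    unfolding centralizes_def
  proof (intro allI impI; elim conjE)
    fix f :: "(nat \<times> nat \<Rightarrow> 'b) \<Rightarrow> 'b" and a b :: "nat \<Rightarrow> nat \<Rightarrow> 'b"
      and u v :: "nat \<times> nat \<Rightarrow> 'b"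
    assume *: "poly_op ar A f" "\<forall>i<length \<alpha>s. \<forall>j. (a i j, b i j) \<in> \<alpha>s ! i"
      "\<forall>ij. (u ij, v ij) \<in> \<beta>"
    have "\<forall>ij. u ij \<in> uni A" "\<forall>ij. v ij \<in> uni A"
      using *(3) assms(3) by (auto simp: ucong_def equiv_def)
    then show "(f (block_env (length \<alpha>s) {..<length \<alpha>s} a b u),
        f (block_env (length \<alpha>s) {..<length \<alpha>s} a b v)) \<in> uni A \<times> uni A"
      using clo[OF *(1)] env[OF *(2)] by simp
  qed
  then have ex: "?Q (uni A \<times> uni A)" using one by blast
  have "equiv (uni A) ?G"
  proof (rule equivI)
    show "?G \<subseteq> uni A \<times> uni A" using ex by blast
    show "refl_on (uni A) ?G" by (auto simp: refl_on_def ucong_def equiv_def)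
    show "sym ?G" by (auto simp: sym_def ucong_def equiv_def)
    show "trans ?G"
    proof (intro transI InterI)
      fix x y z r assume *: "(x, y) \<in> ?G" "(y, z) \<in> ?G" and r: "r \<in> {\<gamma>. ?Q \<gamma>}"
      have "(x, y) \<in> r" "(y, z) \<in> r" using InterD[OF *(1) r] InterD[OF *(2) r] .
      moreover have "trans r" using r by (simp add: ucong_def equiv_def)
      ultimately show "(x, z) \<in> r" by (meson transD)
    qed
  qed
  moreover have "(opn A f xs, opn A f ys) \<in> ?G"
    if "length xs = ar f" "list_all2 (\<lambda>x y. (x, y) \<in> ?G) xs ys" for f xs ys
  proof (rule InterI)
    fix r assume r: "r \<in> {\<gamma>. ?Q \<gamma>}"
    have "list_all2 (\<lambda>x y. (x, y) \<in> r) xs ys"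
      using that(2) InterD[OF _ r] by (rule list_all2_mono)
    then show "(opn A f xs, opn A f ys) \<in> r"
      using r that(1) by (simp add: ucong_def)
  qed
  ultimately have "ucong ar A ?G" unfolding ucong_def[of ar A ?G] by blast
  moreover have "centralizes ar A \<alpha>s \<beta> ?G"
    unfolding centralizes_def[of ar A \<alpha>s \<beta> ?G]
  proof (intro allI impI InterI)
    fix f :: "(nat \<times> nat \<Rightarrow> 'b) \<Rightarrow> 'b" and a b :: "nat \<Rightarrow> nat \<Rightarrow> 'b"
      and u v :: "nat \<times> nat \<Rightarrow> 'b" and r
    let ?env = "\<lambda>S. block_env (length \<alpha>s) S a b"
    assume *: "poly_op ar A f \<and> (\<forall>i<length \<alpha>s. \<forall>j. (a i j, b i j) \<in> \<alpha>s ! i) \<and>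
        (\<forall>ij. (u ij, v ij) \<in> \<beta>) \<and>
        (\<forall>S. S \<subset> {..<length \<alpha>s} \<longrightarrow> (f (?env S u), f (?env S v)) \<in> ?G)"
      and r: "r \<in> {\<gamma>. ?Q \<gamma>}"
    have "\<forall>S. S \<subset> {..<length \<alpha>s} \<longrightarrow> (f (?env S u), f (?env S v)) \<in> r"
      using * InterD[OF _ r] by simp
    moreover have "centralizes ar A \<alpha>s \<beta> r" using r by simp
    ultimately show "(f (?env {..<length \<alpha>s} u), f (?env {..<length \<alpha>s} v)) \<in> r"
      using * unfolding centralizes_def by simp
  qed
  ultimately have Q: "?Q ?G" by (rule conjI)
  have "hcommutator ar A \<alpha>s \<beta> = ?G"
    unfolding hcommutator_def
  proof (rule Least_equality)
    show "?Q ?G" by (rule Q)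
    show "?G \<subseteq> y" if "?Q y" for y using that by (intro Inter_lower) simp
  qed
  then show "ucong ar A (hcommutator ar A \<alpha>s \<beta>)"
    and "centralizes ar A \<alpha>s \<beta> (hcommutator ar A \<alpha>s \<beta>)"
    and "\<lbrakk>ucong ar A \<gamma>; centralizes ar A \<alpha>s \<beta> \<gamma>\<rbrakk> \<Longrightarrow> hcommutator ar A \<alpha>s \<beta> \<subseteq> \<gamma>"
    using Q by (simp_all add: Inter_lower)
qed

definition k_supernilpotent :: "('f \<Rightarrow> nat) \<Rightarrow> ('f, 'a) ualg \<Rightarrow> nat \<Rightarrow> bool" where
  "k_supernilpotent ar A k \<longleftrightarrow>
     hcommutator ar A (replicate k (uni A \<times> uni A)) (uni A \<times> uni A) = Id_on (uni A)"

definition supernilpotent :: "('f \<Rightarrow> nat) \<Rightarrow> ('f, 'a) ualg \<Rightarrow> bool" where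
  "supernilpotent ar A \<longleftrightarrow> (\<exists>k\<ge>1. k_supernilpotent ar A k)"


section \<open>Circuits and CSAT\<close>

text \<open>
  The nodes of a circuit with \<open>n\<close> variables are numbered in a topological order: nodes
  \<open>0, \<dots>, n - 1\<close> are the variables, node \<open>n + i\<close> is the \<open>i\<close>-th entry of the gate list, and
  the wires into a gate come from nodes with smaller numbers.
\<close>

datatype ('f, 'a) gate = GConst 'a | GOp 'f "nat list"

record ('f, 'a) circuit =
  n_inputs :: nat
  gates :: "('f, 'a) gate list"
  out1 :: nat
  out2 :: nat

fun wf_gate :: "('f \<Rightarrow> nat) \<Rightarrow> ('f, 'a) ualg \<Rightarrow> nat \<Rightarrow> ('f, 'a) gate \<Rightarrow> bool" where
  "wf_gate ar A i (GConst a) \<longleftrightarrow> a \<in> uni A"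
| "wf_gate ar A i (GOp f js) \<longleftrightarrow> length js = ar f \<and> (\<forall>j\<in>set js. j < i)"

definition wf_circuit :: "('f \<Rightarrow> nat) \<Rightarrow> ('f, 'a) ualg \<Rightarrow> ('f, 'a) circuit \<Rightarrow> bool" where
  "wf_circuit ar A C \<longleftrightarrow>
     (\<forall>i<length (gates C). wf_gate ar A (n_inputs C + i) (gates C ! i)) \<and>
     out1 C < n_inputs C + length (gates C) \<and> out2 C < n_inputs C + length (gates C)"

fun gate_eval :: "('f, 'a) ualg \<Rightarrow> 'a list \<Rightarrow> ('f, 'a) gate \<Rightarrow> 'a" where
  "gate_eval A vs (GConst a) = a"
| "gate_eval A vs (GOp f js) = opn A f (map (\<lambda>j. vs ! j) js)"

text \<open>The list of the values of all nodes, starting from the values of the variables.\<close>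

fun gates_eval :: "('f, 'a) ualg \<Rightarrow> 'a list \<Rightarrow> ('f, 'a) gate list \<Rightarrow> 'a list" where
  "gates_eval A vs [] = vs"
| "gates_eval A vs (g # gs) = gates_eval A (vs @ [gate_eval A vs g]) gs"

definition valuations :: "('f, 'a) ualg \<Rightarrow> nat \<Rightarrow> 'a list set" where
  "valuations A n = {xs. length xs = n \<and> set xs \<subseteq> uni A}"

definition is_solution :: "('f, 'a) ualg \<Rightarrow> ('f, 'a) circuit \<Rightarrow> 'a list \<Rightarrow> bool" where
  "is_solution A C xs \<longleftrightarrow>
     gates_eval A xs (gates C) ! out1 C = gates_eval A xs (gates C) ! out2 C"

definition CSAT :: "('f, 'a) ualg \<Rightarrow> ('f, 'a) circuit \<Rightarrow> bool" where
  "CSAT A C \<longleftrightarrow> (\<exists>xs\<in>valuations A (n_inputs C). is_solution A C xs)"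

text \<open>The input size: number of nodes, wires and output pointers.\<close>

fun gate_size :: "('f, 'a) gate \<Rightarrow> nat" where
  "gate_size (GConst a) = 1"
| "gate_size (GOp f js) = 1 + length js"

definition circuit_size :: "('f, 'a) circuit \<Rightarrow> nat" where
  "circuit_size C = n_inputs C + (\<Sum>g\<leftarrow>gates C. gate_size g) + 2"


section \<open>Black-box algorithms and their running time\<close>

text \<open>
  Candidate valuations are produced by a uniform-cost random access machine with structured
  control. Its memory consists of registers holding natural numbers and a write-only tape
  of elements of the algebra. \<open>REmit\<close> outputs the first \<open>n\<close> tape cells as the next candidate.

  The constructors mean, in this order: \<open>X\<^sub>r := c\<close>; \<open>X\<^sub>r := X\<^sub>i + X\<^sub>j\<close>; \<open>X\<^sub>r := X\<^sub>i - X\<^sub>j\<close> (truncated);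
  \<open>X\<^sub>r := X[X\<^sub>i]\<close>; \<open>X[X\<^sub>r] := X\<^sub>i\<close>; tape cell \<open>X\<^sub>r := a\<close>; output; sequencing;
  test of \<open>X\<^sub>r \<noteq> 0\<close>; loop while \<open>X\<^sub>r \<noteq> 0\<close>.
\<close>

datatype 'a ram =
    RConst nat nat
  | RAdd nat nat nat
  | RSub nat nat nat
  | RLoad nat nat
  | RStore nat nat
  | RWrite nat 'a
  | REmit
  | RSeq "'a ram" "'a ram"
  | RIf nat "'a ram" "'a ram"
  | RWhile nat "'a ram"

type_synonym 'a ram_state = "(nat \<Rightarrow> nat) \<times> (nat \<Rightarrow> 'a)"

text \<open>
  \<open>ram_exec n p s H t s'\<close>: started in \<open>s\<close>, the program \<open>p\<close> halts in \<open>s'\<close> after \<open>t\<close> steps,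
  having output the list \<open>H\<close> of tuples of length \<open>n\<close>.
\<close>

inductive ram_exec ::
    "nat \<Rightarrow> 'a ram \<Rightarrow> 'a ram_state \<Rightarrow> 'a list list \<Rightarrow> nat \<Rightarrow> 'a ram_state \<Rightarrow> bool" for n where
  RConst: "ram_exec n (RConst r c) (X, T) [] 1 (X(r := c), T)"
| RAdd: "ram_exec n (RAdd r i j) (X, T) [] 1 (X(r := X i + X j), T)"
| RSub: "ram_exec n (RSub r i j) (X, T) [] 1 (X(r := X i - X j), T)"
| RLoad: "ram_exec n (RLoad r i) (X, T) [] 1 (X(r := X (X i)), T)"
| RStore: "ram_exec n (RStore r i) (X, T) [] 1 (X(X r := X i), T)"
| RWrite: "ram_exec n (RWrite r a) (X, T) [] 1 (X, T(X r := a))"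
| REmit: "ram_exec n REmit (X, T) [map T [0..<n]] 1 (X, T)"
| RSeq: "ram_exec n p s H1 t1 s' \<Longrightarrow> ram_exec n p' s' H2 t2 s''
    \<Longrightarrow> ram_exec n (RSeq p p') s (H1 @ H2) (t1 + t2) s''"
| RIf_True: "X r \<noteq> 0 \<Longrightarrow> ram_exec n p (X, T) H t s'
    \<Longrightarrow> ram_exec n (RIf r p p') (X, T) H (1 + t) s'"
| RIf_False: "X r = 0 \<Longrightarrow> ram_exec n p' (X, T) H t s'
    \<Longrightarrow> ram_exec n (RIf r p p') (X, T) H (1 + t) s'"
| RWhile_True: "X r \<noteq> 0 \<Longrightarrow> ram_exec n p (X, T) H1 t1 s'
    \<Longrightarrow> ram_exec n (RWhile r p) s' H2 t2 s''
    \<Longrightarrow> ram_exec n (RWhile r p) (X, T) (H1 @ H2) (1 + t1 + t2) s''"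
| RWhile_False: "X r = 0 \<Longrightarrow> ram_exec n (RWhile r p) (X, T) [] 1 (X, T)"

lemma ram_exec_deterministic:
  "ram_exec n p s H t s' \<Longrightarrow> ram_exec n p s H' t' s'' \<Longrightarrow> H' = H \<and> t' = t \<and> s'' = s'"
  apply (induction arbitrary: H' t' s'' rule: ram_exec.induct)
  subgoal by (erule ram_exec.cases) auto
  subgoal by (erule ram_exec.cases) auto
  subgoal by (erule ram_exec.cases) auto
  subgoal by (erule ram_exec.cases) auto
  subgoal by (erule ram_exec.cases) auto
  subgoal by (erule ram_exec.cases) auto
  subgoal by (erule ram_exec.cases) auto
  subgoal premises prems for p s H1 t1 s1 p' H2 t2 s2
    using prems(5) by (cases rule: ram_exec.cases) (metis prems(2,4))
  subgoal premises prems for X r p T H t s1 p'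
    using prems(4)
    by (cases rule: ram_exec.cases) (use prems(1,3) in auto)
  subgoal premises prems for X r p T H t s1 p'
    using prems(4)
    by (cases rule: ram_exec.cases) (use prems(1,3) in auto)
  subgoal premises prems for X r p T H1 t1 s1 H2 t2 s2
    using prems(6) by (cases rule: ram_exec.cases) (metis prems(3,5), metis prems(1))
  subgoal by (erule ram_exec.cases) auto
  done

text \<open>The only input of the generator is the number \<open>n\<close> of variables, in register 0.\<close>

definition generates :: "'a ram \<Rightarrow> nat \<Rightarrow> 'a list list \<Rightarrow> nat \<Rightarrow> bool" where
  "generates p n H t \<longleftrightarrow>
     (\<exists>s'. ram_exec n p ((\<lambda>_. 0)(0 := n), (\<lambda>_. undefined)) H t s')"

text \<open>
  Time to test one candidate: read in its entries, evaluate the gates one after the other (one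
  step per gate and one per wire), and compare the two outputs.
\<close>

fun gate_time :: "('f, 'a) gate \<Rightarrow> nat" where
  "gate_time (GConst a) = 1"
| "gate_time (GOp f js) = 1 + length js"

definition test_time :: "('f, 'a) circuit \<Rightarrow> nat" where
  "test_time C = n_inputs C + (\<Sum>g\<leftarrow>gates C. gate_time g) + 1"

text \<open>
  \<open>black_box_run A p C ans t\<close>: the black-box algorithm whose candidates (hitting set) are generated
  by \<open>p\<close> gives the answer \<open>ans\<close> on the circuit \<open>C\<close> in time \<open>t\<close>.
\<close>

definition black_box_run ::
    "('f, 'a) ualg \<Rightarrow> 'a ram \<Rightarrow> ('f, 'a) circuit \<Rightarrow> bool \<Rightarrow> nat \<Rightarrow> bool" where
  "black_box_run A p C ans t \<longleftrightarrow>
     (\<exists>H t\<^sub>0. generates p (n_inputs C) H t\<^sub>0 \<and> set H \<subseteq> valuations A (n_inputs C) \<and>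
        (ans \<longleftrightarrow> (\<exists>xs\<in>set H. is_solution A C xs)) \<and>
        t = t\<^sub>0 + (\<Sum>xs\<leftarrow>H. test_time C))"

end

theory Submission
  imports Defs "HOL-Number_Theory.Residues"
begin

text \<open>
  By congruence modularity the algebra has Day polynomials. Call a map \<open>w \<mapsto> T b w\<close>, with \<open>T\<close> a polynomial,
  collapsing if \<open>T a w\<close> is independent of \<open>w\<close> for some tuple \<open>a\<close>. Supernilpotency of degree \<open>k\<close> says in
  particular that every composition of \<open>k\<close> collapsing maps is constant, and Day polynomials turn this into a
  central series; iterating the difference polynomial along it yields a Mal'cev polynomial.
  Since the order is a power of the prime \<open>q\<close>, the central series can be refined to one with elementary
  abelian factors, so elements get at most \<open>h\<close> coordinates modulo \<open>q\<close> in which each basic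
  operation is affine on every level once the lower levels are fixed. Hence the coordinate \<open>c\<close> of
  any gate, as a function of the inputs, is a sum of functions of at most \<open>(1 + m (q - 1)) ^ c\<close> inputs each,
  and the indicator function of the solution set is a sum of functions of at most \<open>(m q) ^ h = d\<close> inputs.
  By inclusion-exclusion such a function vanishes if it vanishes at all tuples with at
  most \<open>d\<close> entries different from a fixed element, so these tuples form a hitting set.
\<close>

section \<open>Polynomials and congruences\<close>

text \<open>The degree of supernilpotency does not enter d: it bounds the length of the central
  series, while the degree count runs along the coordinates. The Mal'cev polynomial p has two tasks.
  On a central factor it acts as x - y + z and makes the factor an abelian group; and as p z x y is
  injective in z, all classes of a congruence have the same size, so the order of this group is a
  power of q. Coordinates are taken modulo the q-th powers because endomorphisms of the group act
  there by matrices modulo q. The base B = 1 + m (q - 1) comes from a recursion. On each level the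
  linear part has constant coefficients and does not raise the number of inputs. What remains of a
  coordinate is a function of s lower coordinates of at most m arguments, and interpolation over the
  field with q elements multiplies the sum of their bounds by q - 1. Powers of B solve this, as m (q
  - 1) (1 + B + ... + B^(s - 1)) = B^s - 1. So the bound is the same at every gate, whatever the
  depth of the circuit.\<close>

lemma poly_op_var: "poly_op ar A (\<lambda>\<rho>. \<rho> v)"
  unfolding poly_op_def by (rule exI[of _ "UVar (Inl v)"]) auto

lemma poly_op_const: "c \<in> uni A \<Longrightarrow> poly_op ar A (\<lambda>\<rho>. c)"
  unfolding poly_op_def by (rule exI[of _ "UVar (Inr c)"]) auto

lemma poly_op_app:
  assumes "length gs = ar f" "\<forall>g\<in>set gs. poly_op ar A g"
  shows "poly_op ar A (\<lambda>\<rho>. opn A f (map (\<lambda>g. g \<rho>) gs))"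
proof -
  have "\<forall>g\<in>set gs. \<exists>t. wf_utrm ar t \<and> (\<forall>c. Inr c \<in> utrm_vars t \<longrightarrow> c \<in> uni A) \<and>
      g = (\<lambda>\<rho>. utrm_eval A (case_sum \<rho> (\<lambda>c. c)) t)"
    using assms(2) unfolding poly_op_def by blast
  from bchoice[OF this] obtain tm where tm: "\<forall>g\<in>set gs. wf_utrm ar (tm g) \<and>
      (\<forall>c. Inr c \<in> utrm_vars (tm g) \<longrightarrow> c \<in> uni A)"
    and eval_tm: "\<And>g \<rho>. g \<in> set gs \<Longrightarrow> g \<rho> = utrm_eval A (case_sum \<rho> (\<lambda>c. c)) (tm g)"
    by (metis (no_types, lifting))
  have eq: "map (\<lambda>g. g \<rho>) gs = map (utrm_eval A (case_sum \<rho> (\<lambda>c. c)) \<circ> tm) gs" for \<rho>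
    using eval_tm by auto
  show ?thesis
    unfolding poly_op_def using tm assms(1)
    by (intro exI[of _ "UApp f (map tm gs)"]) (auto simp: eq simp del: map_eq_conv)
qed

lemma ucong_subset: "ucong ar A \<theta> \<Longrightarrow> (x, y) \<in> \<theta> \<Longrightarrow> x \<in> uni A \<and> y \<in> uni A"
  by (auto simp: ucong_def equiv_def)

lemma ucong_refl: "ucong ar A \<theta> \<Longrightarrow> x \<in> uni A \<Longrightarrow> (x, x) \<in> \<theta>"
  by (auto simp: ucong_def equiv_def refl_on_def)

lemma ucong_sym: "ucong ar A \<theta> \<Longrightarrow> (x, y) \<in> \<theta> \<Longrightarrow> (y, x) \<in> \<theta>"
  by (auto simp: ucong_def equiv_def sym_def)

lemma ucong_trans: "ucong ar A \<theta> \<Longrightarrow> (x, y) \<in> \<theta> \<Longrightarrow> (y, z) \<in> \<theta> \<Longrightarrow> (x, z) \<in> \<theta>"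
  by (auto simp: ucong_def equiv_def trans_def)

lemma ucong_inter:
  assumes a: "ucong ar A \<alpha>" and b: "ucong ar A \<beta>"
  shows "ucong ar A (\<alpha> \<inter> \<beta>)"
  unfolding ucong_def
proof (intro conjI allI impI)
  show "equiv (uni A) (\<alpha> \<inter> \<beta>)"
    using a b by (auto simp: ucong_def equiv_def refl_on_def intro: sym_Int trans_Int)
next
  fix f xs ys assume *: "length xs = ar f \<and> list_all2 (\<lambda>x y. (x, y) \<in> \<alpha> \<inter> \<beta>) xs ys"
  then have "list_all2 (\<lambda>x y. (x, y) \<in> \<alpha>) xs ys" "list_all2 (\<lambda>x y. (x, y) \<in> \<beta>) xs ys"
    by (auto elim!: list_all2_mono)
  then show "(opn A f xs, opn A f ys) \<in> \<alpha> \<inter> \<beta>" using a b * by (simp add: ucong_def)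
qed

locale ualgebra =
  fixes ar :: "'f \<Rightarrow> nat" and A :: "('f, 'a) ualg"
  assumes ualg: "is_ualg ar A"
begin

abbreviation U :: "'a set" where "U \<equiv> uni A"

lemma opn_closed: "length xs = ar f \<Longrightarrow> set xs \<subseteq> U \<Longrightarrow> opn A f xs \<in> U"
  using ualg by (auto simp: is_ualg_def)

lemma ucong_Id_on: "ucong ar A (Id_on U)"
proof -
  have "xs = ys \<and> set xs \<subseteq> U" if "list_all2 (\<lambda>x y. (x, y) \<in> Id_on U) xs ys" for xs ys
    using that by (induction rule: list_all2_induct) auto
  then show ?thesis using opn_closed
    by (fastforce simp: ucong_def equiv_def refl_on_def sym_def trans_def)
qed

lemma ucong_full: "ucong ar A (U \<times> U)"
proof -
  have "set xs \<subseteq> U \<and> set ys \<subseteq> U \<and> length ys = length xs"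
    if "list_all2 (\<lambda>x y. (x, y) \<in> U \<times> U) xs ys" for xs ys
    using that by (induction rule: list_all2_induct) auto
  then show ?thesis using opn_closed
    by (fastforce simp: ucong_def equiv_def refl_on_def sym_def trans_def)
qed

text \<open>Arguments are exchanged one at a time from the left and the changes combined by
  transitivity, so compatibility need only be checked in a single argument, as is done for
  \<open>upper_central\<close>.\<close>

lemma ucong_of_translations:
  assumes eq: "equiv U \<theta>"
    and tr: "\<And>f us vs x y. (x, y) \<in> \<theta> \<Longrightarrow> set us \<subseteq> U \<Longrightarrow> set vs \<subseteq> U \<Longrightarrow>
      length us + 1 + length vs = ar f \<Longrightarrow> (opn A f (us @ x # vs), opn A f (us @ y # vs)) \<in> \<theta>"
  shows "ucong ar A \<theta>"
proof -
  have sub: "\<theta> \<subseteq> U \<times> U" and refl: "\<And>x. x \<in> U \<Longrightarrow> (x, x) \<in> \<theta>"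
    and tra: "\<And>x y z. (x, y) \<in> \<theta> \<Longrightarrow> (y, z) \<in> \<theta> \<Longrightarrow> (x, z) \<in> \<theta>"
    using eq by (auto simp: equiv_def refl_on_def trans_def)
  have main: "(opn A f (us @ xs), opn A f (us @ ys)) \<in> \<theta>"
    if "list_all2 (\<lambda>x y. (x, y) \<in> \<theta>) xs ys" "set us \<subseteq> U" "length us + length xs = ar f"
    for f us xs ys
    using that
  proof (induction xs ys arbitrary: us rule: list_all2_induct)
    case Nil
    then show ?case using refl opn_closed by auto
  next
    case (Cons x xs y ys)
    have xs: "set xs \<subseteq> U" and y: "y \<in> U"
      using Cons(1,2) sub by (fastforce simp: list_all2_conv_all_nth in_set_conv_nth)+
    have "(opn A f (us @ x # xs), opn A f (us @ y # xs)) \<in> \<theta>"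
      using tr[OF Cons(1)] Cons.prems xs by auto
    moreover have "(opn A f ((us @ [y]) @ xs), opn A f ((us @ [y]) @ ys)) \<in> \<theta>"
      using Cons.prems y by (intro Cons.IH) auto
    ultimately show ?case by (auto intro: tra)
  qed
  show ?thesis
    unfolding ucong_def using eq main[where us = "[]"] by auto
qed

text \<open>
  Polynomials \<open>t z w\<close> with one distinguished variable \<open>w\<close>; the other variables form an
  infinite tuple \<open>z\<close>, of which only finitely many entries matter.
\<close>

inductive pol :: "((nat \<Rightarrow> 'a) \<Rightarrow> 'a \<Rightarrow> 'a) \<Rightarrow> bool" where
  pol_const: "c \<in> U \<Longrightarrow> pol (\<lambda>z w. c)"
| pol_proj: "pol (\<lambda>z w. z i)"
| pol_arg: "pol (\<lambda>z w. w)"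
| pol_op: "length ts = ar f \<Longrightarrow> \<forall>t\<in>set ts. pol t \<Longrightarrow> pol (\<lambda>z w. opn A f (map (\<lambda>t. t z w) ts))"

lemma pol_closed: "pol t \<Longrightarrow> range z \<subseteq> U \<Longrightarrow> w \<in> U \<Longrightarrow> t z w \<in> U"
proof (induction rule: pol.induct)
  case (pol_op ts f)
  then show ?case by (intro opn_closed) auto
qed auto

lemma pol_subst:
  assumes "pol t" "\<And>i. pol (\<sigma> i)" "pol \<omega>"
  shows "pol (\<lambda>z w. t (\<lambda>i. \<sigma> i z w) (\<omega> z w))"
  using assms(1)
proof (induction rule: pol.induct)
  case (pol_op ts f)
  then have "pol (\<lambda>z w. opn A f (map (\<lambda>t. t z w) (map (\<lambda>t z w. t (\<lambda>i. \<sigma> i z w) (\<omega> z w)) ts)))"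
    by (intro pol.pol_op) auto
  then show ?case by (simp add: o_def)
qed (use assms pol.intros in auto)

lemma pol_cong:
  assumes \<theta>: "ucong ar A \<theta>" and "pol t" "\<And>i. (a i, b i) \<in> \<theta>" "(u, v) \<in> \<theta>"
  shows "(t a u, t b v) \<in> \<theta>"
  using assms(2)
proof (induction rule: pol.induct)
  case (pol_op ts f)
  then have "list_all2 (\<lambda>x y. (x, y) \<in> \<theta>) (map (\<lambda>t. t a u) ts) (map (\<lambda>t. t b v) ts)"
    by (auto simp: list_all2_conv_all_nth)
  then show ?case using \<theta> pol_op by (simp add: ucong_def)
qed (use assms ucong_refl[OF \<theta>] in auto)

lemma pol_utrm_eval: "wf_utrm ar t \<Longrightarrow> (\<And>i. pol (\<sigma> i)) \<Longrightarrow> pol (\<lambda>z w. utrm_eval A (\<lambda>i. \<sigma> i z w) t)"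
proof (induction t)
  case (UApp f ts)
  then have "pol (\<lambda>z w. opn A f (map (\<lambda>t. t z w) (map (\<lambda>t z w. utrm_eval A (\<lambda>i. \<sigma> i z w) t) ts)))"
    by (intro pol.pol_op) auto
  then show ?case by (simp add: o_def)
qed auto

lemma poly_op_pol:
  assumes "pol t" "\<And>i. poly_op ar A (\<sigma> i)" "poly_op ar A \<omega>"
  shows "poly_op ar A (\<lambda>\<rho>. t (\<lambda>i. \<sigma> i \<rho>) (\<omega> \<rho>))"
  using assms(1)
proof (induction rule: pol.induct)
  case (pol_op ts f)
  then have "poly_op ar A
      (\<lambda>\<rho>. opn A f (map (\<lambda>g. g \<rho>) (map (\<lambda>t \<rho>. t (\<lambda>i. \<sigma> i \<rho>) (\<omega> \<rho>)) ts)))"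
    by (intro poly_op_app) auto
  then show ?case by (simp add: o_def)
qed (use assms poly_op_const in auto)

text \<open>\<open>pol\<close> has no arity, so an operation of fixed arity is a polynomial in the
  first entries of the tuple z.\<close>

definition pol4 :: "('a \<Rightarrow> 'a \<Rightarrow> 'a \<Rightarrow> 'a \<Rightarrow> 'a) \<Rightarrow> bool" where
  "pol4 M \<longleftrightarrow> pol (\<lambda>z w. M (z 0) (z 1) (z 2) (z 3))"

definition pol3 :: "('a \<Rightarrow> 'a \<Rightarrow> 'a \<Rightarrow> 'a) \<Rightarrow> bool" where
  "pol3 p \<longleftrightarrow> pol (\<lambda>z w. p (z 0) (z 1) (z 2))"

lemma pol4_app:
  assumes "pol4 M" "pol t0" "pol t1" "pol t2" "pol t3"
  shows "pol (\<lambda>z w. M (t0 z w) (t1 z w) (t2 z w) (t3 z w))"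
  using pol_subst[of _ "\<lambda>i. if i = 0 then t0 else if i = 1 then t1 else if i = 2 then t2 else t3",
      OF assms(1)[unfolded pol4_def] _ pol_arg] assms by simp

lemma pol3_app:
  assumes "pol3 p" "pol t0" "pol t1" "pol t2"
  shows "pol (\<lambda>z w. p (t0 z w) (t1 z w) (t2 z w))"
  using pol_subst[of _ "\<lambda>i. if i = 0 then t0 else if i = 1 then t1 else t2",
      OF assms(1)[unfolded pol3_def] _ pol_arg] assms by simp

lemma pol3_closed:
  assumes "pol3 p" "x \<in> U" "y \<in> U" "z \<in> U"
  shows "p x y z \<in> U"
  using pol_closed[OF pol3_app[OF assms(1), of "\<lambda>_ _. x" "\<lambda>_ _. y" "\<lambda>_ _. z"],
      of "\<lambda>_. x" x] assms pol_const by auto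

lemma pol4_cong:
  assumes \<theta>: "ucong ar A \<theta>" and "pol4 M" "(x, x') \<in> \<theta>" "(y, y') \<in> \<theta>" "(z, z') \<in> \<theta>" "(w, w') \<in> \<theta>"
  shows "(M x y z w, M x' y' z' w') \<in> \<theta>"
  using pol_cong[OF \<theta> assms(2)[unfolded pol4_def],
      of "\<lambda>i. if i = 0 then x else if i = 1 then y else if i = 2 then z else w"
         "\<lambda>i. if i = 0 then x' else if i = 1 then y' else if i = 2 then z' else w'", OF _ assms(3)] assms
  by simp

lemma pol3_cong:
  assumes \<theta>: "ucong ar A \<theta>" and "pol3 p" "(x, x') \<in> \<theta>" "(y, y') \<in> \<theta>" "(z, z') \<in> \<theta>"
  shows "(p x y z, p x' y' z') \<in> \<theta>"
  using pol_cong[OF \<theta> assms(2)[unfolded pol3_def],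
      of "\<lambda>i. if i = 0 then x else if i = 1 then y else z"
         "\<lambda>i. if i = 0 then x' else if i = 1 then y' else z'", OF _ assms(3)] assms
  by simp

lemma pol_fix:
  assumes "pol t"
  shows "range a \<subseteq> U \<Longrightarrow> pol \<omega> \<Longrightarrow> pol (\<lambda>z w. t a (\<omega> z w))"
    and "pol \<omega> \<Longrightarrow> pol (\<lambda>z w. t z (\<omega> z w))"
  using pol_subst[OF assms, of "\<lambda>i z w. a i" \<omega>] pol_subst[OF assms, of "\<lambda>i z w. z i" \<omega>]
  by (auto intro: pol.intros)

end

section \<open>Day polynomials, nilpotency and a Mal'cev polynomial\<close>

lemma utrm_eval_pointwise:
  assumes "\<And>f gs. opn B f gs = (\<lambda>\<rho>. opn A f (map (\<lambda>g. g \<rho>) gs))"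
  shows "utrm_eval B \<sigma> t = (\<lambda>\<rho>. utrm_eval A (\<lambda>i. \<sigma> i \<rho>) t)"
proof (induction t)
  case (UApp f ts)
  then have "map (\<lambda>g. g \<rho>) (map (utrm_eval B \<sigma>) ts) = map (utrm_eval A (\<lambda>i. \<sigma> i \<rho>)) ts" for \<rho>
    by auto
  then show ?case unfolding utrm_eval.simps assms by presburger
qed simp

lemma trancl_seq:
  assumes "(x, y) \<in> R\<^sup>+"
  shows "\<exists>(n :: nat) g. g 0 = x \<and> g n = y \<and> (\<forall>i<n. (g i, g (Suc i)) \<in> R)"
proof -
  obtain n where "(x, y) \<in> R ^^ n" using assms by (auto simp: trancl_power)
  then show ?thesis unfolding relpow_fun_conv by blast
qed

context ualgebra begin

text \<open>
  Day's condition. It is read off the algebra of term functions, using kernels of restriction maps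
  as congruences; consecutive \<open>M i\<close> are linked in one of two ways, in no particular order.
\<close>

definition day_chain :: "(nat \<Rightarrow> 'a \<Rightarrow> 'a \<Rightarrow> 'a \<Rightarrow> 'a \<Rightarrow> 'a) \<Rightarrow> nat \<Rightarrow> bool" where
  "day_chain M n \<longleftrightarrow> (\<forall>i\<le>n. pol4 (M i)) \<and>
     (\<forall>x\<in>U. \<forall>y\<in>U. \<forall>z\<in>U. \<forall>u\<in>U. M 0 x y z u = x \<and> M n x y z u = u) \<and>
     (\<forall>i\<le>n. \<forall>x\<in>U. \<forall>y\<in>U. M i x y y x = x) \<and>
     (\<forall>i<n. (\<forall>x\<in>U. \<forall>u\<in>U. M i x x u u = M (Suc i) x x u u) \<or>
            (\<forall>x\<in>U. \<forall>y\<in>U. \<forall>u\<in>U. M i x y y u = M (Suc i) x y y u))"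

text \<open>The modular law is applied to the variables 0 and 3. They are related by \<alpha>, and
  also by \<beta>, \<gamma>, \<beta> through the variables 1 and 2, so a chain of links in \<gamma>
  and \<beta> \<inter> \<alpha> joins them; its members are Day's polynomials. All links lie in
  \<alpha>, which gives M i x y y x = x.\<close>

lemma day_chain_exists:
  assumes "in_cm_variety ar A"
  obtains M n where "day_chain M n"
proof -
  obtain E where E: "\<forall>(s, t)\<in>E. wf_utrm ar s \<and> wf_utrm ar t" "satisfies_ids A E" "cm_variety ar E"
    using assms unfolding in_cm_variety_def by blast
  obtain o' where o': "o' \<in> U" using ualg by (auto simp: is_ualg_def)
  \<comment> \<open>Clipping forces the values of term functions into U even where \<rho> leaves U,
    so the identities of A, which speak of assignments into U, pass to B.\<close>
  define clip where "clip \<rho> = (\<lambda>i :: nat. if \<rho> i \<in> U then \<rho> i else o')" for \<rho> :: "nat \<Rightarrow> 'a"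
  have clipU: "range (clip \<rho>) \<subseteq> U" for \<rho> using o' by (auto simp: clip_def)
  have clip_id: "clip \<rho> = \<rho>" if "range \<rho> \<subseteq> U" for \<rho> using that by (force simp: clip_def)
  define tf where "tf t = (\<lambda>\<rho>. utrm_eval A (clip \<rho>) t)" for t
  define B :: "('f, (nat \<Rightarrow> 'a) \<Rightarrow> 'a) ualg" where
    "B = \<lparr>uni = tf ` {t. wf_utrm ar t}, opn = (\<lambda>f gs. (\<lambda>\<rho>. opn A f (map (\<lambda>g. g \<rho>) gs)))\<rparr>"
  have opB: "opn B f gs = (\<lambda>\<rho>. opn A f (map (\<lambda>g. g \<rho>) gs))" for f gs by (simp add: B_def)
  have uniB: "uni B = tf ` {t. wf_utrm ar t}" by (simp add: B_def)
  have BU: "g \<rho> \<in> U" if "g \<in> uni B" for g \<rho>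
    using that utrm_eval_closed[OF ualg clipU] by (auto simp: uniB tf_def)
  have "opn B f gs \<in> uni B" if "length gs = ar f" "set gs \<subseteq> uni B" for f gs
  proof -
    have "\<forall>g\<in>set gs. \<exists>t. wf_utrm ar t \<and> g = tf t" using that(2) by (auto simp: uniB)
    then obtain tm where tm: "\<And>g. g \<in> set gs \<Longrightarrow> wf_utrm ar (tm g) \<and> g = tf (tm g)" by metis
    have *: "map (\<lambda>g. g \<rho>) gs = map (utrm_eval A (clip \<rho>)) (map tm gs)" for \<rho>
      using tm by (auto simp: tf_def fun_eq_iff)
    have "opn B f gs = tf (UApp f (map tm gs))"
      unfolding opB tf_def utrm_eval.simps * ..
    then show ?thesis using tm that(1) by (auto simp: uniB)
  qed
  moreover have "tf (UVar 0) \<in> uni B" by (auto simp: uniB)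
  ultimately have B: "is_ualg ar B" by (auto simp: is_ualg_def)
  have "satisfies_ids B E"
    unfolding satisfies_ids_def
  proof (intro ballI allI impI, clarify)
    fix s t and \<sigma> :: "nat \<Rightarrow> _" assume st: "(s, t) \<in> E" and \<sigma>: "range \<sigma> \<subseteq> uni B"
    have "utrm_eval A (\<lambda>i. \<sigma> i \<rho>) s = utrm_eval A (\<lambda>i. \<sigma> i \<rho>) t" for \<rho>
    proof -
      have "range (\<lambda>i. \<sigma> i \<rho>) \<subseteq> U" using BU \<sigma> by blast
      then show ?thesis using E(2) st unfolding satisfies_ids_def by blast
    qed
    then show "utrm_eval B \<sigma> s = utrm_eval B \<sigma> t"
      unfolding utrm_eval_pointwise[of B A, OF opB] by blast
  qed
  then have mod: "ucong_modular ar B" using cm_variety_imp_ucong_modular[OF E(1,3) B] by blast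
  define ker where "ker P = {(g, h). g \<in> uni B \<and> h \<in> uni B \<and>
      (\<forall>\<rho>. range \<rho> \<subseteq> U \<longrightarrow> P \<rho> \<longrightarrow> g \<rho> = h \<rho>)}" for P :: "(nat \<Rightarrow> 'a) \<Rightarrow> bool"
  have ker: "ucong ar B (ker P)" for P
    unfolding ucong_def
  proof (intro conjI allI impI; (elim conjE)?)
    show "equiv (uni B) (ker P)"
      by (auto simp: ker_def equiv_def refl_on_def sym_def trans_def)
  next
    fix f gs hs assume l: "length gs = ar f" and al: "list_all2 (\<lambda>g h. (g, h) \<in> ker P) gs hs"
    then have sub: "set gs \<subseteq> uni B" "set hs \<subseteq> uni B" "length hs = ar f"
      by (auto simp: ker_def list_all2_conv_all_nth in_set_conv_nth)
    have "map (\<lambda>g. g \<rho>) gs = map (\<lambda>g. g \<rho>) hs" if "range \<rho> \<subseteq> U" "P \<rho>" for \<rho>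
      using al that by (auto simp: list_all2_conv_all_nth ker_def intro!: nth_equalityI)
    then show "(opn B f gs, opn B f hs) \<in> ker P"
      using sub l B by (auto simp: ker_def opB is_ualg_def)
  qed
  define \<alpha> where "\<alpha> = ker (\<lambda>\<rho>. \<rho> 1 = \<rho> 2 \<and> \<rho> 0 = \<rho> 3)"
  define \<beta> where "\<beta> = ker (\<lambda>\<rho>. \<rho> 0 = \<rho> 1 \<and> \<rho> 2 = \<rho> 3)"
  define \<gamma> where "\<gamma> = ker (\<lambda>\<rho>. \<rho> 1 = \<rho> 2)"
  have cong: "ucong ar B \<alpha>" "ucong ar B \<beta>" "ucong ar B \<gamma>"
    unfolding \<alpha>_def \<beta>_def \<gamma>_def by (rule ker)+
  have \<gamma>\<alpha>: "\<gamma> \<subseteq> \<alpha>" by (auto simp: \<alpha>_def \<gamma>_def ker_def)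
  let ?v = "\<lambda>i. tf (UVar i)"
  have v: "?v i \<in> uni B" for i by (auto simp: uniB)
  have vr: "?v i \<rho> = \<rho> i" if "range \<rho> \<subseteq> U" for i \<rho> using clip_id[OF that] by (simp add: tf_def)
  have "(?v 0, ?v 1) \<in> \<beta>" "(?v 1, ?v 2) \<in> \<gamma>" "(?v 2, ?v 3) \<in> \<beta>" and a03: "(?v 0, ?v 3) \<in> \<alpha>"
    using v vr by (auto simp: \<alpha>_def \<beta>_def \<gamma>_def ker_def)
  then have "(?v 0, ?v 3) \<in> (\<gamma> \<union> \<beta>)\<^sup>+"
    by (meson UnI1 UnI2 trancl.r_into_trancl trancl.trancl_into_trancl)
  then have "(?v 0, ?v 3) \<in> ucong_join ar B \<gamma> \<beta> \<inter> \<alpha>"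
    using a03 ucong_join_eq_trancl[OF B cong(3,2)] by simp
  then have "(?v 0, ?v 3) \<in> ucong_join ar B \<gamma> (\<beta> \<inter> \<alpha>)"
    using mod cong \<gamma>\<alpha> by (simp add: ucong_modular_def)
  then have "(?v 0, ?v 3) \<in> (\<gamma> \<union> (\<beta> \<inter> \<alpha>))\<^sup>+"
    using ucong_join_eq_trancl[OF B cong(3) ucong_inter[OF cong(2,1)]] by simp
  from trancl_seq[OF this] obtain n :: nat and g where g: "g 0 = ?v 0" "g n = ?v 3"
    "\<And>i. i < n \<Longrightarrow> (g i, g (Suc i)) \<in> \<gamma> \<union> (\<beta> \<inter> \<alpha>)"
    by blast
  have g\<alpha>: "(?v 0, g i) \<in> \<alpha>" if "i \<le> n" for i
    using that
  proof (induction i)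
    case 0
    then show ?case using g(1) ucong_refl[OF cong(1) v] by simp
  next
    case (Suc i)
    then have "(g i, g (Suc i)) \<in> \<alpha>" using g(3)[of i] \<gamma>\<alpha> by auto
    then show ?case using Suc ucong_trans[OF cong(1)] by auto
  qed
  have "\<exists>t. wf_utrm ar t \<and> g i = tf t" if "i \<le> n" for i
    using g\<alpha>[OF that] by (auto simp: \<alpha>_def ker_def uniB)
  then obtain tm where tm: "\<And>i. i \<le> n \<Longrightarrow> wf_utrm ar (tm i) \<and> g i = tf (tm i)" by metis
  define env where "env x y z u = (\<lambda>i :: nat. if i = 0 then x else if i = 1 then y
      else if i = 2 then z else (u :: 'a))" for x y z u
  have envU: "range (env x y z u) \<subseteq> U" if "x \<in> U" "y \<in> U" "z \<in> U" "u \<in> U" for x y z u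
    using that by (auto simp: env_def)
  define M where "M i x y z u = utrm_eval A (env x y z u) (tm i)" for i x y z u
  have Mg: "M i x y z u = g i (env x y z u)" if "i \<le> n" "x \<in> U" "y \<in> U" "z \<in> U" "u \<in> U" for i x y z u
    using tm[OF that(1)] clip_id[OF envU[OF that(2-)]] by (simp add: M_def tf_def)
  have env: "env x y z u 0 = x" "env x y z u (Suc 0) = y" "env x y z u 2 = z" "env x y z u 3 = u"
    for x y z u by (simp_all add: env_def)
  have "pol4 (M i)" if "i \<le> n" for i
    unfolding pol4_def M_def env_def
    by (rule pol_utrm_eval[where \<sigma> = "\<lambda>i z w. if i = 0 then z 0 else if i = 1 then z 1
      else if i = 2 then z 2 else z 3"], use tm[OF that] in blast)
      (rename_tac j, case_tac "j = 0"; case_tac "j = 1"; case_tac "j = 2"; simp add: pol_proj)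
  moreover have "M 0 x y z u = x \<and> M n x y z u = u" if "x \<in> U" "y \<in> U" "z \<in> U" "u \<in> U" for x y z u
    using Mg[OF _ that] g(1,2) vr[OF envU[OF that]] by (simp add: env)
  moreover have "M i x y y x = x" if "i \<le> n" "x \<in> U" "y \<in> U" for i x y
  proof -
    have "g i (env x y y x) = ?v 0 (env x y y x)"
      using g\<alpha>[OF that(1)] envU[OF that(2,3,3,2)] by (simp add: \<alpha>_def ker_def env)
    then show ?thesis using Mg[OF that(1) that(2,3,3,2)] vr[OF envU[OF that(2,3,3,2)]] by (simp add: env)
  qed
  moreover have "(\<forall>x\<in>U. \<forall>u\<in>U. M i x x u u = M (Suc i) x x u u) \<or>
      (\<forall>x\<in>U. \<forall>y\<in>U. \<forall>u\<in>U. M i x y y u = M (Suc i) x y y u)" if "i < n" for i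
    using g(3)[OF that]
  proof
    assume "(g i, g (Suc i)) \<in> \<gamma>"
    then have "M i x y y u = M (Suc i) x y y u" if "x \<in> U" "y \<in> U" "u \<in> U" for x y u
      using that envU[of x y y u] \<open>i < n\<close> by (simp add: \<gamma>_def ker_def Mg env)
    then show ?thesis by blast
  next
    assume "(g i, g (Suc i)) \<in> \<beta> \<inter> \<alpha>"
    then have "M i x x u u = M (Suc i) x x u u" if "x \<in> U" "u \<in> U" for x u
      using that envU[of x x u u] \<open>i < n\<close> by (simp add: \<beta>_def ker_def Mg env)
    then show ?thesis by blast
  qed
  ultimately have "day_chain M n" unfolding day_chain_def by blast
  then show thesis by (rule that)
qed

text \<open>Links of one kind preserve M i c c d d, links of the other kind preserve M i c r r d.
  The hypothesis makes these two congruent at every i, so the class of c is kept along the whole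
  chain, which ends in d.\<close>

lemma day_chain_related:
  assumes day: "day_chain M n" and \<delta>: "ucong ar A \<delta>" and r: "(r, r') \<in> \<delta>" and cd: "c \<in> U" "d \<in> U"
    and rel: "\<And>i. i \<le> n \<Longrightarrow> (M i c r r' d, M i c c d d) \<in> \<delta>"
  shows "(c, d) \<in> \<delta>"
proof -
  have rU: "r \<in> U" "r' \<in> U" using ucong_subset[OF \<delta> r] by auto
  have rel': "(M i c r r d, M i c c d d) \<in> \<delta>" if "i \<le> n" for i
  proof -
    have "pol4 (M i)" using day that by (simp add: day_chain_def)
    then have "(M i c r r d, M i c r r' d) \<in> \<delta>"
      by (rule pol4_cong[OF \<delta> _ ucong_refl[OF \<delta> cd(1)] ucong_refl[OF \<delta> rU(1)] r ucong_refl[OF \<delta> cd(2)]])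
    then show ?thesis using rel[OF that] ucong_trans[OF \<delta>] by blast
  qed
  have "(c, M i c c d d) \<in> \<delta>" if "i \<le> n" for i
    using that
  proof (induction i)
    case 0
    then show ?case using day cd ucong_refl[OF \<delta>] by (simp add: day_chain_def)
  next
    case (Suc i)
    then have "i < n" by simp
    with day consider "M i c c d d = M (Suc i) c c d d" | "M i c r r d = M (Suc i) c r r d"
      unfolding day_chain_def using cd rU by blast
    then show ?case
    proof cases
      case 1
      then show ?thesis using Suc by simp
    next
      case 2
      have "(c, M i c r r d) \<in> \<delta>"
        using Suc rel'[of i] ucong_sym[OF \<delta>] ucong_trans[OF \<delta>] by (meson Suc_leD)
      then show ?thesis using 2 rel'[OF Suc.prems] ucong_trans[OF \<delta>] by metis
    qed
  qed
  from this[of n] show ?thesis using day cd by (simp add: day_chain_def)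
qed

section \<open>A central series from collapsing maps\<close>

text \<open>Translations by a strongly collapsing polynomial; in a supernilpotent algebra they generate
  a nilpotent semigroup of maps.\<close>

definition collapsing :: "((nat \<Rightarrow> 'a) \<Rightarrow> 'a \<Rightarrow> 'a) \<times> (nat \<Rightarrow> 'a) \<times> (nat \<Rightarrow> 'a) \<Rightarrow> bool" where
  "collapsing = (\<lambda>(T, a, b). pol T \<and> range a \<subseteq> U \<and> range b \<subseteq> U \<and> (\<exists>c. \<forall>u\<in>U. T a u = c))"

text \<open>A stand-in for the upper central series. It tests collapsing maps only, which
  supernilpotency controls directly; Day's polynomials recover the full term conditions in
  \<open>central_upper_central\<close>.\<close>

fun upper_central :: "nat \<Rightarrow> ('a \<times> 'a) set" where
  "upper_central 0 = Id_on U"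
| "upper_central (Suc j) = {(x, y). x \<in> U \<and> y \<in> U \<and>
     (\<forall>T a b. collapsing (T, a, b) \<longrightarrow> (T b x, T b y) \<in> upper_central j)}"

text \<open>A collapsing polynomial stays collapsing when a translation of A is substituted for its
  argument w; hence each term of the series is compatible with the operations.\<close>

lemma ucong_upper_central: "ucong ar A (upper_central j)"
proof (induction j)
  case 0
  then show ?case using ucong_Id_on by simp
next
  case (Suc j)
  show ?case
  proof (rule ucong_of_translations)
    have "T b x \<in> U" if "collapsing (T, a, b)" "x \<in> U" for T a b x
      using that pol_closed by (auto simp: collapsing_def)
    then have "refl_on U (upper_central (Suc j))"
      using ucong_refl[OF Suc] by (intro refl_onI) simp
    moreover have "sym (upper_central (Suc j))"
      using ucong_sym[OF Suc] by (intro symI) simp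
    moreover have "trans (upper_central (Suc j))"
      using ucong_trans[OF Suc] unfolding upper_central.simps by (intro transI) blast
    ultimately show "equiv U (upper_central (Suc j))"
      by (intro equivI) auto
  next
    fix f us vs x y
    assume *: "(x, y) \<in> upper_central (Suc j)" "set us \<subseteq> U" "set vs \<subseteq> U"
      "length us + 1 + length vs = ar f"
    define g where "g w = opn A f (us @ w # vs)" for w
    have "pol (\<lambda>z w. opn A f (map (\<lambda>t. t z w)
        (map (\<lambda>c z w. c) us @ (\<lambda>z w. w) # map (\<lambda>c z w. c) vs)))"
      using * by (intro pol_op) (auto intro: pol.intros)
    then have g: "pol (\<lambda>z w. g w)" by (simp add: g_def o_def)
    have gU: "g w \<in> U" if "w \<in> U" for w using that * by (auto simp: g_def intro!: opn_closed)
    have "(T b (g x), T b (g y)) \<in> upper_central j" if "collapsing (T, a, b)" for T a b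
    proof -
      have "collapsing (\<lambda>z w. T z (g w), a, b)"
        using that pol_fix(2)[OF _ g, of T] gU unfolding collapsing_def by auto
      then show ?thesis using *(1) by auto
    qed
    then have "(g x, g y) \<in> upper_central (Suc j)" using gU *(1) by auto
    then show "(opn A f (us @ x # vs), opn A f (us @ y # vs)) \<in> upper_central (Suc j)"
      by (simp add: g_def)
  qed
qed

fun word :: "(((nat \<Rightarrow> 'a) \<Rightarrow> 'a \<Rightarrow> 'a) \<times> (nat \<Rightarrow> 'a) \<times> (nat \<Rightarrow> 'a)) list \<Rightarrow> 'a \<Rightarrow> 'a" where
  "word [] u = u"
| "word ((T, a, b) # ts) u = T b (word ts u)"

lemma word_snoc: "word (ts @ [(T, a, b)]) u = word ts (T b u)"
  by (induction ts) auto

lemma upper_centralI: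
  assumes "x \<in> U" "y \<in> U" "\<And>ts. length ts = j \<Longrightarrow> \<forall>s\<in>set ts. collapsing s \<Longrightarrow> word ts x = word ts y"
  shows "(x, y) \<in> upper_central j"
  using assms
proof (induction j arbitrary: x y)
  case (Suc j)
  have "(T b x, T b y) \<in> upper_central j" if c: "collapsing (T, a, b)" for T a b
  proof (rule Suc.IH)
    show "T b x \<in> U" "T b y \<in> U" using c Suc.prems pol_closed by (auto simp: collapsing_def)
    show "word ts (T b x) = word ts (T b y)" if "length ts = j" "\<forall>s\<in>set ts. collapsing s" for ts
      using Suc.prems(3)[of "ts @ [(T, a, b)]"] that c by (simp add: word_snoc)
  qed
  then show ?case using Suc.prems by auto
qed (use assms in auto)

text \<open>This is \<open>word\<close> in the format of \<open>centralizes\<close>: the letter in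
  place l reads its tuple from block l, and the innermost argument lies in the block after the last
  letter. With k letters that is block k, which belongs to the last tuple of the term
  condition.\<close>

fun blockword :: "nat \<Rightarrow> (((nat \<Rightarrow> 'a) \<Rightarrow> 'a \<Rightarrow> 'a) \<times> (nat \<Rightarrow> 'a) \<times> (nat \<Rightarrow> 'a)) list \<Rightarrow>
    (nat \<times> nat \<Rightarrow> 'a) \<Rightarrow> 'a" where
  "blockword l [] \<rho> = \<rho> (l, 0)"
| "blockword l ((T, a, b) # ts) \<rho> = T (\<lambda>j. \<rho> (l, j)) (blockword (Suc l) ts \<rho>)"

lemma poly_op_blockword: "\<forall>s\<in>set ts. collapsing s \<Longrightarrow> poly_op ar A (blockword l ts)"
proof (induction ts arbitrary: l)
  case Nil
  have "blockword l [] = (\<lambda>\<rho>. \<rho> (l, 0))" by auto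
  then show ?case using poly_op_var[of ar A "(l, 0)"] by metis
next
  case (Cons s ts)
  obtain T a b where s: "s = (T, a, b)" by (cases s)
  have "blockword l (s # ts) = (\<lambda>\<rho>. T (\<lambda>j. \<rho> (l, j)) (blockword (Suc l) ts \<rho>))" by (auto simp: s)
  moreover have "poly_op ar A (\<lambda>\<rho>. T (\<lambda>j. \<rho> (l, j)) (blockword (Suc l) ts \<rho>))"
    using Cons s
    by (intro poly_op_pol[of T "\<lambda>j \<rho>. \<rho> (l, j)" "blockword (Suc l) ts"] poly_op_var)
      (auto simp: collapsing_def)
  ultimately show ?case by metis
qed

lemma blockword_closed: "\<forall>s\<in>set ts. collapsing s \<Longrightarrow> range \<rho> \<subseteq> U \<Longrightarrow> blockword l ts \<rho> \<in> U"
proof (induction ts arbitrary: l)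
  case (Cons s ts)
  obtain T a b where s: "s = (T, a, b)" by (cases s)
  have "T (\<lambda>j. \<rho> (l, j)) (blockword (Suc l) ts \<rho>) \<in> U"
    using Cons s by (intro pol_closed[of T]) (auto simp: collapsing_def)
  then show ?case by (simp add: s)
qed auto

text \<open>Let block i hold the tuple a or b of letter i. As soon as some block holds a, that
  letter is constant in its argument and the word cannot tell x from y. These are the premises of
  the term condition modulo \<open>Id_on U\<close>; its conclusion, with b in every block, is the
  claim.\<close>

lemma supernilpotent_word_const:
  assumes sn: "k_supernilpotent ar A k" and ts: "length ts = k" "\<forall>s\<in>set ts. collapsing s"
    and xy: "x \<in> U" "y \<in> U"
  shows "word ts x = word ts y"
proof -
  let ?\<alpha>s = "replicate k (U \<times> U)"
  define a where "a i = (if i < k then fst (snd (ts ! i)) else (\<lambda>_. x))" for i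
  define b where "b i = (if i < k then snd (snd (ts ! i)) else (\<lambda>_. x))" for i
  have abU: "a i j \<in> U" "b i j \<in> U" for i j
  proof -
    have "collapsing (ts ! i)" if "i < k" using ts that by auto
    then show "a i j \<in> U" "b i j \<in> U"
      using xy by (auto simp: a_def b_def collapsing_def image_subset_iff split: prod.splits)
  qed
  let ?env = "\<lambda>S w. block_env k S a b (\<lambda>_. w)"
  have envU: "range (?env S w) \<subseteq> U" if "w \<in> U" for S w using abU that by (auto simp: block_env_def)
  have "centralizes ar A ?\<alpha>s (U \<times> U) (hcommutator ar A ?\<alpha>s (U \<times> U))"
    using ucong_full by (intro hcommutator_is_least(2) ualg) auto
  then have cent: "centralizes ar A ?\<alpha>s (U \<times> U) (Id_on U)" using sn by (simp add: k_supernilpotent_def)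
  have part: "blockword 0 ts (?env S x) = blockword 0 ts (?env S y)" if "i < k" "i \<notin> S" for S i
  proof -
    \<comment> \<open>Induction over the suffixes that contain letter i; the empty suffix is
      excluded by i < k.\<close>
    have "blockword (k - length us) us (?env S x) = blockword (k - length us) us (?env S y)"
      if "ts = vs @ us" "length vs \<le> i" for us vs
      using that
    proof (induction us arbitrary: vs)
      case Nil
      then show ?case using ts \<open>i < k\<close> by simp
    next
      case (Cons s us)
      obtain T a' b' where s: "s = (T, a', b')" by (cases s)
      have k: "k = length vs + Suc (length us)" using Cons.prems ts by simp
      have nth: "ts ! length vs = s" using Cons.prems by simp
      have U: "blockword (Suc (length vs)) us (?env S w) \<in> U" if "w \<in> U" for w
        using Cons.prems ts envU[OF that] by (intro blockword_closed) auto
      show ?case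
      proof (cases "length vs = i")
        case True
        have "(\<lambda>j. ?env S w (length vs, j)) = a'" for w
          using \<open>i \<notin> S\<close> \<open>i < k\<close> True nth by (auto simp: block_env_def a_def s)
        moreover have "collapsing s" using Cons.prems ts by auto
        ultimately show ?thesis using U[OF xy(1)] U[OF xy(2)] k by (auto simp: s collapsing_def)
      next
        case False
        have "blockword (k - length us) us (?env S x) = blockword (k - length us) us (?env S y)"
          using Cons.prems False by (intro Cons.IH[of "vs @ [s]"]) auto
        moreover have "(\<lambda>j. ?env S x (length vs, j)) = (\<lambda>j. ?env S y (length vs, j))"
          using k by (auto simp: block_env_def)
        ultimately show ?thesis using k by (simp add: s)
      qed
    qed
    from this[of "[]" ts] show ?thesis using ts by simp
  qed
  have prem: "(blockword 0 ts (?env S x), blockword 0 ts (?env S y)) \<in> Id_on U" if S: "S \<subset> {..<k}" for S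
  proof -
    obtain i where "i < k" "i \<notin> S" using psubset_imp_ex_mem[OF S] by auto
    then show ?thesis
      using part blockword_closed[OF ts(2) envU[OF xy(2)]] by (auto simp: Id_on_iff)
  qed
  have "(blockword 0 ts (?env {..<k} x), blockword 0 ts (?env {..<k} y)) \<in> Id_on U"
    using cent[unfolded centralizes_def, rule_format, of "blockword 0 ts" a b "\<lambda>_. x" "\<lambda>_. y"]
      poly_op_blockword[OF ts(2)] abU xy prem by simp
  moreover have "blockword (k - length us) us (?env {..<k} w) = word us w"
    if "ts = vs @ us" for us vs w
    using that
  proof (induction us arbitrary: vs)
    case Nil
    then show ?case using ts by (simp add: block_env_def)
  next
    case (Cons s us)
    obtain T a' b' where s: "s = (T, a', b')" by (cases s)
    have k: "k = length vs + Suc (length us)" using Cons.prems ts by simp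
    have nth: "ts ! length vs = s" using Cons.prems by simp
    have "(\<lambda>j. ?env {..<k} w (length vs, j)) = b'" using k nth by (auto simp: block_env_def b_def s)
    then show ?case using Cons.IH[of "vs @ [s]"] Cons.prems k by (simp add: s)
  qed
  from this[of "[]" ts] have "blockword 0 ts (?env {..<k} w) = word ts w" for w using ts by simp
  ultimately show ?thesis by auto
qed

lemma upper_central_full: "k_supernilpotent ar A k \<Longrightarrow> upper_central k = U \<times> U"
proof
  assume sn: "k_supernilpotent ar A k"
  have "(x, y) \<in> upper_central k" if "x \<in> U" "y \<in> U" for x y
    by (rule upper_centralI[OF that]) (rule supernilpotent_word_const[OF sn _ _ that])
  then show "U \<times> U \<subseteq> upper_central k" by auto
  show "upper_central k \<subseteq> U \<times> U" using ucong_subset[OF ucong_upper_central] by auto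
qed

section \<open>Term conditions, the difference polynomial and the Mal'cev polynomial\<close>

text \<open>In the notation of term conditions, \<open>central \<beta> \<delta>\<close> is \<open>C(\<beta>, 1; \<delta>)\<close> together with \<open>C(1, \<beta>; \<delta>)\<close>.\<close>

definition central :: "('a \<times> 'a) set \<Rightarrow> ('a \<times> 'a) set \<Rightarrow> bool" where
  "central \<beta> \<delta> \<longleftrightarrow> (\<forall>t a b u v. pol t \<and> range a \<subseteq> U \<and> range b \<subseteq> U \<and> (u, v) \<in> \<beta> \<longrightarrow>
     ((t a u, t b u) \<in> \<delta> \<longrightarrow> (t a v, t b v) \<in> \<delta>) \<and> ((t a u, t a v) \<in> \<delta> \<longrightarrow> (t b u, t b v) \<in> \<delta>))"

text \<open>\<open>day_chain_related\<close> reduces each term condition to pairs M i c r r' d, M i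
  c c d d. For the first condition such a pair is the image of (u, v) under a collapsing map; the
  second is reduced to the first with the roles of tuple and argument exchanged.\<close>

lemma central_upper_central:
  assumes day: "day_chain M n"
  shows "central (upper_central (Suc j)) (upper_central j)"
proof -
  let ?\<beta> = "upper_central (Suc j)" and ?\<delta> = "upper_central j"
  note \<delta> = ucong_upper_central[of j]
  have one: "(t a v, t b v) \<in> ?\<delta>"
    if t: "pol t" and a: "range a \<subseteq> U" and b: "range b \<subseteq> U" and uv: "(u, v) \<in> ?\<beta>"
      and eq: "(t a u, t b u) \<in> ?\<delta>" for t a b u v
  proof (rule day_chain_related[OF day \<delta> eq])
    have U: "u \<in> U" "v \<in> U" using uv by auto
    show cU: "t a v \<in> U" and dU: "t b v \<in> U" using U a b t pol_closed by auto
    fix i assume i: "i \<le> n"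
    have pM: "pol4 (M i)" using day i by (simp add: day_chain_def)
    \<comment> \<open>For z = a the two middle entries coincide and so do the outer ones, hence the
      value is t a v whatever w is.\<close>
    let ?T = "\<lambda>z w. M i (t a v) (t a w) (t z w) (t z v)"
    have "pol ?T"
      by (rule pol4_app[OF pM pol_const[OF cU] pol_fix(1)[OF t a pol_arg] pol_fix(2)[OF t pol_arg]
            pol_fix(2)[OF t pol_const[OF U(2)]]])
    moreover have "?T a w = t a v" if "w \<in> U" for w
      using day i that cU pol_closed[OF t a] by (simp add: day_chain_def)
    ultimately have "collapsing (?T, a, b)" using a b by (simp add: collapsing_def)
    then show "(M i (t a v) (t a u) (t b u) (t b v), M i (t a v) (t a v) (t b v) (t b v)) \<in> ?\<delta>"
      using uv by auto
  qed
  have two: "(t b u, t b v) \<in> ?\<delta>"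
    if t: "pol t" and a: "range a \<subseteq> U" and b: "range b \<subseteq> U" and uv: "(u, v) \<in> ?\<beta>"
      and eq: "(t a u, t a v) \<in> ?\<delta>" for t a b u v
  proof (rule day_chain_related[OF day \<delta> eq])
    have U: "u \<in> U" "v \<in> U" using uv by auto
    show cU: "t b u \<in> U" and dU: "t b v \<in> U" using U a b t pol_closed by auto
    fix i assume i: "i \<le> n"
    have pM: "pol4 (M i)" using day i by (simp add: day_chain_def)
    \<comment> \<open>At w = u this is t b u for every z, so the first condition carries the
      agreement of z = a and z = b from u to v.\<close>
    let ?T = "\<lambda>z w. M i (t b u) (t z u) (t z w) (t b w)"
    have T: "pol ?T"
      by (rule pol4_app[OF pM pol_const[OF cU] pol_fix(2)[OF t pol_const[OF U(1)]]
            pol_fix(2)[OF t pol_arg] pol_fix(1)[OF t b pol_arg]])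
    have "?T z u = t b u" if "range z \<subseteq> U" for z
      using day i that cU pol_closed[OF t that] U by (simp add: day_chain_def)
    then have "(?T a u, ?T b u) \<in> ?\<delta>" using a b cU ucong_refl[OF \<delta>] by simp
    from one[OF T a b uv this]
    show "(M i (t b u) (t a u) (t a v) (t b v), M i (t b u) (t b u) (t b v) (t b v)) \<in> ?\<delta>" .
  qed
  show ?thesis
    unfolding central_def
  proof (intro allI impI conjI; elim conjE)
    fix t u v and a b :: "nat \<Rightarrow> 'a"
    assume *: "pol t" "range a \<subseteq> U" "range b \<subseteq> U" "(u, v) \<in> ?\<beta>"
    show "(t a v, t b v) \<in> ?\<delta>" if "(t a u, t b u) \<in> ?\<delta>" using one[OF * that] .
    show "(t b u, t b v) \<in> ?\<delta>" if "(t a u, t a v) \<in> ?\<delta>" using two[OF * that] .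
  qed
qed

text \<open>In \<open>good q g\<close> the value of q x y y is g x y, and g is moved along Day's
  chain from y to x. Links of one kind fix M i y y x x, those of the other kind fix M i y x x x;
  centrality permits the passage between the two forms, by exchanging x and y in the second
  place.\<close>

lemma difference_polynomial:
  assumes day: "day_chain M n"
  obtains q where "pol3 q" "\<And>x z. x \<in> U \<Longrightarrow> z \<in> U \<Longrightarrow> q x x z = z"
    "\<And>\<theta> \<delta> x y. ucong ar A \<theta> \<Longrightarrow> ucong ar A \<delta> \<Longrightarrow> central \<theta> \<delta> \<Longrightarrow> (x, y) \<in> \<theta> \<Longrightarrow> (q x y y, x) \<in> \<delta>"
proof -
  define good where "good q g \<longleftrightarrow> pol3 q \<and> (\<forall>x\<in>U. \<forall>z\<in>U. q x x z = z) \<and>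
    (\<forall>\<theta> \<delta> x y. ucong ar A \<theta> \<and> ucong ar A \<delta> \<and> central \<theta> \<delta> \<and> (x, y) \<in> \<theta> \<longrightarrow> (q x y y, g x y) \<in> \<delta>)"
    for q and g :: "'a \<Rightarrow> 'a \<Rightarrow> 'a"
  \<comment> \<open>With r = M i y a x x the values M i r a a r and M i y a x x coincide. Centrality
    replaces a by b in the second place only.\<close>
  have swap: "(M i r' b a r', g' x y) \<in> \<delta>"
    if i: "i \<le> n" and \<delta>: "ucong ar A \<delta>" and \<theta>: "ucong ar A \<theta>" and c: "central \<theta> \<delta>" and ab: "(a, b) \<in> \<theta>"
      and xU: "x \<in> U" "y \<in> U"
      and r': "(r', M i y a x x) \<in> \<delta>" and g': "g' x y = M i y b x x" for i \<theta> \<delta> a b x y r' g'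
  proof -
    let ?r = "M i y a x x"
    have pM: "pol4 (M i)" using day i by (simp add: day_chain_def)
    have abU: "a \<in> U" "b \<in> U" using ucong_subset[OF \<theta> ab] by auto
    have rU: "?r \<in> U" "r' \<in> U" using ucong_subset[OF \<delta> r'] by auto
    let ?t = "\<lambda>z w. M i (z 0) w (z (Suc 0)) (z 2)"
    have t: "pol ?t" by (intro pol4_app[OF pM] pol.intros)
    let ?A = "\<lambda>j :: nat. if j = 0 then ?r else if j = 1 then a else ?r"
    let ?B = "\<lambda>j :: nat. if j = 0 then y else x"
    have "?t ?A a = ?t ?B a" using day i abU rU by (simp add: day_chain_def)
    moreover have "?t ?B a \<in> U" using rU by simp
    ultimately have "(?t ?A a, ?t ?B a) \<in> \<delta>" using ucong_refl[OF \<delta>] by simp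
    moreover have "range ?A \<subseteq> U" "range ?B \<subseteq> U" using rU abU xU by auto
    ultimately have "(?t ?A b, ?t ?B b) \<in> \<delta>"
      using c t ab unfolding central_def by blast
    then have "(M i ?r b a ?r, M i y b x x) \<in> \<delta>" by simp
    moreover have "(M i r' b a r', M i ?r b a ?r) \<in> \<delta>"
      using r' abU by (intro pol4_cong[OF \<delta> pM]) (auto simp: ucong_refl[OF \<delta>])
    ultimately show ?thesis using ucong_trans[OF \<delta>] g' by metis
  qed
  have PQ: "\<exists>q'. good q' (\<lambda>x y. M i y x x x)" if i: "i \<le> n" and q: "good q (\<lambda>x y. M i y y x x)" for i q
  proof
    let ?q = "\<lambda>x y z. M i (q x y z) x y (q x y z)"
    have pM: "pol4 (M i)" using day i by (simp add: day_chain_def)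
    have q3: "pol3 q" using q by (simp add: good_def)
    show "good ?q (\<lambda>x y. M i y x x x)"
      unfolding good_def
    proof (intro conjI ballI allI impI; (elim conjE)?)
      show "pol3 ?q" unfolding pol3_def by (intro pol4_app[OF pM] pol3_app[OF q3] pol.intros)
      show "?q x x z = z" if "x \<in> U" "z \<in> U" for x z
        using that q day i by (simp add: good_def day_chain_def)
      fix \<theta> \<delta> x y assume *: "ucong ar A \<theta>" "ucong ar A \<delta>" "central \<theta> \<delta>" "(x, y) \<in> \<theta>"
      then have "(q x y y, M i y y x x) \<in> \<delta>" using q unfolding good_def by blast
      then show "(?q x y y, M i y x x x) \<in> \<delta>"
        using swap[OF i *(2,1,3) ucong_sym[OF *(1,4)], of x y _ "\<lambda>x y. M i y x x x"]
          ucong_subset[OF *(1,4)] by blast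
    qed
  qed
  have QP: "\<exists>q'. good q' (\<lambda>x y. M i y y x x)" if i: "i \<le> n" and q: "good q (\<lambda>x y. M i y x x x)" for i q
  proof
    let ?q = "\<lambda>x y z. M i (q x y z) y x (q x y z)"
    have pM: "pol4 (M i)" using day i by (simp add: day_chain_def)
    have q3: "pol3 q" using q by (simp add: good_def)
    show "good ?q (\<lambda>x y. M i y y x x)"
      unfolding good_def
    proof (intro conjI ballI allI impI; (elim conjE)?)
      show "pol3 ?q" unfolding pol3_def by (intro pol4_app[OF pM] pol3_app[OF q3] pol.intros)
      show "?q x x z = z" if "x \<in> U" "z \<in> U" for x z
        using that q day i by (simp add: good_def day_chain_def)
      fix \<theta> \<delta> x y assume *: "ucong ar A \<theta>" "ucong ar A \<delta>" "central \<theta> \<delta>" "(x, y) \<in> \<theta>"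
      then have "(q x y y, M i y x x x) \<in> \<delta>" using q unfolding good_def by blast
      then show "(?q x y y, M i y y x x) \<in> \<delta>"
        using swap[OF i *(2,1,3,4), of x y _ "\<lambda>x y. M i y y x x"] ucong_subset[OF *(1,4)] by blast
    qed
  qed
  have good_cong: "good q g'" if "good q g" "\<And>x y. x \<in> U \<Longrightarrow> y \<in> U \<Longrightarrow> g x y = g' x y" for q g g'
    unfolding good_def
  proof (intro conjI allI impI; (elim conjE)?)
    show "pol3 q" "\<forall>x\<in>U. \<forall>z\<in>U. q x x z = z" using that(1) by (auto simp: good_def)
    fix \<theta> \<delta> x y assume *: "ucong ar A \<theta>" "ucong ar A \<delta>" "central \<theta> \<delta>" "(x, y) \<in> \<theta>"
    then have "(q x y y, g x y) \<in> \<delta>" using that(1) unfolding good_def by blast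
    then show "(q x y y, g' x y) \<in> \<delta>" using that(2) ucong_subset[OF *(1,4)] by simp
  qed
  have "\<exists>q. good q (\<lambda>x y. M i y y x x)" if "i \<le> n" for i
    using that
  proof (induction i)
    case 0
    have "pol3 (\<lambda>x y z. z)" unfolding pol3_def by (rule pol_proj)
    then have "good (\<lambda>x y z. z) (\<lambda>x y. y)"
      using ucong_subset ucong_refl by (fastforce simp: good_def)
    then have "good (\<lambda>x y z. z) (\<lambda>x y. M 0 y y x x)"
      by (rule good_cong) (use day in \<open>auto simp: day_chain_def\<close>)
    then show ?case by blast
  next
    case (Suc i)
    then obtain q where q: "good q (\<lambda>x y. M i y y x x)" by auto
    obtain q' where q': "good q' (\<lambda>x y. M i y x x x)" using PQ[OF _ q] Suc.prems by auto
    consider "\<forall>x\<in>U. \<forall>u\<in>U. M i x x u u = M (Suc i) x x u u"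
      | "\<forall>x\<in>U. \<forall>y\<in>U. \<forall>u\<in>U. M i x y y u = M (Suc i) x y y u"
      using day Suc.prems unfolding day_chain_def by (meson Suc_le_lessD)
    then show ?case
    proof cases
      case 1
      then show ?thesis using good_cong[OF q, of "\<lambda>x y. M (Suc i) y y x x"] by blast
    next
      case 2
      then have "good q' (\<lambda>x y. M (Suc i) y x x x)"
        using good_cong[OF q', of "\<lambda>x y. M (Suc i) y x x x"] by blast
      then show ?thesis using QP[OF Suc.prems] by blast
    qed
  qed
  then obtain q where "good q (\<lambda>x y. M n y y x x)" by blast
  then have "good q (\<lambda>x y. x)" by (rule good_cong) (use day in \<open>auto simp: day_chain_def\<close>)
  then show thesis using that[of q] unfolding good_def by blast
qed

text \<open>If p x y y is x modulo one term of the series, then q x (p x y y) (p x y z) has this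
  property modulo the next lower term. The exact law for x, x, y survives because p x x x =
  x.\<close>

theorem maltsev_polynomial:
  assumes day: "day_chain M n" and sn: "k_supernilpotent ar A k"
  obtains p where "pol3 p" "\<And>x y. x \<in> U \<Longrightarrow> y \<in> U \<Longrightarrow> p x x y = y \<and> p x y y = x"
proof -
  obtain q where q: "pol3 q" "\<And>x z. x \<in> U \<Longrightarrow> z \<in> U \<Longrightarrow> q x x z = z"
    "\<And>\<theta> \<delta> x y. ucong ar A \<theta> \<Longrightarrow> ucong ar A \<delta> \<Longrightarrow> central \<theta> \<delta> \<Longrightarrow> (x, y) \<in> \<theta> \<Longrightarrow> (q x y y, x) \<in> \<delta>"
    using difference_polynomial[OF day] by metis
  have "\<exists>p. pol3 p \<and> (\<forall>x\<in>U. \<forall>y\<in>U. p x x y = y \<and> (p x y y, x) \<in> upper_central (k - j))"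
    if "j \<le> k" for j
    using that
  proof (induction j)
    case 0
    have "pol3 (\<lambda>x y z. z)" unfolding pol3_def by (rule pol_proj)
    then show ?case using upper_central_full[OF sn] by auto
  next
    case (Suc j)
    then obtain p where p: "pol3 p"
      "\<And>x y. x \<in> U \<Longrightarrow> y \<in> U \<Longrightarrow> p x x y = y \<and> (p x y y, x) \<in> upper_central (k - j)" by auto
    let ?p = "\<lambda>x y z. q x (p x y y) (p x y z)"
    have "pol3 ?p"
      unfolding pol3_def by (intro pol3_app[OF q(1)] pol3_app[OF p(1)] pol.intros)
    moreover have "?p x x y = y" if "x \<in> U" "y \<in> U" for x y using p(2) q(2) that by simp
    moreover have "(?p x y y, x) \<in> upper_central (k - Suc j)" if "x \<in> U" "y \<in> U" for x y
    proof -
      have kj: "k - j = Suc (k - Suc j)" using Suc.prems by simp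
      have "(x, p x y y) \<in> upper_central (Suc (k - Suc j))"
        using p(2)[OF that] ucong_sym[OF ucong_upper_central] kj by metis
      then show ?thesis
        using q(3)[OF ucong_upper_central ucong_upper_central central_upper_central[OF day]] by blast
    qed
    ultimately show ?case by blast
  qed
  from this[of k] obtain p where "pol3 p" "\<forall>x\<in>U. \<forall>y\<in>U. p x x y = y \<and> (p x y y, x) \<in> Id_on U" by auto
  then show thesis by (intro that[of p]) auto
qed

end

section \<open>Coordinates on finite abelian groups\<close>

text \<open>The coordinates come from a basis modulo the subgroup of \<open>q\<close>-th powers.\<close>

context comm_group begin

fun powprod :: "(nat \<Rightarrow> 'a) \<Rightarrow> nat \<Rightarrow> (nat \<Rightarrow> int) \<Rightarrow> 'a" where
  "powprod e 0 a = \<one>"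
| "powprod e (Suc k) a = powprod e k a \<otimes> e k [^] a k"

lemma powprod_closed: "(\<And>i. i < k \<Longrightarrow> e i \<in> carrier G) \<Longrightarrow> powprod e k a \<in> carrier G"
  by (induction k) auto

lemma powprod_cong:
  "(\<And>i. i < k \<Longrightarrow> e i = e' i) \<Longrightarrow> (\<And>i. i < k \<Longrightarrow> a i = a' i) \<Longrightarrow> powprod e k a = powprod e' k a'"
  by (induction k) auto

lemma powprod_zero: "(\<And>i. i < k \<Longrightarrow> a i = 0) \<Longrightarrow> powprod e k a = \<one>"
  by (induction k) auto

lemma powprod_add:
  assumes "\<And>i. i < k \<Longrightarrow> e i \<in> carrier G"
  shows "powprod e k (\<lambda>i. a i + b i) = powprod e k a \<otimes> powprod e k b"
  using assms
proof (induction k)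
  case (Suc k)
  then show ?case by (simp add: int_pow_mult powprod_closed m_ac)
qed simp

lemma powprod_scale:
  assumes "\<And>i. i < k \<Longrightarrow> e i \<in> carrier G"
  shows "powprod e k (\<lambda>i. n * a i) = powprod e k a [^] (n :: int)"
  using assms
proof (induction k)
  case (Suc k)
  then show ?case by (simp add: int_pow_distrib powprod_closed int_pow_pow mult.commute)
qed simp

lemma powprod_uminus:
  assumes "\<And>i. i < k \<Longrightarrow> e i \<in> carrier G"
  shows "powprod e k (\<lambda>i. - a i) = inv (powprod e k a)"
  using powprod_scale[OF assms, where n = "-1" and a = a] powprod_closed[OF assms] int_pow_neg[of "powprod e k a" 1]
  by simp

definition qpowers :: "nat \<Rightarrow> 'a set" where
  "qpowers q = (\<lambda>x. x [^] q) ` carrier G"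

lemma qpowers_subgroup: "subgroup (qpowers q) G"
proof (rule subgroupI)
  show "qpowers q \<subseteq> carrier G" by (auto simp: qpowers_def)
  show "qpowers q \<noteq> {}" by (auto simp: qpowers_def)
  show "inv x \<in> qpowers q" if x: "x \<in> qpowers q" for x
  proof -
    obtain y where "y \<in> carrier G" "x = y [^] q" using x by (auto simp: qpowers_def)
    then have "inv x = inv y [^] q" by (simp add: nat_pow_inv)
    then show ?thesis using \<open>y \<in> carrier G\<close> by (auto simp: qpowers_def)
  qed
  show "x \<otimes> y \<in> qpowers q" if xy: "x \<in> qpowers q" "y \<in> qpowers q" for x y
  proof -
    obtain x' y' where "x' \<in> carrier G" "x = x' [^] q" "y' \<in> carrier G" "y = y' [^] q"
      using xy by (auto simp: qpowers_def)
    then have "x \<otimes> y = (x' \<otimes> y') [^] q" by (simp add: nat_pow_distrib)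
    then show ?thesis using \<open>x' \<in> carrier G\<close> \<open>y' \<in> carrier G\<close> by (auto simp: qpowers_def)
  qed
qed

lemma qpowers_int_pow: "x \<in> carrier G \<Longrightarrow> int q dvd n \<Longrightarrow> x [^] n \<in> qpowers q"
proof -
  assume x: "x \<in> carrier G" and "int q dvd n"
  then obtain l where "n = l * int q" by (metis dvdE mult.commute)
  then have "x [^] n = (x [^] l) [^] q" using x by (simp add: int_pow_pow flip: int_pow_int)
  then show ?thesis using x by (auto simp: qpowers_def)
qed

text \<open>Linear independence in the vector space of G modulo q-th powers over the field with q
  elements. Integer exponents avoid both the quotient group and the field.\<close>

definition qindep :: "nat \<Rightarrow> (nat \<Rightarrow> 'a) \<Rightarrow> nat \<Rightarrow> bool" where
  "qindep q e k \<longleftrightarrow> (\<forall>i<k. e i \<in> carrier G) \<and>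
     (\<forall>a. powprod e k a \<in> qpowers q \<longrightarrow> (\<forall>i<k. int q dvd a i))"

text \<open>The combination is multiplied to x, so its exponents are the negatives of the
  coordinates of x; hence the signs in \<open>q_coordinates\<close>.\<close>

definition qspan :: "nat \<Rightarrow> (nat \<Rightarrow> 'a) \<Rightarrow> nat \<Rightarrow> 'a set" where
  "qspan q e k = {x \<in> carrier G. \<exists>a. x \<otimes> powprod e k a \<in> qpowers q}"

lemma qindep_extend:
  assumes q: "prime q" and ind: "qindep q e k" and x: "x \<in> carrier G" "x \<notin> qspan q e k"
  shows "qindep q (e(k := x)) (Suc k)" "qspan q e k \<subset> qspan q (e(k := x)) (Suc k)"
proof -
  interpret K: subgroup "qpowers q" G by (rule qpowers_subgroup)
  have eG: "e i \<in> carrier G" if "i < k" for i using ind that by (simp add: qindep_def)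
  have V: "powprod (e(k := x)) k a = powprod e k a" for a by (rule powprod_cong) auto
  note Vc = powprod_closed[of k e, OF eG]
  show "qindep q (e(k := x)) (Suc k)"
    unfolding qindep_def
  proof (intro conjI allI impI)
    show "(e(k := x)) i \<in> carrier G" if "i < Suc k" for i using that eG x by (auto simp: less_Suc_eq)
    fix a i assume "powprod (e(k := x)) (Suc k) a \<in> qpowers q" and i: "i < Suc k"
    then have in_K: "powprod e k a \<otimes> x [^] a k \<in> qpowers q" by (simp add: V)
    have ak: "int q dvd a k"
    proof (rule ccontr)
      assume "\<not> int q dvd a k"
      then have "coprime (a k) (int q)"
        using q by (simp add: coprime_commute prime_imp_coprime)
      \<comment> \<open>Raising the relation to an inverse b of the exponent of x modulo q isolates
        x up to q-th powers, and so puts x into the span.\<close>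
      then obtain b where "[a k * b = 1] (mod int q)" using cong_solve_coprime_int by blast
      then have "int q dvd 1 - a k * b" by (metis cong_iff_dvd_diff cong_sym)
      then have "x [^] (1 - a k * b) \<in> qpowers q" by (rule qpowers_int_pow[OF x(1)])
      moreover have "(powprod e k a \<otimes> x [^] a k) [^] b \<in> qpowers q"
        using in_K subgroup_int_pow_closed[OF qpowers_subgroup] by blast
      ultimately have "x [^] (1 - a k * b) \<otimes> (powprod e k a \<otimes> x [^] a k) [^] b \<in> qpowers q"
        by (rule K.m_closed)
      also have "x [^] (1 - a k * b) \<otimes> (powprod e k a \<otimes> x [^] a k) [^] b =
          (x [^] (1 - a k * b) \<otimes> x [^] (a k * b)) \<otimes> powprod e k (\<lambda>i. b * a i)"
        using x Vc by (simp add: int_pow_distrib int_pow_pow powprod_scale[OF eG] m_ac)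
      also have "x [^] (1 - a k * b) \<otimes> x [^] (a k * b) = x"
        using x by (simp flip: int_pow_mult)
      finally show False using x by (auto simp: qspan_def)
    qed
    show "int q dvd a i"
    proof (cases "i = k")
      case False
      have "inv (x [^] a k) \<in> qpowers q" using qpowers_int_pow[OF x(1) ak] K.m_inv_closed by blast
      then have "(powprod e k a \<otimes> x [^] a k) \<otimes> inv (x [^] a k) \<in> qpowers q"
        using in_K by (rule K.m_closed[rotated])
      then have "powprod e k a \<in> qpowers q" using x Vc by (simp add: m_assoc)
      then show ?thesis using ind i False by (auto simp: qindep_def less_Suc_eq)
    qed (use ak in simp)
  qed
  have "qspan q e k \<subseteq> qspan q (e(k := x)) (Suc k)"
  proof
    fix y assume "y \<in> qspan q e k"
    then obtain a where y: "y \<in> carrier G" "y \<otimes> powprod e k a \<in> qpowers q" by (auto simp: qspan_def)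
    have "powprod (e(k := x)) (Suc k) (a(k := 0)) = powprod e k a"
      using Vc powprod_cong[of k e e "a(k := 0)" a] by (simp add: V)
    then show "y \<in> qspan q (e(k := x)) (Suc k)" using y unfolding qspan_def by (metis (mono_tags) mem_Collect_eq)
  qed
  moreover have "x \<in> qspan q (e(k := x)) (Suc k)"
  proof -
    have "powprod (e(k := x)) (Suc k) ((\<lambda>_. 0)(k := -1)) = inv x"
      using x powprod_zero[of k "(\<lambda>_. 0)(k := -1)" e] by (simp add: V int_pow_neg[of x 1, simplified])
    then have "x \<otimes> powprod (e(k := x)) (Suc k) ((\<lambda>_. 0)(k := -1)) \<in> qpowers q"
      using x K.one_closed by simp
    then show ?thesis using x unfolding qspan_def by blast
  qed
  ultimately show "qspan q e k \<subset> qspan q (e(k := x)) (Suc k)" using x by blast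
qed

lemma qbasis_exists:
  assumes fin: "finite (carrier G)" and q: "prime q"
  obtains e k where "qindep q e k" "qspan q e k = carrier G"
proof -
  have "\<exists>e' k'. qindep q e' k' \<and> qspan q e' k' = carrier G" if "qindep q e k" for e k
    using that
  proof (induction "card (carrier G - qspan q e k)" arbitrary: e k rule: less_induct)
    case less
    show ?case
    proof (cases "qspan q e k = carrier G")
      case False
      then obtain x where x: "x \<in> carrier G" "x \<notin> qspan q e k" by (auto simp: qspan_def)
      note ext = qindep_extend[OF q less.prems x]
      have "qspan q (e(k := x)) (Suc k) \<subseteq> carrier G" by (auto simp: qspan_def)
      then have "card (carrier G - qspan q (e(k := x)) (Suc k)) < card (carrier G - qspan q e k)"
        using ext(2) fin by (intro psubset_card_mono) auto
      then show ?thesis using less.hyps ext(1) by blast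
    qed (use less.prems in blast)
  qed
  moreover have "qindep q (\<lambda>_. \<one>) 0" by (simp add: qindep_def)
  ultimately show thesis using that by blast
qed

text \<open>These are coordinates on the elementary abelian quotient of G by its q-th powers. An
  endomorphism preserves q-th powers, so it acts linearly, with the matrix read off the images of
  the basis.\<close>

theorem q_coordinates:
  assumes fin: "finite (carrier G)" and q: "prime q" and ord: "order G = q ^ j" "j \<ge> 1"
  obtains k and c :: "nat \<Rightarrow> 'a \<Rightarrow> int" where "k \<ge> 1"
    "\<forall>l<k. \<forall>x\<in>carrier G. \<forall>y\<in>carrier G. [c l (x \<otimes> y) = c l x + c l y] (mod int q)"
    "\<forall>\<tau>. \<exists>x\<in>carrier G. \<forall>l<k. [c l x = \<tau> l] (mod int q)"
    "\<forall>\<phi>\<in>hom G G. \<exists>\<Lambda>. \<forall>l<k. \<forall>x\<in>carrier G.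
        [c l (\<phi> x) = (\<Sum>i<k. \<Lambda> l i * c i x)] (mod int q)"
proof -
  interpret K: subgroup "qpowers q" G by (rule qpowers_subgroup)
  obtain e k where ind: "qindep q e k" and span: "qspan q e k = carrier G"
    using qbasis_exists[OF fin q] .
  have eG: "\<And>i. i < k \<Longrightarrow> e i \<in> carrier G" using ind by (simp add: qindep_def)
  note Vc = powprod_closed[of k e, OF eG]
  define c where "c l x = - (SOME a. x \<otimes> powprod e k a \<in> qpowers q) l" for l x
  have c: "x \<otimes> powprod e k (\<lambda>l. - c l x) \<in> qpowers q" if "x \<in> carrier G" for x
  proof -
    have "\<exists>a. x \<otimes> powprod e k a \<in> qpowers q" using that span by (auto simp: qspan_def)
    from someI_ex[OF this] show ?thesis by (simp add: c_def)
  qed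
  \<comment> \<open>Two representations of x differ by a relation between the e i, whose exponents
    are divisible by q. So any single representation determines c modulo q.\<close>
  have uniq: "[c l x = - a l] (mod int q)" if x: "x \<in> carrier G" and a: "x \<otimes> powprod e k a \<in> qpowers q" and l: "l < k"
    for x a l
  proof -
    have "inv (x \<otimes> powprod e k (\<lambda>l. - c l x)) \<in> qpowers q" using c[OF x] by (rule K.m_inv_closed)
    then have "(x \<otimes> powprod e k a) \<otimes> inv (x \<otimes> powprod e k (\<lambda>l. - c l x)) \<in> qpowers q"
      using a by (rule K.m_closed[rotated])
    also have "inv (x \<otimes> powprod e k (\<lambda>l. - c l x)) = inv x \<otimes> powprod e k (\<lambda>l. c l x)"
      using x Vc powprod_uminus[OF eG, where a = "\<lambda>l. - c l x"] by (simp add: inv_mult)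
    also have "(x \<otimes> powprod e k a) \<otimes> (inv x \<otimes> powprod e k (\<lambda>l. c l x)) =
        powprod e k (\<lambda>l. a l + c l x)"
    proof -
      let ?w = "powprod e k a \<otimes> powprod e k (\<lambda>l. c l x)"
      have "(x \<otimes> powprod e k a) \<otimes> (inv x \<otimes> powprod e k (\<lambda>l. c l x)) = x \<otimes> (inv x \<otimes> ?w)"
        using x Vc by (simp add: m_ac)
      also have "\<dots> = (x \<otimes> inv x) \<otimes> ?w" using x Vc by (intro m_assoc[symmetric]) auto
      finally show ?thesis using x Vc by (simp add: powprod_add[OF eG])
    qed
    finally have "\<forall>i<k. int q dvd a i + c i x"
      using ind[unfolded qindep_def, THEN conjunct2, THEN spec, of "\<lambda>l. a l + c l x"] by simp
    then have "int q dvd a l + c l x" using l by blast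
    then show ?thesis by (simp add: cong_iff_dvd_diff add.commute)
  qed
  have add: "[c l (x \<otimes> y) = c l x + c l y] (mod int q)"
    if "l < k" "x \<in> carrier G" "y \<in> carrier G" for l x y
  proof -
    have "(x \<otimes> powprod e k (\<lambda>l. - c l x)) \<otimes> (y \<otimes> powprod e k (\<lambda>l. - c l y)) \<in> qpowers q"
      using c[OF that(2)] c[OF that(3)] by (rule K.m_closed)
    also have "(x \<otimes> powprod e k (\<lambda>l. - c l x)) \<otimes> (y \<otimes> powprod e k (\<lambda>l. - c l y)) =
        (x \<otimes> y) \<otimes> powprod e k (\<lambda>l. - c l x + - c l y)"
      using that Vc powprod_add[where a = "\<lambda>l. - c l x" and b = "\<lambda>l. - c l y", OF eG]
      by (simp only: m_ac m_closed)
    finally show ?thesis using uniq[of "x \<otimes> y" "\<lambda>l. - c l x + - c l y" l] that by (simp add: add.commute)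
  qed
  have cK: "[c l x = 0] (mod int q)" if "x \<in> qpowers q" "l < k" for l x
  proof -
    have xG: "x \<in> carrier G" using that(1) by (rule K.mem_carrier)
    then have "x \<otimes> powprod e k (\<lambda>_. 0) \<in> qpowers q" using that(1) by (simp add: powprod_zero)
    from uniq[OF xG this that(2)] show ?thesis by simp
  qed
  have cV: "[c l (powprod e k \<tau>) = \<tau> l] (mod int q)" if "l < k" for l \<tau>
    using uniq[OF Vc, of \<tau> "\<lambda>l. - \<tau> l" l] that Vc K.one_closed by (simp add: powprod_uminus[OF eG])
  have c_nat: "[c l (x [^] (n :: nat)) = int n * c l x] (mod int q)" if "l < k" "x \<in> carrier G" for l x n
  proof (induction n)
    case 0
    then show ?case using cK[OF K.one_closed that(1)] by simp
  next
    case (Suc n)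
    have "[c l (x [^] Suc n) = c l (x [^] n) + c l x] (mod int q)" using add that by simp
    also have "[c l (x [^] n) + c l x = int n * c l x + c l x] (mod int q)"
      using Suc by (intro cong_add) auto
    finally show ?case by (simp add: algebra_simps)
  qed
  have c_inv: "[c l (inv x) = - c l x] (mod int q)" if "l < k" "x \<in> carrier G" for l x
  proof -
    have "[c l (inv x) + c l x = c l (inv x \<otimes> x)] (mod int q)" using add[of l "inv x" x] that by (simp add: cong_sym)
    also have "[c l (inv x \<otimes> x) = 0] (mod int q)" using cK[OF K.one_closed that(1)] that by simp
    finally show ?thesis by (simp add: cong_iff_dvd_diff)
  qed
  have c_pow: "[c l (x [^] n) = n * c l x] (mod int q)" if "l < k" "x \<in> carrier G" for l x and n :: int
  proof (cases n)
    case (nonneg m)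
    then show ?thesis using c_nat[OF that, of m] by (simp add: int_pow_int)
  next
    case (neg m)
    have "[c l (inv (x [^] Suc m)) = - c l (x [^] Suc m)] (mod int q)" using that by (intro c_inv) auto
    also have "[- c l (x [^] Suc m) = - (int (Suc m) * c l x)] (mod int q)"
      using c_nat[OF that, of "Suc m"] by (simp only: cong_minus_minus_iff)
    finally show ?thesis using that unfolding neg int_pow_neg_int[OF that(2)]
      by (simp add: algebra_simps)
  qed
  have endo: "\<exists>\<Lambda>. \<forall>l<k. \<forall>x\<in>carrier G. [c l (\<phi> x) = (\<Sum>i<k. \<Lambda> l i * c i x)] (mod int q)"
    if \<phi>: "\<phi> \<in> hom G G" for \<phi>
  proof -
    interpret \<phi>: group_hom G G \<phi> using \<phi> by unfold_locales
    have V: "[c l (\<phi> (powprod e n a)) = (\<Sum>i<n. c l (\<phi> (e i)) * a i)] (mod int q)"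
      if "n \<le> k" "l < k" for n l a
      using that
    proof (induction n)
      case 0
      then show ?case using cK[OF K.one_closed] by simp
    next
      case (Suc n)
      have en: "e n \<in> carrier G" and Vn: "powprod e n a \<in> carrier G"
        using Suc.prems eG powprod_closed[of n e] by auto
      then have "[c l (\<phi> (powprod e (Suc n) a)) = c l (\<phi> (powprod e n a)) + c l (\<phi> (e n) [^] a n)] (mod int q)"
        using add[OF Suc.prems(2)] by (simp add: \<phi>.hom_int_pow)
      also have "[c l (\<phi> (powprod e n a)) + c l (\<phi> (e n) [^] a n) =
          (\<Sum>i<n. c l (\<phi> (e i)) * a i) + a n * c l (\<phi> (e n))] (mod int q)"
        using Suc en c_pow by (intro cong_add) auto
      finally show ?case by (simp add: mult.commute)
    qed
    have "[c l (\<phi> x) = (\<Sum>i<k. c l (\<phi> (e i)) * c i x)] (mod int q)" if l: "l < k" and x: "x \<in> carrier G" for l x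
    proof -
      let ?V = "powprod e k (\<lambda>i. c i x)"
      have "x \<otimes> inv ?V \<in> qpowers q" using c[OF x] by (simp add: powprod_uminus[OF eG])
      then obtain y where y: "y \<in> carrier G" "x \<otimes> inv ?V = y [^] q" by (auto simp: qpowers_def)
      then have "x = y [^] q \<otimes> ?V" using x Vc by (metis inv_closed inv_inv inv_solve_right' m_closed nat_pow_closed)
      then have "\<phi> x = \<phi> (y [^] q \<otimes> ?V)" by (rule arg_cong)
      then have "\<phi> x = \<phi> y [^] q \<otimes> \<phi> ?V" using y Vc by (simp add: \<phi>.hom_nat_pow)
      then have "[c l (\<phi> x) = c l (\<phi> y [^] q) + c l (\<phi> ?V)] (mod int q)"
        using add[OF l, of "\<phi> y [^] q" "\<phi> ?V"] y Vc by simp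
      also have "[c l (\<phi> y [^] q) + c l (\<phi> ?V) = 0 + (\<Sum>i<k. c l (\<phi> (e i)) * c i x)] (mod int q)"
        using cK[OF _ l] V[OF _ l, of k "\<lambda>i. c i x"] y by (intro cong_add) (auto simp: qpowers_def)
      finally show ?thesis by simp
    qed
    then show ?thesis by (intro exI[of _ "\<lambda>l i. c l (\<phi> (e i))"]) blast
  qed
  \<comment> \<open>If every element is a q-th power, it is a q^n-th power for every n, and q^j, the
    order of G, makes it trivial.\<close>
  have "k \<noteq> 0"
  proof
    assume "k = 0"
    then have G: "x \<in> qpowers q" if "x \<in> carrier G" for x
    proof -
      have "x \<in> qspan q e k" using span that by simp
      then show ?thesis using \<open>k = 0\<close> by (auto simp: qspan_def)
    qed
    have "\<exists>y\<in>carrier G. x = y [^] (q ^ n)" if "x \<in> carrier G" for x n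
    proof (induction n)
      case 0
      then show ?case using that by auto
    next
      case (Suc n)
      then obtain y where y: "y \<in> carrier G" "x = y [^] (q ^ n)" by blast
      then obtain z where "z \<in> carrier G" "y = z [^] q" using G[of y] by (auto simp: qpowers_def)
      then show ?case using y by (intro bexI[of _ z]) (simp_all add: nat_pow_pow)
    qed
    then have "x = \<one>" if "x \<in> carrier G" for x
      using that pow_order_eq_1 ord(1) by metis
    then have "carrier G = {\<one>}" by auto
    then have "order G = 1" by (simp add: order_def)
    then show False using ord prime_gt_1_nat[OF q] by simp
  qed
  then have "k \<ge> 1" by simp
  then show thesis
  proof (rule that)
    show "\<forall>l<k. \<forall>x\<in>carrier G. \<forall>y\<in>carrier G. [c l (x \<otimes> y) = c l x + c l y] (mod int q)"
      using add by blast
    show "\<forall>\<tau>. \<exists>x\<in>carrier G. \<forall>l<k. [c l x = \<tau> l] (mod int q)" using cV Vc by blast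
    show "\<forall>\<phi>\<in>hom G G. \<exists>\<Lambda>. \<forall>l<k. \<forall>x\<in>carrier G. [c l (\<phi> x) = (\<Sum>i<k. \<Lambda> l i * c i x)] (mod int q)"
      using endo by blast
  qed
qed

end

section \<open>Central congruences\<close>

text \<open>A central factor \<delta> / \<epsilon>. Modulo \<epsilon> the Mal'cev polynomial p x y z
  behaves like x - y + z whenever x and y are related by \<delta>, even if z lies in another class
  of \<delta>; zr is an arbitrary zero.\<close>

locale central_pair = ualgebra ar A for ar :: "'f \<Rightarrow> nat" and A :: "('f, 'a) ualg" +
  fixes p :: "'a \<Rightarrow> 'a \<Rightarrow> 'a \<Rightarrow> 'a" and zr :: 'a and \<delta> \<epsilon> :: "('a \<times> 'a) set"
  assumes pol3_p: "pol3 p"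
    and maltsev: "\<And>x y. x \<in> uni A \<Longrightarrow> y \<in> uni A \<Longrightarrow> p x x y = y \<and> p x y y = x"
    and zr: "zr \<in> uni A"
    and \<delta>: "ucong ar A \<delta>" and \<epsilon>: "ucong ar A \<epsilon>" and \<epsilon>_le: "\<epsilon> \<subseteq> \<delta>" and cen: "central \<delta> \<epsilon>"
begin

lemma p_simps [simp]:
  "x \<in> U \<Longrightarrow> y \<in> U \<Longrightarrow> p x x y = y" "x \<in> U \<Longrightarrow> y \<in> U \<Longrightarrow> p x y y = x"
  using maltsev by auto

lemma p_closed [simp]: "x \<in> U \<Longrightarrow> y \<in> U \<Longrightarrow> z \<in> U \<Longrightarrow> p x y z \<in> U"
  using pol3_closed[OF pol3_p] .

lemmas zr_in [simp] = zr
lemmas \<epsilon>_sym = ucong_sym[OF \<epsilon>] and \<epsilon>_trans [trans] = ucong_trans[OF \<epsilon>] and \<epsilon>_refl = ucong_refl[OF \<epsilon>]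
lemmas \<delta>_sym = ucong_sym[OF \<delta>] and \<delta>_trans = ucong_trans[OF \<delta>] and \<delta>_refl = ucong_refl[OF \<delta>]

lemma \<delta>_U: "(x, y) \<in> \<delta> \<Longrightarrow> x \<in> U" "(x, y) \<in> \<delta> \<Longrightarrow> y \<in> U"
  using ucong_subset[OF \<delta>] by auto

lemma \<epsilon>_U: "(x, y) \<in> \<epsilon> \<Longrightarrow> x \<in> U" "(x, y) \<in> \<epsilon> \<Longrightarrow> y \<in> U"
  using ucong_subset[OF \<epsilon>] by auto

lemmas p_cong = pol3_cong[OF _ pol3_p]

text \<open>Centrality: the difference \<open>t z u - t z v\<close> does not depend on \<open>z\<close>.\<close>

lemma difference_const:
  assumes t: "pol t" and a: "range a \<subseteq> U" and b: "range b \<subseteq> U" and uv: "(u, v) \<in> \<delta>"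
  shows "(t b u, p (t a u) (t a v) (t b v)) \<in> \<epsilon>"
proof -
  have U: "u \<in> U" "v \<in> U" using uv \<delta>_U by auto
  \<comment> \<open>At w = v this takes the value t b v both for z = a and for z = b; centrality
    transports the agreement to w = u.\<close>
  let ?g = "\<lambda>z w. p (t z w) (t z v) (t b v)"
  have tU: "t a u \<in> U" "t a v \<in> U" "t b u \<in> U" "t b v \<in> U" using pol_closed t a b U by auto
  have g: "pol ?g"
    by (rule pol3_app[OF pol3_p t pol_fix(2)[OF t pol_const[OF U(2)]] pol_const[OF tU(4)]])
  have "(?g b v, ?g a v) \<in> \<epsilon>" using tU \<epsilon>_refl by simp
  then have "(?g b u, ?g a u) \<in> \<epsilon>"
    using cen[unfolded central_def, rule_format, of ?g b a v u] g a b \<delta>_sym[OF uv] by blast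
  then show ?thesis using tU by simp
qed

lemma difference_const2:
  assumes s: "pol (\<lambda>z w. s (z 0) w)" and ab: "a \<in> U" "b \<in> U" and uv: "(u, v) \<in> \<delta>"
  shows "(s b u, p (s a u) (s a v) (s b v)) \<in> \<epsilon>"
  using difference_const[OF s _ _ uv, of "\<lambda>_. a" "\<lambda>_. b"] ab by auto

text \<open>The polynomial p w y z adds the difference of x and y to the base point z; by
  \<open>difference_const2\<close> it does not matter at which base point this difference is read
  off.\<close>

lemma translate:
  assumes "(x, y) \<in> \<delta>" "e \<in> U" "e' \<in> U"
  shows "(p x y e', p (p x y e) e e') \<in> \<epsilon>"
proof -
  have y: "y \<in> U" using assms \<delta>_U by auto
  have "pol (\<lambda>z w. p w y (z 0))" by (intro pol3_app[OF pol3_p] pol.intros y)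
  from difference_const2[OF this assms(2,3,1)] show ?thesis using y assms by simp
qed

lemma difference_eq:
  assumes t: "pol t" and a: "range a \<subseteq> U" and b: "range b \<subseteq> U" and uv: "(u, v) \<in> \<delta>"
  shows "(p (t b u) (t b v) zr, p (t a u) (t a v) zr) \<in> \<epsilon>"
proof -
  have U: "u \<in> U" "v \<in> U" using uv \<delta>_U by auto
  have tU: "t a u \<in> U" "t a v \<in> U" "t b u \<in> U" "t b v \<in> U" using pol_closed t a b U by auto
  have "(t a u, t a v) \<in> \<delta>" using a by (intro pol_cong[OF \<delta> t _ uv] \<delta>_refl) auto
  then have "(p (t a u) (t a v) zr, p (p (t a u) (t a v) (t b v)) (t b v) zr) \<in> \<epsilon>"
    using translate tU by simp
  moreover have "(p (t b u) (t b v) zr, p (p (t a u) (t a v) (t b v)) (t b v) zr) \<in> \<epsilon>"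
    using difference_const[OF assms] tU \<epsilon>_refl by (intro p_cong[OF \<epsilon>]) auto
  ultimately show ?thesis using \<epsilon>_sym \<epsilon>_trans by blast
qed

lemma p_\<delta>: "(x, y) \<in> \<delta> \<Longrightarrow> e \<in> U \<Longrightarrow> (p x y e, e) \<in> \<delta>"
  using p_cong[OF \<delta>, of x y y y e e] \<delta>_refl \<delta>_U by simp

section \<open>The abelian group of a central factor\<close>

definition nrm :: "'a \<Rightarrow> 'a" where "nrm x = (SOME y. y \<in> \<epsilon> `` {x})"

lemma nrm: "x \<in> U \<Longrightarrow> (x, nrm x) \<in> \<epsilon>"
  unfolding nrm_def using someI[of "\<lambda>y. y \<in> \<epsilon> `` {x}" x] \<epsilon>_refl by simp

lemma nrm_eq: "(x, y) \<in> \<epsilon> \<Longrightarrow> nrm x = nrm y"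
proof -
  assume "(x, y) \<in> \<epsilon>"
  then have "\<epsilon> `` {x} = \<epsilon> `` {y}" using \<epsilon>_sym \<epsilon>_trans by blast
  then show ?thesis by (simp add: nrm_def)
qed

lemma nrm_eq_iff: "x \<in> U \<Longrightarrow> y \<in> U \<Longrightarrow> nrm x = nrm y \<longleftrightarrow> (x, y) \<in> \<epsilon>"
  using nrm nrm_eq \<epsilon>_sym \<epsilon>_trans by metis

text \<open>The quotient of the \<delta>-class of zr by \<epsilon>, with g + h = g - zr + h. Its
  elements are representatives in A, so that basic operations can be applied to them in
  \<open>lin\<close>.\<close>

definition grp :: "'a monoid" where
  "grp = \<lparr>carrier = nrm ` (\<delta> `` {zr}), mult = (\<lambda>g h. nrm (p g zr h)), one = nrm zr\<rparr>"

lemma grp_simps [simp]: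
  "carrier grp = nrm ` (\<delta> `` {zr})" "g \<otimes>\<^bsub>grp\<^esub> h = nrm (p g zr h)" "\<one>\<^bsub>grp\<^esub> = nrm zr"
  by (auto simp: grp_def)

lemma carrierD: "g \<in> carrier grp \<Longrightarrow> (g, zr) \<in> \<delta> \<and> g \<in> U \<and> nrm g = g"
proof -
  assume "g \<in> carrier grp"
  then obtain x where x: "(zr, x) \<in> \<delta>" "g = nrm x" by auto
  then have "(x, g) \<in> \<epsilon>" using nrm \<delta>_U by auto
  moreover from this have "(g, zr) \<in> \<delta>" using x(1) \<epsilon>_le \<delta>_sym \<delta>_trans by blast
  ultimately show ?thesis using x(2) nrm_eq \<epsilon>_U by metis
qed

lemma carrierI: "(x, zr) \<in> \<delta> \<Longrightarrow> nrm x \<in> carrier grp"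
  using \<delta>_sym by auto

text \<open>Replacing zr by g for w in p (p w zr g') zr g'' causes the same difference for every
  g''. At g'' = zr it is the difference of p g zr g' and g', which by \<open>translate\<close> is
  that of g and zr.\<close>

lemma plus_assoc:
  assumes "(g, zr) \<in> \<delta>" "g' \<in> U" "g'' \<in> U"
  shows "(p (p g zr g') zr g'', p g zr (p g' zr g'')) \<in> \<epsilon>"
proof -
  have g: "g \<in> U" using assms \<delta>_U by auto
  let ?y = "p g' zr g''"
  have "pol (\<lambda>z w. p (p w zr g') zr (z 0))"
    by (intro pol3_app[OF pol3_p] pol.intros zr assms)
  from difference_const2[OF this zr assms(3,1)]
  have "(p (p g zr g') zr g'', p (p g zr g') g' ?y) \<in> \<epsilon>" using g assms by simp
  moreover have "(p g zr ?y, p (p g zr g') g' ?y) \<in> \<epsilon>" using translate assms g by simp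
  ultimately show ?thesis using \<epsilon>_sym \<epsilon>_trans by blast
qed

lemma plus_comm:
  assumes "(g, zr) \<in> \<delta>" "g' \<in> U"
  shows "(p g zr g', p g' zr g) \<in> \<epsilon>"
proof -
  have g: "g \<in> U" using assms \<delta>_U by auto
  have "pol (\<lambda>z w. p (z 0) zr w)" by (intro pol3_app[OF pol3_p] pol.intros zr)
  from difference_const2[OF this zr assms(2,1)] show ?thesis using g assms \<epsilon>_sym by simp
qed

lemma grp_comm_group: "comm_group grp"
proof (rule comm_groupI)
  fix x y assume x: "x \<in> carrier grp" and y: "y \<in> carrier grp"
  note xD = carrierD[OF x] and yD = carrierD[OF y]
  have "(p x zr y, zr) \<in> \<delta>" using p_\<delta>[of x zr y] xD yD \<delta>_trans by blast
  then show "x \<otimes>\<^bsub>grp\<^esub> y \<in> carrier grp" using carrierI by simp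
  show "x \<otimes>\<^bsub>grp\<^esub> y = y \<otimes>\<^bsub>grp\<^esub> x" using plus_comm xD yD nrm_eq by simp
next
  show "\<one>\<^bsub>grp\<^esub> \<in> carrier grp" using \<delta>_refl by auto
next
  fix x y z assume x: "x \<in> carrier grp" and y: "y \<in> carrier grp" and z: "z \<in> carrier grp"
  note D = carrierD[OF x] carrierD[OF y] carrierD[OF z]
  have "(p (nrm (p x zr y)) zr z, p (p x zr y) zr z) \<in> \<epsilon>"
    using D nrm \<epsilon>_sym \<epsilon>_refl by (intro p_cong[OF \<epsilon>]) auto
  also have "(p (p x zr y) zr z, p x zr (p y zr z)) \<in> \<epsilon>" using plus_assoc D by simp
  also have "(p x zr (p y zr z), p x zr (nrm (p y zr z))) \<in> \<epsilon>"
    using D nrm \<epsilon>_refl by (intro p_cong[OF \<epsilon>]) auto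
  finally show "x \<otimes>\<^bsub>grp\<^esub> y \<otimes>\<^bsub>grp\<^esub> z = x \<otimes>\<^bsub>grp\<^esub> (y \<otimes>\<^bsub>grp\<^esub> z)" using nrm_eq by simp
next
  fix x assume x: "x \<in> carrier grp"
  note D = carrierD[OF x]
  have "(p (nrm zr) zr x, p zr zr x) \<in> \<epsilon>"
    using D nrm \<epsilon>_sym \<epsilon>_refl by (intro p_cong[OF \<epsilon>]) auto
  then show "\<one>\<^bsub>grp\<^esub> \<otimes>\<^bsub>grp\<^esub> x = x" using nrm_eq D by fastforce
  let ?y = "p zr x zr"
  have zx: "(zr, x) \<in> \<delta>" using D \<delta>_sym by blast
  then have "nrm ?y \<in> carrier grp" using p_\<delta> carrierI by simp
  moreover have "(p (nrm ?y) zr x, p ?y zr x) \<in> \<epsilon>"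
    using D nrm \<epsilon>_sym \<epsilon>_refl by (intro p_cong[OF \<epsilon>]) auto
  moreover have "(p zr x x, p ?y zr x) \<in> \<epsilon>" by (rule translate[OF zx zr]) (use D in auto)
  ultimately have "nrm ?y \<in> carrier grp \<and> nrm ?y \<otimes>\<^bsub>grp\<^esub> x = \<one>\<^bsub>grp\<^esub>" using D nrm_eq by fastforce
  then show "\<exists>y\<in>carrier grp. y \<otimes>\<^bsub>grp\<^esub> x = \<one>\<^bsub>grp\<^esub>" by blast
qed

definition dif :: "'a \<Rightarrow> 'a \<Rightarrow> 'a" where "dif x y = nrm (p x y zr)"

lemma dif_carrier: "(x, y) \<in> \<delta> \<Longrightarrow> dif x y \<in> carrier grp"
  unfolding dif_def using p_\<delta> by (intro carrierI) auto

lemma dif_cong: "(x, x') \<in> \<epsilon> \<Longrightarrow> (y, y') \<in> \<epsilon> \<Longrightarrow> dif x y = dif x' y'"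
  unfolding dif_def using \<epsilon>_refl by (intro nrm_eq p_cong[OF \<epsilon>]) auto

lemma dif_add:
  assumes xy: "(x, y) \<in> \<delta>" and yz: "(y, z) \<in> \<delta>"
  shows "dif x z = dif x y \<otimes>\<^bsub>grp\<^esub> dif y z"
proof -
  have U: "x \<in> U" "y \<in> U" "z \<in> U" using \<delta>_U xy yz by auto
  have "pol (\<lambda>s w. p w z (s 0))" by (intro pol3_app[OF pol3_p] pol.intros U)
  from difference_const2[OF this U(3) zr xy]
  have "(p x z zr, p x y (p y z zr)) \<in> \<epsilon>" using U by simp
  also have "(p x y (p y z zr), p (p x y zr) zr (p y z zr)) \<in> \<epsilon>" using translate[OF xy] U by simp
  also have "(p (p x y zr) zr (p y z zr), p (nrm (p x y zr)) zr (nrm (p y z zr))) \<in> \<epsilon>"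
    using U nrm \<epsilon>_refl by (intro p_cong[OF \<epsilon>]) auto
  finally show ?thesis using nrm_eq by (simp add: dif_def)
qed

text \<open>Taking y instead of zr as base point turns p x y zr and zr into x and y; centrality
  allows this exchange.\<close>

lemma dif_one_iff:
  assumes xy: "(x, y) \<in> \<delta>"
  shows "dif x y = \<one>\<^bsub>grp\<^esub> \<longleftrightarrow> (x, y) \<in> \<epsilon>"
proof -
  have U: "x \<in> U" "y \<in> U" using \<delta>_U xy by auto
  let ?t = "\<lambda>z w. p w y (z (0 :: nat))"
  have t: "pol ?t" by (intro pol3_app[OF pol3_p] pol.intros U)
  have "(x, y) \<in> \<epsilon>" if "(p x y zr, zr) \<in> \<epsilon>"
    using cen[unfolded central_def, rule_format, of ?t "\<lambda>_. zr" "\<lambda>_. y" x y] t xy U that by auto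
  moreover have "(p x y zr, p y y zr) \<in> \<epsilon>" if "(x, y) \<in> \<epsilon>"
    using that U \<epsilon>_refl by (intro p_cong[OF \<epsilon>]) auto
  ultimately show ?thesis using U by (auto simp: dif_def nrm_eq_iff)
qed

lemma dif_surj:
  assumes g: "g \<in> carrier grp" and y: "y \<in> U"
  shows "\<exists>x. (x, y) \<in> \<delta> \<and> dif x y = g"
proof -
  note D = carrierD[OF g]
  have "(p g zr zr, p (p g zr y) y zr) \<in> \<epsilon>" by (rule translate) (use D y in auto)
  then have "dif (p g zr y) y = g" using D nrm_eq unfolding dif_def by fastforce
  then show ?thesis using p_\<delta>[of g zr y] D y by blast
qed

section \<open>Linear parts of the basic operations\<close>

definition lin :: "'f \<Rightarrow> nat \<Rightarrow> 'a \<Rightarrow> 'a" where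
  "lin f i g = dif (opn A f ((replicate (ar f) zr)[i := g])) (opn A f (replicate (ar f) zr))"

lemma opn_update_cong:
  assumes \<theta>: "ucong ar A \<theta>" and ws: "length ws = ar f" "set ws \<subseteq> U" and uv: "(u, v) \<in> \<theta>"
  shows "(opn A f (ws[i := u]), opn A f (ws[i := v])) \<in> \<theta>"
proof -
  have "list_all2 (\<lambda>x y. (x, y) \<in> \<theta>) (ws[i := u]) (ws[i := v])"
    using ws uv ucong_refl[OF \<theta>]
    by (auto simp: list_all2_conv_all_nth nth_list_update subset_iff in_set_conv_nth)
      (metis nth_list_update_eq nth_list_update_neq)
  then show ?thesis using \<theta> ws by (simp add: ucong_def)
qed

text \<open>Centrality makes the effect of a change in argument i independent of the other arguments
  and of the point where the change starts; this is why \<open>lin\<close> may be defined with zr in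
  all these places.\<close>

lemma dif_opn_update:
  assumes ws: "length ws = ar f" "set ws \<subseteq> U" and i: "i < ar f" and uv: "(u, v) \<in> \<delta>"
  shows "dif (opn A f (ws[i := u])) (opn A f (ws[i := v])) = lin f i (dif u v)"
proof -
  have U: "u \<in> U" "v \<in> U" using \<delta>_U uv by auto
  define g where "g = p u v zr"
  have g: "(g, zr) \<in> \<delta>" "g \<in> U" using p_\<delta>[OF uv zr] U by (auto simp: g_def)
  \<comment> \<open>With p w zr (z i) in argument i, the same two values g and zr of w serve for
    both tuples: for z = b they move the argument between u, up to \<epsilon>, and v; for z
    constantly zr, between g and zr.\<close>
  define t where "t = (\<lambda>z w. opn A f (map (\<lambda>j. if j = i then p w zr (z i) else z j) [0..<ar f]))"
  have "pol (\<lambda>z w. opn A f (map (\<lambda>t. t z w)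
      (map (\<lambda>j z w. if j = i then p w zr (z i) else z j) [0..<ar f])))"
  proof (rule pol_op)
    have "pol (\<lambda>z w. if j = i then p w zr (z i) else z j)" for j
      by (cases "j = i") (auto intro!: pol3_app[OF pol3_p] intro: pol.intros zr)
    then show "\<forall>t\<in>set (map (\<lambda>j z w. if j = i then p w zr (z i) else z j) [0..<ar f]). pol t" by auto
  qed simp
  then have t: "pol t" by (simp add: t_def o_def)
  define b where "b j = (if j < ar f then ws[i := v] ! j else zr)" for j
  have wsv: "set (ws[i := v]) \<subseteq> U" using ws U set_update_subset_insert[of ws i v] by auto
  have b: "range b \<subseteq> U"
  proof -
    have "b j \<in> U" for j using wsv ws(1) zr nth_mem[of j "ws[i := v]"] by (auto simp: b_def)
    then show ?thesis by auto
  qed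
  have tb: "t b w = opn A f (ws[i := p w zr v])" for w
    unfolding t_def using ws i by (intro arg_cong[of _ _ "opn A f"] nth_equalityI)
      (auto simp: b_def nth_list_update)
  have ta: "t (\<lambda>_. zr) w = opn A f ((replicate (ar f) zr)[i := p w zr zr])" for w
    unfolding t_def using i by (intro arg_cong[of _ _ "opn A f"] nth_equalityI)
      (auto simp: nth_list_update)
  have "(p (t b g) (t b zr) zr, p (t (\<lambda>_. zr) g) (t (\<lambda>_. zr) zr) zr) \<in> \<epsilon>"
    using difference_eq[OF t _ b g(1)] zr by auto
  then have eq: "dif (t b g) (t b zr) = dif (t (\<lambda>_. zr) g) (t (\<lambda>_. zr) zr)"
    unfolding dif_def by (rule nrm_eq)
  have "(p u v v, p (p u v zr) zr v) \<in> \<epsilon>" by (rule translate[OF uv zr U(2)])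
  then have "(p g zr v, u) \<in> \<epsilon>" using U \<epsilon>_sym by (simp add: g_def)
  then have "(t b g, opn A f (ws[i := u])) \<in> \<epsilon>" unfolding tb by (rule opn_update_cong[OF \<epsilon> ws])
  moreover have tbz: "t b zr = opn A f (ws[i := v])" using tb U by simp
  moreover have "opn A f (ws[i := v]) \<in> U"
    using ws wsv by (intro opn_closed) auto
  ultimately have "dif (t b g) (t b zr) = dif (opn A f (ws[i := u])) (opn A f (ws[i := v]))"
    using \<epsilon>_refl by (intro dif_cong) auto
  moreover have "dif (t (\<lambda>_. zr) g) (t (\<lambda>_. zr) zr) = lin f i (dif u v)"
  proof -
    have rep: "length (replicate (ar f) zr) = ar f" "set (replicate (ar f) zr) \<subseteq> U" using zr by auto
    have "(g, dif u v) \<in> \<epsilon>" unfolding dif_def g_def[symmetric] using nrm[OF g(2)] .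
    then have "(opn A f ((replicate (ar f) zr)[i := g]), opn A f ((replicate (ar f) zr)[i := dif u v])) \<in> \<epsilon>"
      by (rule opn_update_cong[OF \<epsilon> rep])
    moreover have "opn A f (replicate (ar f) zr) \<in> U" using rep by (rule opn_closed)
    moreover have "(replicate (ar f) zr)[i := zr] = replicate (ar f) zr" by (metis i list_update_id nth_replicate)
    ultimately show ?thesis
      using g(2) \<epsilon>_refl unfolding lin_def ta by (intro dif_cong) auto
  qed
  ultimately show ?thesis using eq by simp
qed

text \<open>The change from zr to the sum of x and y is cut at y. The part from y on has difference
  x, so by \<open>dif_opn_update\<close> it contributes \<open>lin f i x\<close>.\<close>

lemma lin_hom: "i < ar f \<Longrightarrow> lin f i \<in> hom grp grp"
proof (rule homI)
  assume i: "i < ar f"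
  let ?os = "replicate (ar f) zr"
  have os: "length ?os = ar f" "set ?os \<subseteq> U" using zr by auto
  have os_i: "?os[i := zr] = ?os" by (metis i list_update_id nth_replicate)
  have rel: "(opn A f (?os[i := u]), opn A f (?os[i := v])) \<in> \<delta>" if "(u, v) \<in> \<delta>" for u v
    using opn_update_cong[OF \<delta> os that] .
  fix x assume x: "x \<in> carrier grp"
  note xD = carrierD[OF x]
  show "lin f i x \<in> carrier grp"
    unfolding lin_def using rel[of x zr] xD by (intro dif_carrier) (simp add: os_i)
  fix y assume y: "y \<in> carrier grp"
  note yD = carrierD[OF y]
  define k where "k = nrm (p x zr y)"
  have k_eq: "(k, p x zr y) \<in> \<epsilon>" using nrm \<epsilon>_sym xD yD by (simp add: k_def)
  have ky: "(k, y) \<in> \<delta>" using k_eq \<epsilon>_le p_\<delta>[of x zr y] xD yD \<delta>_trans by blast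
  have "(p k y zr, p (p x zr y) y zr) \<in> \<epsilon>"
    using k_eq \<epsilon>_refl yD by (intro p_cong[OF \<epsilon>]) auto
  moreover have "(p x zr zr, p (p x zr y) y zr) \<in> \<epsilon>" by (rule translate) (use xD yD in auto)
  ultimately have "(p k y zr, x) \<in> \<epsilon>" using xD \<epsilon>_sym \<epsilon>_trans by (metis p_simps(2) zr)
  then have "dif k y = nrm x" unfolding dif_def by (rule nrm_eq)
  then have dif_k: "dif k y = x" using xD by simp
  have "lin f i k = dif (opn A f (?os[i := k])) (opn A f (?os[i := y])) \<otimes>\<^bsub>grp\<^esub>
      dif (opn A f (?os[i := y])) (opn A f ?os)"
    unfolding lin_def using rel[OF ky] rel[of y zr] yD by (intro dif_add) (simp_all add: os_i)
  also have "dif (opn A f (?os[i := k])) (opn A f (?os[i := y])) = lin f i x"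
    using dif_opn_update[OF os i ky] dif_k by simp
  finally show "lin f i (x \<otimes>\<^bsub>grp\<^esub> y) = lin f i x \<otimes>\<^bsub>grp\<^esub> lin f i y"
    by (simp add: k_def lin_def)
qed

text \<open>Exchanging the arguments one at a time gives a telescoping product of values of
  \<open>lin\<close>, which the additive map c turns into a sum.\<close>

lemma additive_dif_opn:
  fixes c :: "'a \<Rightarrow> int"
  assumes c: "\<And>x y. x \<in> carrier grp \<Longrightarrow> y \<in> carrier grp \<Longrightarrow> [c (x \<otimes>\<^bsub>grp\<^esub> y) = c x + c y] (mod m)"
    and xs: "length xs = ar f" and ys: "length ys = ar f" and xy: "\<And>j. j < ar f \<Longrightarrow> (xs ! j, ys ! j) \<in> \<delta>"
  shows "[c (dif (opn A f xs) (opn A f ys)) = (\<Sum>j<ar f. c (lin f j (dif (xs ! j) (ys ! j))))] (mod m)"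
proof -
  interpret G: comm_group grp by (rule grp_comm_group)
  define zs where "zs i = take i xs @ drop i ys" for i
  have len: "length (zs i) = ar f" if "i \<le> ar f" for i using xs ys that by (simp add: zs_def)
  have sets: "set xs \<subseteq> U" "set ys \<subseteq> U" using xs ys \<delta>_U[OF xy] by (auto simp: in_set_conv_nth)
  have zsU: "set (zs i) \<subseteq> U" for i
    using sets by (auto simp: zs_def dest: in_set_takeD in_set_dropD)
  have zs_Suc: "zs (Suc i) = (zs i)[i := xs ! i]" "(zs i)[i := ys ! i] = zs i" if "i < ar f" for i
    using xs ys that by (auto simp: zs_def nth_append nth_list_update nth_Cons split: nat.splits intro!: nth_equalityI)
  have rel: "(opn A f (zs (Suc i)), opn A f (zs i)) \<in> \<delta>" if "i < ar f" for i
    using opn_update_cong[OF \<delta> len zsU xy[OF that], of i i] zs_Suc[OF that] that by simp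
  have zU: "opn A f (zs i) \<in> U" if "i \<le> ar f" for i using len[OF that] zsU by (rule opn_closed)
  have "(opn A f (zs i), opn A f ys) \<in> \<delta> \<and>
      [c (dif (opn A f (zs i)) (opn A f ys)) = (\<Sum>j<i. c (lin f j (dif (xs ! j) (ys ! j))))] (mod m)"
    if "i \<le> ar f" for i
    using that
  proof (induction i)
    case 0
    have y: "opn A f ys \<in> U" using ys sets by (intro opn_closed)
    have "dif (opn A f ys) (opn A f ys) = \<one>\<^bsub>grp\<^esub>"
      using dif_one_iff[OF \<delta>_refl[OF y]] \<epsilon>_refl[OF y] by blast
    moreover have "[c \<one>\<^bsub>grp\<^esub> = 0] (mod m)"
      using c[OF G.one_closed G.one_closed] by (metis G.one_closed G.r_one add_cancel_right_left cong_add_lcancel_0 cong_sym)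
    ultimately show ?case using \<delta>_refl[OF y] by (simp add: zs_def)
  next
    case (Suc i)
    then have i: "i < ar f" and IH: "(opn A f (zs i), opn A f ys) \<in> \<delta>"
      "[c (dif (opn A f (zs i)) (opn A f ys)) = (\<Sum>j<i. c (lin f j (dif (xs ! j) (ys ! j))))] (mod m)" by auto
    have "dif (opn A f (zs (Suc i))) (opn A f ys) =
        dif (opn A f (zs (Suc i))) (opn A f (zs i)) \<otimes>\<^bsub>grp\<^esub> dif (opn A f (zs i)) (opn A f ys)"
      using rel[OF i] IH(1) by (rule dif_add)
    also have "dif (opn A f (zs (Suc i))) (opn A f (zs i)) = lin f i (dif (xs ! i) (ys ! i))"
      using dif_opn_update[OF len zsU i xy[OF i], of i] zs_Suc[OF i] i by simp
    finally have "[c (dif (opn A f (zs (Suc i))) (opn A f ys)) =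
        c (lin f i (dif (xs ! i) (ys ! i))) + c (dif (opn A f (zs i)) (opn A f ys))] (mod m)"
      using c dif_carrier[OF IH(1)] dif_carrier[OF xy[OF i]] hom_in_carrier[OF lin_hom[OF i]]
      by (simp del: grp_simps)
    also have "[c (lin f i (dif (xs ! i) (ys ! i))) + c (dif (opn A f (zs i)) (opn A f ys)) =
        c (lin f i (dif (xs ! i) (ys ! i))) + (\<Sum>j<i. c (lin f j (dif (xs ! j) (ys ! j))))] (mod m)"
      using IH(2) by (intro cong_add) auto
    finally show ?case using \<delta>_trans[OF rel[OF i] IH(1)] by (simp add: add.commute)
  qed
  from this[of "ar f"] show ?thesis using xs ys by (simp add: zs_def)
qed

end

section \<open>Coordinates on the algebra\<close>

context ualgebra begin

text \<open>
  \<open>coords q H \<chi> s \<theta>\<close>: the functions \<open>\<chi> 0, \<dots>, \<chi> (H - 1)\<close>, read modulo \<open>q\<close>, are coordinates on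
  the quotient by \<open>\<theta>\<close>. The coordinates \<open>c\<close> with a common value of \<open>s c\<close> form a level, and
  \<open>s c\<close> is the number of coordinates on lower levels. Basic operations are affine on each level
  once the lower coordinates are fixed.
\<close>

definition level :: "nat \<Rightarrow> (nat \<Rightarrow> nat) \<Rightarrow> nat \<Rightarrow> nat set" where
  "level H s c = {c'. c' < H \<and> s c' = s c}"

text \<open>The coefficients do not vary with the lower coordinates; only the constant term of the
  affine map does. Subtracting the linear part therefore leaves a function of the lower coordinates
  alone.\<close>

definition affine_at ::
    "nat \<Rightarrow> nat \<Rightarrow> (nat \<Rightarrow> 'a \<Rightarrow> int) \<Rightarrow> (nat \<Rightarrow> nat) \<Rightarrow> 'f \<Rightarrow> nat \<Rightarrow> (nat \<Rightarrow> nat \<Rightarrow> int) \<Rightarrow> bool" where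
  "affine_at q H \<chi> s f c \<Lambda> \<longleftrightarrow> (\<forall>xs ys. length xs = ar f \<and> length ys = ar f \<and> set xs \<subseteq> U \<and> set ys \<subseteq> U \<and>
     (\<forall>j<ar f. \<forall>c'<s c. [\<chi> c' (xs ! j) = \<chi> c' (ys ! j)] (mod int q)) \<longrightarrow>
     [\<chi> c (opn A f xs) - \<chi> c (opn A f ys) =
       (\<Sum>j<ar f. \<Sum>c'\<in>level H s c. \<Lambda> j c' * (\<chi> c' (xs ! j) - \<chi> c' (ys ! j)))] (mod int q))"

definition coords :: "nat \<Rightarrow> nat \<Rightarrow> (nat \<Rightarrow> 'a \<Rightarrow> int) \<Rightarrow> (nat \<Rightarrow> nat) \<Rightarrow> ('a \<times> 'a) set \<Rightarrow> bool" where
  "coords q H \<chi> s \<theta> \<longleftrightarrow> (\<forall>c<H. s c \<le> c) \<and>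
     \<theta> = {(x, y). x \<in> U \<and> y \<in> U \<and> (\<forall>c<H. [\<chi> c x = \<chi> c y] (mod int q))} \<and>
     (\<forall>\<tau>. \<exists>x\<in>U. \<forall>c<H. [\<chi> c x = \<tau> c] (mod int q)) \<and>
     (\<forall>f. \<forall>c<H. \<exists>\<Lambda>. affine_at q H \<chi> s f c \<Lambda>)"

lemma coordsD:
  assumes "coords q H \<chi> s \<theta>"
  shows "\<And>c. c < H \<Longrightarrow> s c \<le> c"
    and "\<And>x y. (x, y) \<in> \<theta> \<longleftrightarrow> x \<in> U \<and> y \<in> U \<and> (\<forall>c<H. [\<chi> c x = \<chi> c y] (mod int q))"
    and "\<And>\<tau>. \<exists>x\<in>U. \<forall>c<H. [\<chi> c x = \<tau> c] (mod int q)"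
    and "\<And>f c. c < H \<Longrightarrow> \<exists>\<Lambda>. affine_at q H \<chi> s f c \<Lambda>"
  using assms unfolding coords_def by auto

lemma ucong_coords:
  assumes co: "coords q H \<chi> s \<theta>"
  shows "ucong ar A \<theta>"
  unfolding ucong_def
proof (intro conjI allI impI; (elim conjE)?)
  note \<theta> = coordsD(2)[OF co]
  show "equiv U \<theta>"
  proof (rule equivI)
    show "\<theta> \<subseteq> U \<times> U" using \<theta> by auto
    show "refl_on U \<theta>" using \<theta> by (auto simp: refl_on_def)
    show "sym \<theta>" using \<theta> cong_sym by (metis symI)
    show "trans \<theta>"
    proof (rule transI)
      fix x y z assume "(x, y) \<in> \<theta>" "(y, z) \<in> \<theta>"
      then show "(x, z) \<in> \<theta>" using \<theta> cong_trans by blast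
    qed
  qed
  fix f xs ys assume len: "length xs = ar f" and all: "list_all2 (\<lambda>x y. (x, y) \<in> \<theta>) xs ys"
  have ys: "length ys = ar f" using len all list_all2_lengthD by fastforce
  have nth: "(xs ! j, ys ! j) \<in> \<theta>" if "j < ar f" for j using all that len by (simp add: list_all2_conv_all_nth)
  have sets: "set xs \<subseteq> U" "set ys \<subseteq> U" using nth len ys \<theta> by (auto simp: in_set_conv_nth)
  have "[\<chi> c (opn A f xs) = \<chi> c (opn A f ys)] (mod int q)" if c: "c < H" for c
  proof -
    obtain \<Lambda> where "affine_at q H \<chi> s f c \<Lambda>" using coordsD(4)[OF co c] by blast
    moreover have "[\<chi> c' (xs ! j) = \<chi> c' (ys ! j)] (mod int q)" if "j < ar f" "c' < H" for j c'
      using nth[OF that(1)] that(2) \<theta> by blast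
    moreover have "s c \<le> c" using coordsD(1)[OF co c] .
    ultimately have "[\<chi> c (opn A f xs) - \<chi> c (opn A f ys) =
       (\<Sum>j<ar f. \<Sum>c'\<in>level H s c. \<Lambda> j c' * (\<chi> c' (xs ! j) - \<chi> c' (ys ! j)))] (mod int q)"
      using len ys sets c unfolding affine_at_def by auto
    also have "[(\<Sum>j<ar f. \<Sum>c'\<in>level H s c. \<Lambda> j c' * (\<chi> c' (xs ! j) - \<chi> c' (ys ! j))) =
        (\<Sum>j<ar f. \<Sum>c'\<in>level H s c. 0)] (mod int q)"
    proof (intro cong_sum)
      fix j c' assume "j \<in> {..<ar f}" "c' \<in> level H s c"
      then have "[\<chi> c' (xs ! j) = \<chi> c' (ys ! j)] (mod int q)"
        using nth \<theta> by (auto simp: level_def)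
      then show "[\<Lambda> j c' * (\<chi> c' (xs ! j) - \<chi> c' (ys ! j)) = 0] (mod int q)"
        by (simp add: cong_iff_dvd_diff)
    qed
    finally show ?thesis by (simp add: cong_iff_dvd_diff)
  qed
  then show "(opn A f xs, opn A f ys) \<in> \<theta>" using \<theta> opn_closed len ys sets by blast
qed

end

context central_pair begin

text \<open>The coordinates of the group of \<delta> / \<epsilon> form a new level. They vanish on
  q-th powers of that group, so \<delta>' may still lie strictly above \<epsilon>; what counts is
  that it lies strictly below \<delta>.\<close>

theorem coords_refine:
  assumes co: "coords q H \<chi> s \<delta>" and fin: "finite U" and q: "prime q"
    and ord: "order grp = q ^ j" "j \<ge> 1"
  obtains H' \<chi>' s' \<delta>' where "coords q H' \<chi>' s' \<delta>'" "\<delta>' \<subset> \<delta>"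
proof -
  have "\<delta> `` {zr} \<subseteq> U" using \<delta>_U by auto
  then have fin_grp: "finite (carrier grp)" using fin finite_subset by auto
  obtain k and c :: "nat \<Rightarrow> 'a \<Rightarrow> int" where k: "k \<ge> 1"
    and add0: "\<forall>l<k. \<forall>x\<in>carrier grp. \<forall>y\<in>carrier grp.
      [c l (x \<otimes>\<^bsub>grp\<^esub> y) = c l x + c l y] (mod int q)"
    and surj: "\<forall>\<tau>. \<exists>x\<in>carrier grp. \<forall>l<k. [c l x = \<tau> l] (mod int q)"
    and endo: "\<forall>\<phi>\<in>hom grp grp. \<exists>\<Lambda>. \<forall>l<k. \<forall>x\<in>carrier grp.
        [c l (\<phi> x) = (\<Sum>i<k. \<Lambda> l i * c i x)] (mod int q)"
    using comm_group.q_coordinates[OF grp_comm_group fin_grp q ord] .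
  have add: "[c l (x \<otimes>\<^bsub>grp\<^esub> y) = c l x + c l y] (mod int q)"
    if "l < k" "x \<in> carrier grp" "y \<in> carrier grp" for l x y using add0 that by blast
  \<comment> \<open>Each class of \<delta> has its own base point, and the new coordinates of x are
    those of its difference from it. Inside a class the base point cancels.\<close>
  define rp where "rp x = (SOME y. y \<in> \<delta> `` {x})" for x
  have rp: "(x, rp x) \<in> \<delta>" if "x \<in> U" for x
    unfolding rp_def using someI[of "\<lambda>y. y \<in> \<delta> `` {x}" x] \<delta>_refl that by simp
  have rp_eq: "rp x = rp y" if "(x, y) \<in> \<delta>" for x y
  proof -
    have "\<delta> `` {x} = \<delta> `` {y}" using that \<delta>_sym \<delta>_trans by blast
    then show ?thesis by (simp add: rp_def)
  qed
  define \<chi>' where "\<chi>' n x = (if n < H then \<chi> n x else c (n - H) (dif x (rp x)))" for n x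
  define s' where "s' n = (if n < H then s n else H)" for n
  define \<delta>' where "\<delta>' = {(x, y). x \<in> U \<and> y \<in> U \<and> (\<forall>n<H + k. [\<chi>' n x = \<chi>' n y] (mod int q))}"
  have \<chi>_old: "\<chi>' n = \<chi> n" if "n < H" for n using that by (auto simp: \<chi>'_def)
  have \<chi>_new: "[\<chi>' (H + l) x - \<chi>' (H + l) y = c l (dif x y)] (mod int q)" if "l < k" "(x, y) \<in> \<delta>" for l x y
  proof -
    have yr: "(y, rp x) \<in> \<delta>" using rp[of y] rp_eq[OF that(2)] \<delta>_U that(2) by simp
    have "[c l (dif x (rp x)) = c l (dif x y) + c l (dif y (rp x))] (mod int q)"
      using add[OF that(1) dif_carrier[OF that(2)] dif_carrier[OF yr]] dif_add[OF that(2) yr] by simp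
    then show ?thesis using rp_eq[OF that(2)] by (simp add: \<chi>'_def cong_iff_dvd_diff algebra_simps)
  qed
  have s_le: "s' n \<le> n" if "n < H + k" for n using that coordsD(1)[OF co] by (auto simp: s'_def)
  have level_old: "level (H + k) s' n = level H s n" if "n < H" for n
    using that coordsD(1)[OF co that] by (auto simp: level_def s'_def)
  have level_new: "level (H + k) s' (H + l) = (+) H ` {..<k}" for l
  proof -
    have "c' \<in> (+) H ` {..<k}" if "c' < H + k" "\<not> c' < H" for c'
      using that by (intro image_eqI[of _ _ "c' - H"]) auto
    then show ?thesis using coordsD(1)[OF co] by (fastforce simp: level_def s'_def split: if_splits)
  qed
  have aff: "\<exists>\<Lambda>. affine_at q (H + k) \<chi>' s' f n \<Lambda>" if n: "n < H + k" for f n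
  proof (cases "n < H")
    case True
    obtain \<Lambda> where \<Lambda>: "affine_at q H \<chi> s f n \<Lambda>" using coordsD(4)[OF co True] by blast
    have "s n \<le> n" using coordsD(1)[OF co True] .
    then have "affine_at q (H + k) \<chi>' s' f n \<Lambda>"
      using \<Lambda> True unfolding affine_at_def level_old[OF True]
      by (auto simp: \<chi>_old s'_def level_def)
    then show ?thesis by blast
  next
    case False
    define l where "l = n - H"
    have l: "l < k" "n = H + l" using False n by (auto simp: l_def)
    have "\<exists>\<Lambda>. \<forall>l<k. \<forall>x\<in>carrier grp. [c l (lin f i x) = (\<Sum>i<k. \<Lambda> l i * c i x)] (mod int q)"
      if "i < ar f" for i using endo lin_hom[OF that] by blast
    then obtain \<Lambda> where \<Lambda>: "\<And>i x. i < ar f \<Longrightarrow> x \<in> carrier grp \<Longrightarrow>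
        [c l (lin f i x) = (\<Sum>i'<k. \<Lambda> i l i' * c i' x)] (mod int q)"
      using l(1) by metis
    have "affine_at q (H + k) \<chi>' s' f n (\<lambda>j c'. \<Lambda> j l (c' - H))"
      unfolding affine_at_def
    proof (intro allI impI; elim conjE)
      fix xs ys assume len: "length xs = ar f" "length ys = ar f" and sets: "set xs \<subseteq> U" "set ys \<subseteq> U"
        and agree: "\<forall>j<ar f. \<forall>c'<s' n. [\<chi>' c' (xs ! j) = \<chi>' c' (ys ! j)] (mod int q)"
      have xy: "(xs ! j, ys ! j) \<in> \<delta>" if "j < ar f" for j
        using that agree sets len l by (auto simp: coordsD(2)[OF co] s'_def \<chi>_old subset_iff)
      then have "list_all2 (\<lambda>x y. (x, y) \<in> \<delta>) xs ys" using len by (simp add: list_all2_conv_all_nth)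
      then have "(opn A f xs, opn A f ys) \<in> \<delta>" using \<delta> len by (simp add: ucong_def)
      then have "[\<chi>' n (opn A f xs) - \<chi>' n (opn A f ys) = c l (dif (opn A f xs) (opn A f ys))] (mod int q)"
        unfolding l(2) by (rule \<chi>_new[OF l(1)])
      also have "[c l (dif (opn A f xs) (opn A f ys)) =
          (\<Sum>j<ar f. c l (lin f j (dif (xs ! j) (ys ! j))))] (mod int q)"
        using add[OF l(1)] len xy by (rule additive_dif_opn)
      also have "[(\<Sum>j<ar f. c l (lin f j (dif (xs ! j) (ys ! j)))) =
          (\<Sum>j<ar f. \<Sum>i<k. \<Lambda> j l i * c i (dif (xs ! j) (ys ! j)))] (mod int q)"
        using \<Lambda> dif_carrier[OF xy] by (intro cong_sum) (simp del: grp_simps)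
      also have "[(\<Sum>j<ar f. \<Sum>i<k. \<Lambda> j l i * c i (dif (xs ! j) (ys ! j))) =
          (\<Sum>j<ar f. \<Sum>i<k. \<Lambda> j l i * (\<chi>' (H + i) (xs ! j) - \<chi>' (H + i) (ys ! j)))] (mod int q)"
        using \<chi>_new[OF _ xy] by (intro cong_sum cong_mult) (auto intro: cong_sym)
      also have "(\<Sum>j<ar f. \<Sum>i<k. \<Lambda> j l i * (\<chi>' (H + i) (xs ! j) - \<chi>' (H + i) (ys ! j))) =
          (\<Sum>j<ar f. \<Sum>c'\<in>level (H + k) s' n. \<Lambda> j l (c' - H) * (\<chi>' c' (xs ! j) - \<chi>' c' (ys ! j)))"
        unfolding l(2) level_new by (simp add: sum.reindex)
      finally show "[\<chi>' n (opn A f xs) - \<chi>' n (opn A f ys) =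
          (\<Sum>j<ar f. \<Sum>c'\<in>level (H + k) s' n. \<Lambda> j l (c' - H) * (\<chi>' c' (xs ! j) - \<chi>' c' (ys ! j)))] (mod int q)" .
    qed
    then show ?thesis by blast
  qed
  have sur: "\<exists>x\<in>U. \<forall>n<H + k. [\<chi>' n x = \<tau> n] (mod int q)" for \<tau>
  proof -
    \<comment> \<open>x0 has the right old coordinates; moving it inside its class of \<delta> by a
      suitable group element corrects the new ones.\<close>
    obtain x0 where x0: "x0 \<in> U" "\<And>n. n < H \<Longrightarrow> [\<chi> n x0 = \<tau> n] (mod int q)"
      using coordsD(3)[OF co] by blast
    obtain g where g: "g \<in> carrier grp" "\<And>l. l < k \<Longrightarrow> [c l g = \<tau> (H + l) - \<chi>' (H + l) x0] (mod int q)"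
      using surj[THEN spec, of "\<lambda>l. \<tau> (H + l) - \<chi>' (H + l) x0"] by blast
    obtain x where x: "(x, x0) \<in> \<delta>" "dif x x0 = g" using dif_surj[OF g(1) x0(1)] by blast
    have "[\<chi>' n x = \<tau> n] (mod int q)" if "n < H + k" for n
    proof (cases "n < H")
      case True
      then have "[\<chi> n x = \<chi> n x0] (mod int q)" using x(1) coordsD(2)[OF co] by blast
      then show ?thesis using x0(2)[OF True] \<chi>_old[OF True] cong_trans by metis
    next
      case False
      define l where "l = n - H"
      have l: "n = H + l" "l < k" using False that by (auto simp: l_def)
      have "[\<chi>' n x - \<chi>' n x0 = \<tau> n - \<chi>' n x0] (mod int q)"
        using cong_trans[OF \<chi>_new[OF l(2) x(1)]] g(2)[OF l(2)] x(2) l(1) by simp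
      then show ?thesis by (simp add: cong_iff_dvd_diff)
    qed
    then show ?thesis using x(1) \<delta>_U by blast
  qed
  have "coords q (H + k) \<chi>' s' \<delta>'"
    unfolding coords_def using s_le aff sur \<delta>'_def by blast
  moreover have "\<delta>' \<subset> \<delta>"
  proof
    show "\<delta>' \<subseteq> \<delta>"
    proof
      fix z assume z: "z \<in> \<delta>'"
      obtain x y where xy: "z = (x, y)" by (cases z)
      have "[\<chi> n x = \<chi> n y] (mod int q)" if "n < H" for n
        using z that \<chi>_old[OF that] unfolding xy \<delta>'_def by (auto dest: spec[of _ n])
      then show "z \<in> \<delta>" using z unfolding xy coordsD(2)[OF co] by (simp add: \<delta>'_def)
    qed
    obtain g where g: "g \<in> carrier grp" "\<forall>l<k. [c l g = 1] (mod int q)" using surj[THEN spec, of "\<lambda>_. 1"] by blast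
    obtain x where x: "(x, zr) \<in> \<delta>" "dif x zr = g" using dif_surj[OF g(1) zr] by blast
    have "[\<chi>' H x - \<chi>' H zr = 1] (mod int q)"
      using \<chi>_new[of 0, OF _ x(1)] k g(2) x(2) cong_trans by fastforce
    moreover have "\<not> [(0 :: int) = 1] (mod int q)"
      using q prime_gt_1_nat[OF q] by (simp add: cong_iff_dvd_diff)
    ultimately have "\<not> [\<chi>' H x = \<chi>' H zr] (mod int q)"
      by (metis cong_diff_iff_cong_0 cong_sym cong_trans)
    then have "(x, zr) \<notin> \<delta>'" using k by (auto simp: \<delta>'_def intro!: exI[of _ H])
    then show "\<delta>' \<noteq> \<delta>" using x(1) by blast
  qed
  ultimately show thesis by (rule that)
qed

end

section \<open>Equal class sizes and the number of coordinates\<close>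

context ualgebra begin

text \<open>The map z to p z x y sends the class of x into that of y. If two images agree,
  centrality lets y be replaced by x, which gives z back; so the two arguments agree modulo ever
  lower terms of the series, and the map is injective.\<close>

lemma card_classes_eq:
  assumes day: "day_chain M n" and sn: "k_supernilpotent ar A k" and fin: "finite U"
    and p: "pol3 p" "\<And>x y. x \<in> U \<Longrightarrow> y \<in> U \<Longrightarrow> p x x y = y \<and> p x y y = x"
    and \<theta>: "ucong ar A \<theta>" and xy: "x \<in> U" "y \<in> U"
  shows "card (\<theta> `` {x}) = card (\<theta> `` {y})"
proof -
  have le: "card (\<theta> `` {x}) \<le> card (\<theta> `` {y})" if xy: "x \<in> U" "y \<in> U" for x y
  proof (rule card_inj_on_le[of "\<lambda>z. p z x y"])
    have "\<theta> `` {y} \<subseteq> U" using ucong_subset[OF \<theta>] by auto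
    then show "finite (\<theta> `` {y})" using fin finite_subset by blast
    show "(\<lambda>z. p z x y) ` (\<theta> `` {x}) \<subseteq> \<theta> `` {y}"
    proof clarify
      fix z assume "(x, z) \<in> \<theta>"
      then have "(p x x y, p z x y) \<in> \<theta>"
        using ucong_refl[OF \<theta>] xy by (intro pol3_cong[OF \<theta> p(1)]) auto
      then show "(y, p z x y) \<in> \<theta>" using p(2) xy by simp
    qed
    show "inj_on (\<lambda>z. p z x y) (\<theta> `` {x})"
    proof (rule inj_onI)
      fix z z' assume z: "z \<in> \<theta> `` {x}" "z' \<in> \<theta> `` {x}" and eq: "p z x y = p z' x y"
      have zU: "z \<in> U" "z' \<in> U" using z ucong_subset[OF \<theta>] by auto
      let ?t = "\<lambda>s w. p w x (s (0 :: nat))"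
      have t: "pol ?t" by (intro pol3_app[OF p(1)] pol.intros xy)
      have "(z, z') \<in> upper_central (k - j)" if "j \<le> k" for j
        using that
      proof (induction j)
        case 0
        then show ?case using upper_central_full[OF sn] zU by simp
      next
        case (Suc j)
        then have kj: "k - j = Suc (k - Suc j)" by simp
        have "(?t (\<lambda>_. y) z, ?t (\<lambda>_. y) z') \<in> upper_central (k - Suc j)"
          using eq pol3_closed[OF p(1)] zU xy ucong_refl[OF ucong_upper_central] by simp
        moreover have "(z, z') \<in> upper_central (Suc (k - Suc j))" using Suc kj by simp
        ultimately have "(?t (\<lambda>_. x) z, ?t (\<lambda>_. x) z') \<in> upper_central (k - Suc j)"
          using central_upper_central[OF day, unfolded central_def, rule_format,
              of ?t "\<lambda>_. y" "\<lambda>_. x" z z' "k - Suc j"] t xy by auto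
        then show ?case using p(2) xy zU by simp
      qed
      from this[of k] show "z = z'" by auto
    qed
  qed
  show ?thesis using le[OF xy] le[OF xy(2,1)] by simp
qed

lemma card_eq_classes_times:
  assumes "finite S" and eq: "\<And>x. x \<in> S \<Longrightarrow> x \<in> \<epsilon> `` {x}" "\<And>x. x \<in> S \<Longrightarrow> \<epsilon> `` {x} \<subseteq> S"
    "\<And>x y. (x, y) \<in> \<epsilon> \<Longrightarrow> \<epsilon> `` {x} = \<epsilon> `` {y}"
    and m: "\<And>x. x \<in> S \<Longrightarrow> card (\<epsilon> `` {x}) = m"
  shows "card S = m * card ((\<lambda>x. \<epsilon> `` {x}) ` S)"
proof -
  have U: "\<Union> ((\<lambda>x. \<epsilon> `` {x}) ` S) = S" using eq by blast
  have "m * card ((\<lambda>x. \<epsilon> `` {x}) ` S) = card (\<Union> ((\<lambda>x. \<epsilon> `` {x}) ` S))"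
  proof (rule card_partition)
    show "finite ((\<lambda>x. \<epsilon> `` {x}) ` S)" "finite (\<Union> ((\<lambda>x. \<epsilon> `` {x}) ` S))" using assms(1) U by auto
    show "\<And>c. c \<in> (\<lambda>x. \<epsilon> `` {x}) ` S \<Longrightarrow> card c = m" using m by auto
    fix c1 c2 assume c: "c1 \<in> (\<lambda>x. \<epsilon> `` {x}) ` S" "c2 \<in> (\<lambda>x. \<epsilon> `` {x}) ` S" "c1 \<noteq> c2"
    then obtain x y where xy: "c1 = \<epsilon> `` {x}" "c2 = \<epsilon> `` {y}" by blast
    show "c1 \<inter> c2 = {}"
    proof (rule ccontr)
      assume "c1 \<inter> c2 \<noteq> {}"
      then obtain z where "(x, z) \<in> \<epsilon>" "(y, z) \<in> \<epsilon>" using xy by blast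
      then show False using eq(3) xy c(3) by metis
    qed
  qed
  then show ?thesis using U by simp
qed

text \<open>The congruence \<delta> shrinks from the full relation to the identity. Each step needs
  a central factor at the top of \<delta> whose group has order q^e with e at least 1.\<close>

theorem coords_exist:
  assumes cm: "in_cm_variety ar A" and sn: "k_supernilpotent ar A k"
    and fin: "finite U" and q: "prime q" and card: "card U = q ^ h"
  obtains H \<chi> s where "coords q H \<chi> s (Id_on U)" "H \<le> h"
proof -
  obtain M n where day: "day_chain M n" using day_chain_exists[OF cm] .
  obtain p where p: "pol3 p" "\<And>x y. x \<in> U \<Longrightarrow> y \<in> U \<Longrightarrow> p x x y = y \<and> p x y y = x"
    using maltsev_polynomial[OF day sn] by blast
  obtain zr where zr: "zr \<in> U" using ualg by (auto simp: is_ualg_def)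
  have finU: "finite \<theta>" if "ucong ar A \<theta>" for \<theta>
  proof -
    have "\<theta> \<subseteq> U \<times> U" using ucong_subset[OF that] by auto
    then show ?thesis using fin finite_subset by blast
  qed
  have "\<exists>H' \<chi>' s'. coords q H' \<chi>' s' (Id_on U)" if "coords q H \<chi> s \<delta>" for H \<chi> s \<delta>
    using that
  proof (induction "card \<delta>" arbitrary: H \<chi> s \<delta> rule: less_induct)
    case less
    note co = less.prems
    note \<delta> = ucong_coords[OF co]
    show ?case
    proof (cases "\<delta> = Id_on U")
      case False
      have notId: "\<not> \<delta> \<subseteq> Id_on U" using False ucong_refl[OF \<delta>] by auto
      have ex: "\<delta> \<subseteq> upper_central k" using upper_central_full[OF sn] ucong_subset[OF \<delta>] by auto
      define i where "i = (LEAST i. \<delta> \<subseteq> upper_central i)"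
      have i: "\<delta> \<subseteq> upper_central i" unfolding i_def using ex by (rule LeastI)
      have "i \<noteq> 0" using i notId by (metis upper_central.simps(1))
      then obtain j where j: "i = Suc j" using not0_implies_Suc by blast
      have nj: "\<not> \<delta> \<subseteq> upper_central j" using not_less_Least[of j "\<lambda>i. \<delta> \<subseteq> upper_central i"] j i_def by auto
      \<comment> \<open>As \<delta> lies below \<open>upper_central (Suc j)\<close> but not below
        \<open>upper_central j\<close>, it is central over its meet with the latter, and the meet is
        strictly smaller.\<close>
      define \<epsilon> where "\<epsilon> = \<delta> \<inter> upper_central j"
      have \<epsilon>: "ucong ar A \<epsilon>" unfolding \<epsilon>_def using ucong_inter[OF \<delta> ucong_upper_central] .
      have "central \<delta> \<epsilon>"
        unfolding central_def
      proof (intro allI impI conjI; elim conjE)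
        fix t u v and a b :: "nat \<Rightarrow> 'a"
        assume *: "pol t" "range a \<subseteq> U" "range b \<subseteq> U" "(u, v) \<in> \<delta>"
        have uv: "(u, v) \<in> upper_central (Suc j)" using *(4) i j by blast
        note c = central_upper_central[OF day, unfolded central_def, rule_format, of t a b u v j]
        have d: "(t a u, t a v) \<in> \<delta>" "(t b u, t b v) \<in> \<delta>"
          using *(2,3) by (intro pol_cong[OF \<delta> *(1) _ *(4)] ucong_refl[OF \<delta>]; auto)+
        show "(t a v, t b v) \<in> \<epsilon>" if "(t a u, t b u) \<in> \<epsilon>"
        proof -
          have "(t a v, t b v) \<in> upper_central j" using c that * uv unfolding \<epsilon>_def by blast
          moreover have "(t a v, t b u) \<in> \<delta>"
            using that ucong_trans[OF \<delta> ucong_sym[OF \<delta> d(1)]] unfolding \<epsilon>_def by blast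
          ultimately show ?thesis using ucong_trans[OF \<delta> _ d(2)] unfolding \<epsilon>_def by blast
        qed
        show "(t b u, t b v) \<in> \<epsilon>" if "(t a u, t a v) \<in> \<epsilon>"
          using c that * uv d unfolding \<epsilon>_def by blast
      qed
      then interpret central_pair ar A p zr \<delta> \<epsilon>
        using p zr \<delta> \<epsilon> by unfold_locales (auto simp: \<epsilon>_def)
      have part: "card S = card (\<theta> `` {zr}) * card ((\<lambda>x. \<theta> `` {x}) ` S)"
        if "ucong ar A \<theta>" "S \<subseteq> U" "\<And>x. x \<in> S \<Longrightarrow> \<theta> `` {x} \<subseteq> S" for \<theta> S
      proof (rule card_eq_classes_times)
        show "finite S" using that(2) fin finite_subset by blast
        show "x \<in> \<theta> `` {x}" if "x \<in> S" for x
          using ucong_refl[OF \<open>ucong ar A \<theta>\<close>] that \<open>S \<subseteq> U\<close> by auto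
        show "\<theta> `` {x} \<subseteq> S" if "x \<in> S" for x using \<open>\<And>x. x \<in> S \<Longrightarrow> \<theta> `` {x} \<subseteq> S\<close> that .
        show "\<theta> `` {x} = \<theta> `` {y}" if "(x, y) \<in> \<theta>" for x y
          using ucong_sym[OF \<open>ucong ar A \<theta>\<close>] ucong_trans[OF \<open>ucong ar A \<theta>\<close>] that by blast
        show "card (\<theta> `` {x}) = card (\<theta> `` {zr})" if "x \<in> S" for x
          using card_classes_eq[OF day sn fin p \<open>ucong ar A \<theta>\<close> _ zr] that \<open>S \<subseteq> U\<close> by blast
      qed
      \<comment> \<open>By equal class sizes, the order of the group divides the size of a class of
        \<delta>, which divides the order of A.\<close>
      have "card U = card (\<delta> `` {zr}) * card ((\<lambda>x. \<delta> `` {x}) ` U)"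
        using ucong_subset[OF \<delta>] by (intro part[OF \<delta>]) auto
      moreover have "card (\<delta> `` {zr}) = card (\<epsilon> `` {zr}) * card ((\<lambda>x. \<epsilon> `` {x}) ` (\<delta> `` {zr}))"
        using ucong_subset[OF \<delta>] \<epsilon>_le ucong_trans[OF \<delta>] by (intro part[OF \<epsilon>]) blast+
      moreover have "card ((\<lambda>x. \<epsilon> `` {x}) ` (\<delta> `` {zr})) = order grp"
      proof -
        have "inj_on (\<lambda>x. \<epsilon> `` {x}) (carrier grp)"
        proof (rule inj_onI)
          fix x y assume x: "x \<in> carrier grp" and y: "y \<in> carrier grp" and "\<epsilon> `` {x} = \<epsilon> `` {y}"
          then have "(x, y) \<in> \<epsilon>" using \<epsilon>_refl carrierD[OF y] by blast
          then show "x = y" using nrm_eq carrierD[OF x] carrierD[OF y] by metis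
        qed
        moreover have "(\<lambda>x. \<epsilon> `` {x}) ` carrier grp = (\<lambda>x. \<epsilon> `` {x}) ` (\<delta> `` {zr})"
        proof -
          have "\<epsilon> `` {nrm x} = \<epsilon> `` {x}" if "x \<in> \<delta> `` {zr}" for x
            using nrm[of x] \<delta>_U that \<epsilon>_sym \<epsilon>_trans by blast
          then show ?thesis by (auto simp: image_image)
        qed
        ultimately show ?thesis unfolding order_def by (metis card_image)
      qed
      ultimately have "order grp dvd q ^ h" using card by (metis dvd_mult dvd_mult2 dvd_refl)
      then obtain e where e: "order grp = q ^ e" using divides_primepow_nat[OF q] by blast
      have "e \<noteq> 0"
      proof
        assume "e = 0"
        then have "card (carrier grp) = 1" using e by (simp add: order_def)
        then obtain g where g: "carrier grp = {g}" by (meson card_1_singletonE)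
        obtain x y where xy: "(x, y) \<in> \<delta>" "(x, y) \<notin> \<epsilon>" using nj unfolding \<epsilon>_def by auto
        have "\<one>\<^bsub>grp\<^esub> \<in> carrier grp" using \<delta>_refl by auto
        then have "dif x y = \<one>\<^bsub>grp\<^esub>" using dif_carrier[OF xy(1)] g by (metis singletonD)
        then show False using dif_one_iff[OF xy(1)] xy(2) by blast
      qed
      then have "e \<ge> 1" by simp
      from coords_refine[OF co fin q e this]
      obtain H' \<chi>' s' \<delta>' where new: "coords q H' \<chi>' s' \<delta>'" "\<delta>' \<subset> \<delta>" .
      have "card \<delta>' < card \<delta>" using new(2) finU[OF \<delta>] by (rule psubset_card_mono[rotated])
      then show ?thesis using less.hyps new(1) by blast
    qed (use co in blast)
  qed
  moreover have "coords q 0 (\<lambda>_ _. 0) (\<lambda>_. 0) (U \<times> U)" using zr by (auto simp: coords_def)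
  ultimately obtain H \<chi> s where co: "coords q H \<chi> s (Id_on U)" by blast
  \<comment> \<open>Every choice of residues modulo q is attained by an element, and different
    choices by different elements.\<close>
  have "q ^ H \<le> card U"
  proof -
    let ?P = "PiE {..<H} (\<lambda>_. {0..<int q})"
    have "\<forall>\<tau>. \<exists>x. x \<in> U \<and> (\<forall>c<H. [\<chi> c x = \<tau> c] (mod int q))" using coordsD(3)[OF co] by blast
    from choice[OF this] obtain g where g0: "\<forall>\<tau>. g \<tau> \<in> U \<and> (\<forall>c<H. [\<chi> c (g \<tau>) = \<tau> c] (mod int q))" ..
    then have g: "g \<tau> \<in> U" "c < H \<Longrightarrow> [\<chi> c (g \<tau>) = \<tau> c] (mod int q)" for \<tau> c by simp_all
    have "inj_on g ?P"
    proof (rule inj_onI)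
      fix \<tau> \<tau>' assume \<tau>: "\<tau> \<in> ?P" "\<tau>' \<in> ?P" and eq: "g \<tau> = g \<tau>'"
      show "\<tau> = \<tau>'"
      proof (rule PiE_ext[OF \<tau>])
        fix c assume c: "c \<in> {..<H}"
        then have "[\<tau> c = \<tau>' c] (mod int q)" using g(2)[of c \<tau>] g(2)[of c \<tau>'] eq by (metis cong_sym cong_trans lessThan_iff)
        moreover have "\<tau> c \<in> {0..<int q}" "\<tau>' c \<in> {0..<int q}"
          using PiE_mem[OF \<tau>(1) c] PiE_mem[OF \<tau>(2) c] by auto
        ultimately show "\<tau> c = \<tau>' c" by (simp add: cong_def)
      qed
    qed
    then have "card ?P \<le> card U" using g(1) fin by (intro card_inj_on_le[of g]) auto
    then show ?thesis by (simp add: card_PiE)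
  qed
  then have "H \<le> h" using card prime_gt_1_nat[OF q] by simp
  then show thesis using that co by blast
qed

end

section \<open>Sums of juntas and hitting sets\<close>

text \<open>
  \<open>junta A n q D f\<close>: on \<open>n\<close>-tuples over \<open>A\<close> and modulo \<open>q\<close>, the function \<open>f\<close> is a sum of functions
  each depending on at most \<open>D\<close> entries of the tuple. This plays the role of the degree of a polynomial.
\<close>

inductive junta :: "('f, 'a) ualg \<Rightarrow> nat \<Rightarrow> nat \<Rightarrow> nat \<Rightarrow> ('a list \<Rightarrow> int) \<Rightarrow> bool" for A n q D where
  base: "finite I \<Longrightarrow> card I \<le> D \<Longrightarrow>
    \<forall>xs\<in>valuations A n. \<forall>ys\<in>valuations A n. (\<forall>i\<in>I. xs ! i = ys ! i) \<longrightarrow> f xs = f ys \<Longrightarrow> junta A n q D f"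
| add: "junta A n q D f \<Longrightarrow> junta A n q D g \<Longrightarrow> junta A n q D (\<lambda>xs. f xs + g xs)"
| cong: "junta A n q D f \<Longrightarrow> \<forall>xs\<in>valuations A n. [f xs = g xs] (mod int q) \<Longrightarrow> junta A n q D g"

lemma junta_const: "junta A n q D (\<lambda>xs. c)"
  by (rule junta.base[of "{}"]) auto

lemma junta_mono: "junta A n q D f \<Longrightarrow> D \<le> D' \<Longrightarrow> junta A n q D' f"
proof (induction rule: junta.induct)
  case (base I f)
  show ?case by (rule junta.base[OF base(1) order_trans[OF base(2) base.prems] base(3)])
next
  case (add f g)
  then show ?case by (simp add: junta.add)
next
  case (cong f g)
  show ?case by (rule junta.cong[OF cong.IH[OF cong.prems] cong.hyps(2)])
qed

lemma junta_mult:
  assumes f: "junta A n q D f" and g: "junta A n q E g"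
  shows "junta A n q (D + E) (\<lambda>xs. f xs * g xs)"
  using f
proof (induction rule: junta.induct)
  case (base I f)
  note f = base
  show ?case
    using g
  proof (induction rule: junta.induct)
    case (base J g)
    show ?case
    proof (rule junta.base[of "I \<union> J"])
      show "finite (I \<union> J)" using f base by simp
      show "card (I \<union> J) \<le> D + E" using card_Un_le[of I J] f(2) base(2) by linarith
      show "\<forall>xs\<in>valuations A n. \<forall>ys\<in>valuations A n.
          (\<forall>i\<in>I \<union> J. xs ! i = ys ! i) \<longrightarrow> f xs * g xs = f ys * g ys"
      proof (intro ballI impI)
        fix xs ys assume xy: "xs \<in> valuations A n" "ys \<in> valuations A n" "\<forall>i\<in>I \<union> J. xs ! i = ys ! i"
        then have "f xs = f ys" "g xs = g ys" using f(3) base(3) by blast+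
        then show "f xs * g xs = f ys * g ys" by simp
      qed
    qed
  next
    case (add g1 g2)
    then show ?case using junta.add[of A n q "D + E"] by (simp add: distrib_left)
  next
    case (cong g1 g2)
    show ?case by (rule junta.cong[OF cong.IH]) (use cong.hyps in \<open>auto intro: cong_scalar_left\<close>)
  qed
next
  case (add f1 f2)
  then show ?case using junta.add[of A n q "D + E"] by (simp add: distrib_right)
next
  case (cong f1 f2)
  show ?case by (rule junta.cong[OF cong.IH]) (use cong.hyps in \<open>auto intro: cong_scalar_right\<close>)
qed

lemma junta_cmult: "junta A n q D f \<Longrightarrow> junta A n q D (\<lambda>xs. c * f xs)"
  using junta_mult[OF junta_const[where D = 0]] by fastforce

lemma junta_diff: "junta A n q D f \<Longrightarrow> junta A n q D g \<Longrightarrow> junta A n q D (\<lambda>xs. f xs - g xs)"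
  using junta.add[OF _ junta_cmult[where c = "-1"], of A n q D f g] by simp

lemma junta_sum:
  assumes "\<And>i. i \<in> S \<Longrightarrow> junta A n q D (f i)"
  shows "junta A n q D (\<lambda>xs. \<Sum>i\<in>S. f i xs)"
  using assms
proof (induction S rule: infinite_finite_induct)
  case (insert x F)
  then show ?case by (simp add: junta.add)
qed (simp_all add: junta_const)

lemma junta_power: "junta A n q D f \<Longrightarrow> junta A n q (k * D) (\<lambda>xs. f xs ^ k)"
  by (induction k) (auto simp: junta_const intro: junta_mult)

lemma fermat_int:
  assumes q: "prime q" and x: "\<not> int q dvd x"
  shows "[x ^ (q - 1) = 1] (mod int q)"
proof -
  define a where "a = nat (x mod int q)"
  have q0: "q > 0" using q prime_gt_0_nat by blast
  then have a: "int a = x mod int q" by (simp add: a_def)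
  have "\<not> q dvd a" using x a by (metis dvd_mod_iff dvd_refl int_dvd_int_iff)
  then have "[a ^ (q - 1) = 1] (mod q)" by (rule fermat_theorem[OF q])
  then have "[int a ^ (q - 1) = 1] (mod int q)" by (metis cong_int_iff of_nat_1 of_nat_power)
  moreover have "[x ^ (q - 1) = int a ^ (q - 1)] (mod int q)"
    unfolding a by (intro cong_pow) (simp add: cong_def)
  ultimately show ?thesis using cong_trans by blast
qed

text \<open>Interpolation over the field with \<open>q\<close> elements.\<close>

lemma junta_compose:
  assumes q: "prime q" and "finite L" and "\<And>l. l \<in> L \<Longrightarrow> junta A n q (D l) (f l)"
    and "\<And>xs ys. xs \<in> valuations A n \<Longrightarrow> ys \<in> valuations A n \<Longrightarrow>
      (\<forall>l\<in>L. [f l xs = f l ys] (mod int q)) \<Longrightarrow> [F xs = F ys] (mod int q)"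
  shows "junta A n q ((q - 1) * (\<Sum>l\<in>L. D l)) F"
  using assms(2-)
proof (induction L arbitrary: F rule: finite_induct)
  case empty
  show ?case
  proof (cases "valuations A n = {}")
    case True
    then show ?thesis by (intro junta.base[of "{}"]) auto
  next
    case False
    then obtain x0 where "x0 \<in> valuations A n" by blast
    then show ?thesis using empty.prems(2) by (intro junta.cong[OF junta_const[of A n q _ "F x0"]]) auto
  qed
next
  case (insert l L)
  let ?V = "valuations A n"
  define P where "P c xs ys \<longleftrightarrow> ys \<in> ?V \<and> [f l ys = c] (mod int q) \<and> (\<forall>l'\<in>L. [f l' ys = f l' xs] (mod int q))"
    for c xs ys
  \<comment> \<open>G c continues F from the tuples with f l = c to all tuples, as a function of the
    remaining f l' only; 0 is the default where no tuple has these values together with f l =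
    c.\<close>
  define G where "G c xs = (if \<exists>ys. P c xs ys then F (SOME ys. P c xs ys) else 0)" for c xs
  have G: "junta A n q ((q - 1) * (\<Sum>l\<in>L. D l)) (G c)" for c
  proof (rule insert.IH)
    show "junta A n q (D l') (f l')" if "l' \<in> L" for l' using insert.prems(1) that by blast
    fix xs ys assume "\<forall>l'\<in>L. [f l' xs = f l' ys] (mod int q)"
    then have "P c xs = P c ys" unfolding P_def fun_eq_iff using cong_trans cong_sym by blast
    then show "[G c xs = G c ys] (mod int q)" by (simp add: G_def)
  qed
  have fl: "junta A n q (D l) (f l)" using insert.prems(1) by blast
  \<comment> \<open>By Fermat's theorem the second factor is 1 if f l xs is c modulo q and 0
    otherwise. Its exponent is the source of the factor q - 1 in the bound.\<close>
  let ?S = "\<lambda>xs. \<Sum>c\<in>{0..<int q}. G c xs * (1 - (f l xs - c) ^ (q - 1))"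
  have "junta A n q ((q - 1) * (\<Sum>l\<in>L. D l) + (q - 1) * D l) ?S"
    by (intro junta_sum junta_mult[OF G] junta_diff[OF junta_const] junta_power junta_diff[OF fl junta_const])
  moreover have "[?S xs = F xs] (mod int q)" if xs: "xs \<in> ?V" for xs
  proof -
    have q1: "q > 1" using prime_gt_1_nat[OF q] .
    define d where "d = f l xs mod int q"
    have d: "d \<in> {0..<int q}" "[f l xs = d] (mod int q)" using q1 by (auto simp: d_def cong_def)
    have other: "[G c xs * (1 - (f l xs - c) ^ (q - 1)) = 0] (mod int q)" if "c \<in> {0..<int q} - {d}" for c
    proof -
      have "\<not> int q dvd f l xs - c"
        using that d by (auto simp: d_def cong_def simp flip: cong_iff_dvd_diff)
      then have "[(f l xs - c) ^ (q - 1) = 1] (mod int q)" by (rule fermat_int[OF q])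
      then have "[G c xs * (1 - (f l xs - c) ^ (q - 1)) = G c xs * (1 - 1)] (mod int q)"
        by (intro cong_mult cong_diff cong_refl)
      then show ?thesis by simp
    qed
    have Pd: "P d xs xs" using xs d by (simp add: P_def)
    then have "P d xs (SOME ys. P d xs ys)" by (rule someI)
    then have w: "(SOME ys. P d xs ys) \<in> ?V" "\<forall>l'\<in>insert l L. [f l' (SOME ys. P d xs ys) = f l' xs] (mod int q)"
      unfolding P_def using d(2) cong_trans cong_sym by blast+
    have "[G d xs = F xs] (mod int q)"
      using insert.prems(2)[OF w(1) xs w(2)] Pd by (auto simp: G_def)
    moreover have "[1 - (f l xs - d) ^ (q - 1) = 1 - 0 ^ (q - 1)] (mod int q)"
      using d(2) by (intro cong_diff cong_pow cong_refl) (simp add: cong_diff_iff_cong_0)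
    ultimately have main: "[G d xs * (1 - (f l xs - d) ^ (q - 1)) = F xs * (1 - 0 ^ (q - 1))] (mod int q)"
      by (rule cong_mult)
    have "?S xs = G d xs * (1 - (f l xs - d) ^ (q - 1)) +
        (\<Sum>c\<in>{0..<int q} - {d}. G c xs * (1 - (f l xs - c) ^ (q - 1)))"
      using d(1) by (simp add: sum.remove)
    also have "[\<dots> = F xs * (1 - 0 ^ (q - 1)) + (\<Sum>c\<in>{0..<int q} - {d}. 0)] (mod int q)"
      using main other by (intro cong_add cong_sum)
    also have "F xs * (1 - 0 ^ (q - 1)) + (\<Sum>c\<in>{0..<int q} - {d}. 0) = F xs"
      using q1 by (simp add: power_0_left)
    finally show ?thesis .
  qed
  ultimately have "junta A n q ((q - 1) * (\<Sum>l\<in>L. D l) + (q - 1) * D l) F"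
    using junta.cong by blast
  then show ?case using insert.hyps by (simp add: algebra_simps)
qed

section \<open>Inclusion-exclusion and hitting sets\<close>

definition restrict_tuple :: "'a \<Rightarrow> nat \<Rightarrow> nat set \<Rightarrow> 'a list \<Rightarrow> 'a list" where
  "restrict_tuple z n W xs = map (\<lambda>i. if i \<in> W then xs ! i else z) [0..<n]"

lemma restrict_tuple_valuations:
  "z \<in> uni A \<Longrightarrow> xs \<in> valuations A n \<Longrightarrow> restrict_tuple z n W xs \<in> valuations A n"
  by (auto simp: restrict_tuple_def valuations_def)

text \<open>A function of at most D entries ignores some position i of T, so the terms for W and
  \<open>insert i W\<close> cancel.\<close>

lemma junta_alternating_sum:
  assumes "junta A n q D f" and T: "T \<subseteq> {..<n}" "card T > D" and xs: "xs \<in> valuations A n" and z: "z \<in> uni A"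
  shows "[(\<Sum>W\<in>Pow T. (-1) ^ card W * f (restrict_tuple z n W xs)) = 0] (mod int q)"
  using assms(1)
proof (induction rule: junta.induct)
  case (base I f)
  have finT: "finite T" using T(1) finite_subset by blast
  have "\<not> T \<subseteq> I" using base(1,2) T(2) card_mono[of I T] by auto
  then obtain i where i: "i \<in> T" "i \<notin> I" by blast
  let ?g = "\<lambda>W. (-1) ^ card W * f (restrict_tuple z n W xs)"
  have T_eq: "T = insert i (T - {i})" using i by blast
  have pow: "Pow T = Pow (T - {i}) \<union> insert i ` Pow (T - {i})" by (subst T_eq) (rule Pow_insert)
  have inj: "inj_on (insert i) (Pow (T - {i}))" by (rule inj_onI) blast
  have "sum ?g (Pow T) = sum ?g (Pow (T - {i})) + sum ?g (insert i ` Pow (T - {i}))"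
    unfolding pow using finT by (intro sum.union_disjoint) auto
  also have "sum ?g (insert i ` Pow (T - {i})) = (\<Sum>W\<in>Pow (T - {i}). ?g (insert i W))"
    using inj by (simp add: sum.reindex)
  also have "\<dots> = (\<Sum>W\<in>Pow (T - {i}). - ?g W)"
  proof (rule sum.cong)
    fix W assume W: "W \<in> Pow (T - {i})"
    have "finite W" using W finT finite_subset by blast
    then have "card (insert i W) = Suc (card W)" using W by (intro card_insert_disjoint) auto
    moreover have "f (restrict_tuple z n (insert i W) xs) = f (restrict_tuple z n W xs)"
    proof -
      have "restrict_tuple z n (insert i W) xs ! j = restrict_tuple z n W xs ! j" if "j \<in> I" for j
      proof (cases "j < n")
        case True
        then show ?thesis using that i by (auto simp: restrict_tuple_def)
      next
        case False
        \<comment> \<open>The set I may contain positions beyond the end of the tuple. There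
          \<open>nth\<close> is unspecified, but the same for all lists of length n.\<close>
        have "restrict_tuple z n W' xs ! j = [] ! (j - n)" for W'
          using False nth_append[of "restrict_tuple z n W' xs" "[]" j] by (simp add: restrict_tuple_def)
        then show ?thesis by metis
      qed
      then show ?thesis using base(3) restrict_tuple_valuations[OF z xs] by blast
    qed
    ultimately show "?g (insert i W) = - ?g W" by simp
  qed simp
  also have "sum ?g (Pow (T - {i})) + (\<Sum>W\<in>Pow (T - {i}). - ?g W) = 0" by (simp add: sum_negf)
  finally show ?case by simp
next
  case (add f g)
  then have "[(\<Sum>W\<in>Pow T. (-1) ^ card W * f (restrict_tuple z n W xs)) +
      (\<Sum>W\<in>Pow T. (-1) ^ card W * g (restrict_tuple z n W xs)) = 0 + 0] (mod int q)"
    by (intro cong_add)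
  then show ?case by (simp add: distrib_left sum.distrib)
next
  case (cong f g)
  have "[(\<Sum>W\<in>Pow T. (-1) ^ card W * g (restrict_tuple z n W xs)) =
      (\<Sum>W\<in>Pow T. (-1) ^ card W * f (restrict_tuple z n W xs))] (mod int q)"
    using cong.hyps(2) restrict_tuple_valuations[OF z xs]
    by (intro cong_sum cong_scalar_left) (use cong_sym in blast)
  then show ?case using cong.IH cong_trans by blast
qed

text \<open>Otherwise f vanishes at all restrictions to at most D positions. The alternating sum
  over the subsets of a larger W expresses the value at W through those at smaller sets, so by
  induction f vanishes at every W, also at the full set, where the restriction is xs.\<close>

lemma junta_hitting:
  assumes f: "junta A n q D f" and xs: "xs \<in> valuations A n" and z: "z \<in> uni A"
    and nz: "\<not> [f xs = 0] (mod int q)"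
  shows "\<exists>W\<subseteq>{..<n}. card W \<le> D \<and> \<not> [f (restrict_tuple z n W xs) = 0] (mod int q)"
proof (rule ccontr)
  assume contra: "\<not> ?thesis"
  have "[f (restrict_tuple z n W xs) = 0] (mod int q)" if "W \<subseteq> {..<n}" for W
    using that
  proof (induction "card W" arbitrary: W rule: less_induct)
    case less
    show ?case
    proof (cases "card W \<le> D")
      case True
      then show ?thesis using contra less.prems by blast
    next
      case False
      let ?g = "\<lambda>W. (-1) ^ card W * f (restrict_tuple z n W xs)"
      have finW: "finite W" using less.prems finite_subset by blast
      have "[(\<Sum>V\<in>Pow W. ?g V) = 0] (mod int q)"
        using junta_alternating_sum[OF f less.prems _ xs z] False by simp
      moreover have "(\<Sum>V\<in>Pow W. ?g V) = ?g W + (\<Sum>V\<in>Pow W - {W}. ?g V)"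
        using finW by (intro sum.remove) auto
      moreover have "[(\<Sum>V\<in>Pow W - {W}. ?g V) = (\<Sum>V\<in>Pow W - {W}. 0)] (mod int q)"
      proof (rule cong_sum)
        fix V assume V: "V \<in> Pow W - {W}"
        then have "card V < card W" using finW by (intro psubset_card_mono) auto
        then have "[f (restrict_tuple z n V xs) = 0] (mod int q)" using less V by blast
        then show "[?g V = 0] (mod int q)" using cong_scalar_left by fastforce
      qed
      ultimately have "[?g W = 0] (mod int q)"
        unfolding cong_0_iff sum.neutral_const by (simp only: dvd_add_left_iff)
      then have "[(-1) ^ card W * ?g W = (-1) ^ card W * 0] (mod int q)" by (rule cong_scalar_left)
      then show ?thesis by (simp flip: mult.assoc power_add)
    qed
  qed
  moreover have "restrict_tuple z n {..<n} xs = xs"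
    using xs by (auto simp: restrict_tuple_def valuations_def intro!: nth_equalityI)
  ultimately show False using nz by (metis subset_refl)
qed

section \<open>Circuits as sums of juntas\<close>

lemma gates_eval_append: "gates_eval A vs (gs @ hs) = gates_eval A (gates_eval A vs gs) hs"
  by (induction gs arbitrary: vs) auto

lemma length_gates_eval: "length (gates_eval A vs gs) = length vs + length gs"
  by (induction gs arbitrary: vs) auto

lemma geometric_sum_nat: "a * (\<Sum>c<k. (1 + a) ^ c) + 1 = (1 + a) ^ k" for a :: nat
  by (induction k) (auto simp: algebra_simps)

context ualgebra begin

lemma gates_eval_closed:
  assumes "xs \<in> valuations A n" "\<forall>i<length gs. wf_gate ar A (n + i) (gs ! i)"
  shows "set (gates_eval A xs gs) \<subseteq> U"
  using assms(2)
proof (induction gs rule: rev_induct)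
  case Nil
  then show ?case using assms(1) by (simp add: valuations_def)
next
  case (snoc g gs)
  have "\<forall>i<length gs. wf_gate ar A (n + i) (gs ! i)"
    using snoc.prems by (auto simp: nth_append split: if_splits dest: spec less_SucI)
  then have IH: "set (gates_eval A xs gs) \<subseteq> U" by (rule snoc.IH)
  have len: "length (gates_eval A xs gs) = n + length gs"
    using assms(1) by (simp add: length_gates_eval valuations_def)
  have "wf_gate ar A (n + length gs) g" using snoc.prems by (metis length_append_singleton lessI nth_append_length)
  then have "gate_eval A (gates_eval A xs gs) g \<in> U"
    using IH len by (cases g) (auto intro!: opn_closed simp: subset_iff)
  then show ?case using IH by (simp add: gates_eval_append)
qed

text \<open>The bound depends on c only through \<open>s c\<close>, so it is shared by all
  coordinates of a level. The linear part of a gate inherits it from the arguments, and only the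
  remainder needs interpolation.\<close>

theorem gates_junta:
  assumes co: "coords q H \<chi> s (Id_on U)" and q: "prime q" and m: "\<And>f. ar f \<le> m"
    and wf: "\<forall>i<length gs. wf_gate ar A (n + i) (gs ! i)" and i: "i < n + length gs" and c: "c < H"
  shows "junta A n q ((1 + m * (q - 1)) ^ s c) (\<lambda>xs. \<chi> c (gates_eval A xs gs ! i))"
  using wf i c
proof (induction gs arbitrary: i c rule: rev_induct)
  case Nil
  show ?case
    by (rule junta.base[of "{i}"]) simp_all
next
  case (snoc g gs)
  let ?B = "1 + m * (q - 1)"
  let ?V = "valuations A n"
  have wf: "\<forall>i<length gs. wf_gate ar A (n + i) (gs ! i)"
    using snoc.prems(1) by (auto simp: nth_append split: if_splits dest: spec less_SucI)
  note IH = snoc.IH[OF wf]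
  have len: "length (gates_eval A xs gs) = n + length gs" if "xs \<in> ?V" for xs
    using that by (simp add: length_gates_eval valuations_def)
  have c: "c < H" by (rule snoc.prems)
  show ?case
  proof (cases "i < n + length gs")
    case True
    have "gates_eval A xs (gs @ [g]) ! i = gates_eval A xs gs ! i" if "xs \<in> ?V" for xs
      using True len[OF that] by (simp add: gates_eval_append nth_append)
    then show ?thesis by (intro junta.cong[OF IH[OF True c]]) auto
  next
    case False
    then have i: "i = n + length gs" using snoc.prems by simp
    have last: "gates_eval A xs (gs @ [g]) ! i = gate_eval A (gates_eval A xs gs) g" if "xs \<in> ?V" for xs
      using len[OF that] i by (simp add: gates_eval_append nth_append)
    have wfg: "wf_gate ar A (n + length gs) g"
      using snoc.prems(1) by (metis length_append_singleton lessI nth_append_length)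
    have "junta A n q (?B ^ s c) (\<lambda>xs. \<chi> c (gate_eval A (gates_eval A xs gs) g))"
    proof (cases g)
      case (GConst a)
      then show ?thesis by (simp add: junta_const)
    next
      case (GOp f js)
      have js: "length js = ar f" "\<And>j. j < ar f \<Longrightarrow> js ! j < n + length gs" using wfg GOp by auto
      define arg where "arg xs = map (\<lambda>j. gates_eval A xs gs ! j) js" for xs
      have arg_nth: "arg xs ! j = gates_eval A xs gs ! (js ! j)" if "j < ar f" for xs j
        using that js(1) by (simp add: arg_def)
      have argU: "set (arg xs) \<subseteq> U" "length (arg xs) = ar f" if "xs \<in> ?V" for xs
        using gates_eval_closed[OF that wf] len[OF that] js
        by (auto simp: arg_def in_set_conv_nth subset_iff) (metis js(2))
      have argJ: "junta A n q (?B ^ s c') (\<lambda>xs. \<chi> c' (arg xs ! j))" if "j < ar f" "c' < H" for j c'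
        using IH[OF js(2)[OF that(1)] that(2)] arg_nth[OF that(1)] by simp
      obtain \<Lambda> where aff: "affine_at q H \<chi> s f c \<Lambda>" using coordsD(4)[OF co c] by blast
      define Lin where "Lin xs = (\<Sum>j<ar f. \<Sum>c'\<in>level H s c. \<Lambda> j c' * \<chi> c' (arg xs ! j))" for xs
      have Lin: "junta A n q (?B ^ s c) Lin"
        unfolding Lin_def
      proof (intro junta_sum junta_cmult)
        fix j c' assume "j \<in> {..<ar f}" "c' \<in> level H s c"
        then show "junta A n q (?B ^ s c) (\<lambda>xs. \<chi> c' (arg xs ! j))"
          using argJ[of j c'] by (simp add: level_def)
      qed
      \<comment> \<open>By \<open>affine_at\<close> this remainder has congruent values at inputs
        whose gate arguments agree in the coordinates below \<open>s c\<close>.\<close>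
      let ?F = "\<lambda>xs. \<chi> c (opn A f (arg xs)) - Lin xs"
      let ?L = "{..<ar f} \<times> {..<s c}"
      have sc: "s c \<le> c" using coordsD(1)[OF co c] .
      have "junta A n q ((q - 1) * (\<Sum>l\<in>?L. ?B ^ s (snd l))) ?F"
      proof (rule junta_compose[OF q, where f = "\<lambda>l xs. \<chi> (snd l) (arg xs ! fst l)"])
        show "junta A n q (?B ^ s (snd l)) (\<lambda>xs. \<chi> (snd l) (arg xs ! fst l))" if "l \<in> ?L" for l
          using that sc c by (intro argJ) auto
        fix xs ys assume V: "xs \<in> ?V" "ys \<in> ?V"
          and "\<forall>l\<in>?L. [\<chi> (snd l) (arg xs ! fst l) = \<chi> (snd l) (arg ys ! fst l)] (mod int q)"
        then have "\<forall>j<ar f. \<forall>c'<s c. [\<chi> c' (arg xs ! j) = \<chi> c' (arg ys ! j)] (mod int q)" by auto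
        then have "[\<chi> c (opn A f (arg xs)) - \<chi> c (opn A f (arg ys)) =
          (\<Sum>j<ar f. \<Sum>c'\<in>level H s c. \<Lambda> j c' * (\<chi> c' (arg xs ! j) - \<chi> c' (arg ys ! j)))] (mod int q)"
          using aff argU[OF V(1)] argU[OF V(2)] unfolding affine_at_def by blast
        also have "(\<Sum>j<ar f. \<Sum>c'\<in>level H s c. \<Lambda> j c' * (\<chi> c' (arg xs ! j) - \<chi> c' (arg ys ! j))) =
            Lin xs - Lin ys"
          by (simp add: Lin_def right_diff_distrib sum_subtractf)
        finally show "[?F xs = ?F ys] (mod int q)" by (simp add: cong_iff_dvd_diff algebra_simps)
      qed simp
      moreover have "(q - 1) * (\<Sum>l\<in>?L. ?B ^ s (snd l)) \<le> ?B ^ s c"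
      proof -
        have "(\<Sum>l\<in>?L. ?B ^ s (snd l)) = ar f * (\<Sum>c'<s c. ?B ^ s c')"
          using sum.cartesian_product[of "\<lambda>j c'. ?B ^ s c'" "{..<s c}" "{..<ar f}"]
          by (simp add: case_prod_unfold)
        also have "\<dots> \<le> m * (\<Sum>c'<s c. ?B ^ c')"
        proof (intro mult_le_mono sum_mono power_increasing m)
          show "s c' \<le> c'" if "c' \<in> {..<s c}" for c' using that sc c by (intro coordsD(1)[OF co]) auto
        qed simp
        finally have "(q - 1) * (\<Sum>l\<in>?L. ?B ^ s (snd l)) \<le> (q - 1) * (m * (\<Sum>c'<s c. ?B ^ c'))"
          by (rule mult_le_mono2)
        also have "\<dots> \<le> ?B ^ s c" using geometric_sum_nat[of "m * (q - 1)" "s c"] by (simp add: mult.assoc mult.left_commute)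
        finally show ?thesis .
      qed
      ultimately have "junta A n q (?B ^ s c) ?F" by (rule junta_mono)
      from junta.add[OF this Lin] show ?thesis by (simp add: GOp arg_def)
    qed
    then show ?thesis by (rule junta.cong) (simp add: last)
  qed
qed

text \<open>Whether the outputs agree depends on the H differences of their coordinates, so the
  indicator of the solutions arises by one more interpolation. At xs it is 1, hence nonzero modulo
  q.\<close>

theorem hitting_set:
  assumes co: "coords q H \<chi> s (Id_on U)" and q: "prime q" and H: "H \<le> h"
    and m: "\<And>f. ar f \<le> m" "m \<ge> 1" and z: "z \<in> U"
    and wf: "wf_circuit ar A C" and xs: "xs \<in> valuations A (n_inputs C)" "is_solution A C xs"
  shows "\<exists>W\<subseteq>{..<n_inputs C}. card W \<le> (m * q) ^ h \<and> is_solution A C (restrict_tuple z (n_inputs C) W xs)"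
proof -
  let ?n = "n_inputs C" and ?B = "1 + m * (q - 1)"
  let ?V = "valuations A ?n"
  define o1 where "o1 xs = gates_eval A xs (gates C) ! out1 C" for xs
  define o2 where "o2 xs = gates_eval A xs (gates C) ! out2 C" for xs
  have wfg: "\<forall>i<length (gates C). wf_gate ar A (?n + i) (gates C ! i)"
    and out: "out1 C < ?n + length (gates C)" "out2 C < ?n + length (gates C)"
    using wf by (auto simp: wf_circuit_def)
  have oU: "o1 xs \<in> U" "o2 xs \<in> U" if "xs \<in> ?V" for xs
  proof -
    have "length (gates_eval A xs (gates C)) = ?n + length (gates C)"
      using that by (simp add: length_gates_eval valuations_def)
    then show "o1 xs \<in> U" "o2 xs \<in> U"
      using gates_eval_closed[OF that wfg] out nth_mem unfolding o1_def o2_def by (metis subsetD)+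
  qed
  define F :: "'a list \<Rightarrow> int" where "F xs = (if o1 xs = o2 xs then 1 else 0)" for xs
  have sol: "is_solution A C xs \<longleftrightarrow> o1 xs = o2 xs" for xs by (simp add: is_solution_def o1_def o2_def)
  have eq_iff: "o1 xs = o2 xs \<longleftrightarrow> (\<forall>c<H. [\<chi> c (o1 xs) - \<chi> c (o2 xs) = 0] (mod int q))" if "xs \<in> ?V" for xs
    using coordsD(2)[OF co, of "o1 xs" "o2 xs"] oU[OF that] by (auto simp: cong_diff_iff_cong_0)
  have "junta A ?n q ((q - 1) * (\<Sum>c<H. ?B ^ s c)) F"
  proof (rule junta_compose[OF q, where f = "\<lambda>c xs. \<chi> c (o1 xs) - \<chi> c (o2 xs)"])
    show "junta A ?n q (?B ^ s c) (\<lambda>xs. \<chi> c (o1 xs) - \<chi> c (o2 xs))" if "c \<in> {..<H}" for c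
      unfolding o1_def o2_def using that out by (intro junta_diff gates_junta[OF co q m(1) wfg]) auto
    fix xs ys assume V: "xs \<in> ?V" "ys \<in> ?V"
      and eq: "\<forall>c\<in>{..<H}. [\<chi> c (o1 xs) - \<chi> c (o2 xs) = \<chi> c (o1 ys) - \<chi> c (o2 ys)] (mod int q)"
    have "[\<chi> c (o1 xs) - \<chi> c (o2 xs) = 0] (mod int q) \<longleftrightarrow> [\<chi> c (o1 ys) - \<chi> c (o2 ys) = 0] (mod int q)"
      if "c < H" for c using eq that cong_trans cong_sym by (meson lessThan_iff)
    then have "o1 xs = o2 xs \<longleftrightarrow> o1 ys = o2 ys" using eq_iff[OF V(1)] eq_iff[OF V(2)] by blast
    then show "[F xs = F ys] (mod int q)" by (simp add: F_def)
  qed simp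
  \<comment> \<open>As m is at least 1, q - 1 is at most m (q - 1), which completes the geometric
    sum, and the base 1 + m (q - 1) is at most m q.\<close>
  moreover have "(q - 1) * (\<Sum>c<H. ?B ^ s c) \<le> (m * q) ^ h"
  proof -
    have "(q - 1) * (\<Sum>c<H. ?B ^ s c) \<le> (m * (q - 1)) * (\<Sum>c<H. ?B ^ c)"
      using m(2) coordsD(1)[OF co] by (intro mult_le_mono sum_mono power_increasing) auto
    also have "\<dots> \<le> ?B ^ H" using geometric_sum_nat[of "m * (q - 1)" H] by linarith
    also have "\<dots> \<le> ?B ^ h" using H by (intro power_increasing) auto
    also have "?B \<le> m * q"
    proof -
      have "m * q = m * (q - 1) + m" using prime_gt_0_nat[OF q] by (cases q) auto
      then show ?thesis using m(2) by simp
    qed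
    then have "?B ^ h \<le> (m * q) ^ h" by (intro power_mono) auto
    finally show ?thesis .
  qed
  ultimately have J: "junta A ?n q ((m * q) ^ h) F" by (rule junta_mono)
  have "\<not> [F xs = 0] (mod int q)"
    using xs(2) sol prime_gt_1_nat[OF q] by (simp add: F_def cong_def)
  from junta_hitting[OF J xs(1) z this] obtain W where W: "W \<subseteq> {..<?n}" "card W \<le> (m * q) ^ h"
    "\<not> [F (restrict_tuple z ?n W xs) = 0] (mod int q)" by blast
  then have "is_solution A C (restrict_tuple z ?n W xs)" unfolding sol F_def by (auto split: if_splits)
  then show ?thesis using W by blast
qed

end

section \<open>Generating the candidates\<close>

text \<open>
  Register \<open>0\<close> holds \<open>n\<close>, register \<open>1\<close> holds \<open>1\<close>, register \<open>2\<close> holds \<open>0\<close>, and register \<open>3 + i\<close> is the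
  \<open>i\<close>-th loop counter, that is the \<open>i\<close>-th position of the tuple that is written to.
\<close>

fun ram_put :: "nat \<Rightarrow> 'a list \<Rightarrow> 'a ram" where
  "ram_put i [] = RConst 2 0"
| "ram_put i (v # vs) = RSeq (RWrite (3 + i) v) (ram_put (Suc i) vs)"

fun put :: "(nat \<Rightarrow> nat) \<Rightarrow> nat \<Rightarrow> 'a list \<Rightarrow> (nat \<Rightarrow> 'a) \<Rightarrow> nat \<Rightarrow> 'a" where
  "put X i [] T = T"
| "put X i (v # vs) T = put X (Suc i) vs (T(X (3 + i) := v))"

fun ram_emits :: "'a list list \<Rightarrow> 'a ram" where
  "ram_emits [] = RConst 2 0"
| "ram_emits (vs # vss) = RSeq (ram_put 0 vs) (RSeq REmit (ram_emits vss))"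

text \<open>The closing writes restore the constant tape, so that every round of the loops starts
  from the same tape.\<close>

definition ram_body :: "nat \<Rightarrow> 'a \<Rightarrow> 'a list list \<Rightarrow> 'a ram" where
  "ram_body k z vss = RSeq (ram_emits vss) (ram_put 0 (replicate k z))"

text \<open>Adding register 2, which holds 0, copies n into the counter. The decrement precedes the
  body, which thus sees the values n - 1 down to 0, the valid positions.\<close>

definition ram_loop :: "nat \<Rightarrow> 'a ram \<Rightarrow> 'a ram" where
  "ram_loop j b = RSeq (RAdd (3 + j) 0 2) (RWhile (3 + j) (RSeq (RSub (3 + j) (3 + j) 1) b))"

fun ram_nest :: "nat \<Rightarrow> 'a ram \<Rightarrow> 'a ram" where
  "ram_nest 0 b = b"
| "ram_nest (Suc j) b = ram_loop j (ram_nest j b)"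

text \<open>The constant tuple is output separately: it covers the empty set of positions, in
  particular n = 0, where loops do not reach their body.\<close>

definition ram_gen :: "nat \<Rightarrow> 'a \<Rightarrow> 'a list list \<Rightarrow> 'a ram" where
  "ram_gen k z vss = RSeq (RConst 1 1) (RSeq (ram_loop 0 (RWrite 3 z)) (RSeq REmit (ram_nest k (ram_body k z vss))))"

lemma ram_put_exec:
  "X 2 = 0 \<Longrightarrow> ram_exec n (ram_put i vs) (X, T) [] (length vs + 1) (X, put X i vs T)"
proof (induction vs arbitrary: i T)
  case Nil
  \<comment> \<open>As register 2 holds 0, \<open>RConst 2 0\<close> serves as the empty
    program.\<close>
  then have "X(2 := 0) = X" by auto
  then show ?case using ram_exec.RConst[of n 2 0 X T] by simp
next
  case (Cons v vs)
  show ?case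
    using ram_exec.RSeq[OF ram_exec.RWrite Cons.IH[OF Cons.prems]] by fastforce
qed

lemma put_agree:
  "(\<And>x. x \<notin> (\<lambda>l. X (3 + l)) ` {i..<i + length vs} \<Longrightarrow> T x = T' x) \<Longrightarrow> put X i vs T = put X i vs T'"
proof (induction vs arbitrary: i T T')
  case Nil
  then show ?case by auto
next
  case (Cons v vs)
  have "put X (Suc i) vs (T(X (3 + i) := v)) = put X (Suc i) vs (T'(X (3 + i) := v))"
  proof (rule Cons.IH)
    fix x assume x: "x \<notin> (\<lambda>l. X (3 + l)) ` {Suc i..<Suc i + length vs}"
    have "x \<notin> (\<lambda>l. X (3 + l)) ` {i..<i + length (v # vs)}" if "x \<noteq> X (3 + i)"
    proof
      assume "x \<in> (\<lambda>l. X (3 + l)) ` {i..<i + length (v # vs)}"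
      then obtain l where "x = X (3 + l)" "i \<le> l" "l < i + length (v # vs)" by auto
      then have "x \<in> (\<lambda>l. X (3 + l)) ` {Suc i..<Suc i + length vs}"
        using that by (intro image_eqI[of _ _ l]) (auto simp: le_less)
      then show False using x by blast
    qed
    then show "(T(X (3 + i) := v)) x = (T'(X (3 + i) := v)) x" using Cons.prems by auto
  qed
  then show ?case by simp
qed

lemma put_outside:
  "x \<notin> (\<lambda>l. X (3 + l)) ` {i..<i + length vs} \<Longrightarrow> put X i vs T x = T x"
proof (induction vs arbitrary: i T)
  case (Cons v vs)
  have "x \<notin> (\<lambda>l. X (3 + l)) ` {Suc i..<Suc i + length vs}" "x \<noteq> X (3 + i)" using Cons.prems by auto
  then show ?case using Cons.IH by simp
qed simp

lemma put_same:
  "(\<And>l. l < i + k \<Longrightarrow> T (X (3 + l)) = z) \<Longrightarrow> put X i (replicate k z) T = T"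
proof (induction k arbitrary: i)
  case (Suc k)
  have "T(X (3 + i) := z) = T" using Suc.prems[of i] by auto
  then show ?case using Suc by simp
qed simp

lemma put_in: "T x \<in> S \<Longrightarrow> set vs \<subseteq> S \<Longrightarrow> put X i vs T x \<in> S"
  by (induction vs arbitrary: i T) auto

text \<open>The value written depends on the position only, so counters pointing to the same
  position do not conflict.\<close>

lemma put_values:
  "put X i (map (\<lambda>l. g (X (3 + l))) [i..<i + k]) T =
    (\<lambda>x. if x \<in> (\<lambda>l. X (3 + l)) ` {i..<i + k} then g x else T x)"
proof (induction k arbitrary: i T)
  case (Suc k)
  let ?g = "\<lambda>l. g (X (3 + l))" and ?T = "T(X (3 + i) := g (X (3 + i)))"
  have upt: "[i..<i + Suc k] = i # [Suc i..<Suc i + k]" by (simp add: upt_conv_Cons del: upt_Suc)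
  have ivl: "{i..<i + Suc k} = insert i {Suc i..<Suc i + k}" by auto
  have "put X i (map ?g [i..<i + Suc k]) T = put X (Suc i) (map ?g [Suc i..<Suc i + k]) ?T"
    unfolding upt by (simp del: upt_Suc)
  also have "\<dots> = (\<lambda>x. if x \<in> (\<lambda>l. X (3 + l)) ` {Suc i..<Suc i + k} then g x else ?T x)"
    by (rule Suc.IH)
  also have "\<dots> = (\<lambda>x. if x \<in> (\<lambda>l. X (3 + l)) ` {i..<i + Suc k} then g x else T x)"
    unfolding ivl image_insert by (auto simp: fun_eq_iff)
  finally show ?case .
qed simp

lemma ram_emits_exec:
  assumes "X 2 = 0" "\<forall>vs\<in>set vss. length vs = k"
    "\<And>x. x \<notin> (\<lambda>l. X (3 + l)) ` {0..<k} \<Longrightarrow> T x = T0 x"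
  shows "\<exists>T'. ram_exec n (ram_emits vss) (X, T) (map (\<lambda>vs. map (put X 0 vs T0) [0..<n]) vss)
      (length vss * (k + 2) + 1) (X, T') \<and> (\<forall>x. x \<notin> (\<lambda>l. X (3 + l)) ` {0..<k} \<longrightarrow> T' x = T0 x)"
  using assms(2,3)
proof (induction vss arbitrary: T)
  case Nil
  have "X(2 := 0) = X" using assms(1) by auto
  then show ?case using ram_exec.RConst[of n 2 0 X T] Nil by auto
next
  case (Cons vs vss)
  have len: "length vs = k" using Cons.prems by simp
  have eq: "put X 0 vs T = put X 0 vs T0" using Cons.prems(2) len by (intro put_agree) auto
  have out: "put X 0 vs T0 x = T0 x" if "x \<notin> (\<lambda>l. X (3 + l)) ` {0..<k}" for x
    using that len by (intro put_outside) auto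
  obtain T' where T': "ram_exec n (ram_emits vss) (X, put X 0 vs T0) (map (\<lambda>vs. map (put X 0 vs T0) [0..<n]) vss)
      (length vss * (k + 2) + 1) (X, T')" "\<forall>x. x \<notin> (\<lambda>l. X (3 + l)) ` {0..<k} \<longrightarrow> T' x = T0 x"
    using Cons.IH[of "put X 0 vs T0"] Cons.prems(1) out by auto
  have "ram_exec n (RSeq REmit (ram_emits vss)) (X, put X 0 vs T0)
      ([map (put X 0 vs T0) [0..<n]] @ map (\<lambda>vs. map (put X 0 vs T0) [0..<n]) vss)
      (1 + (length vss * (k + 2) + 1)) (X, T')"
    by (rule ram_exec.RSeq[OF ram_exec.REmit T'(1)])
  then have exec: "ram_exec n (ram_emits (vs # vss)) (X, T)
      ([] @ ([map (put X 0 vs T0) [0..<n]] @ map (\<lambda>vs. map (put X 0 vs T0) [0..<n]) vss))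
      (length vs + 1 + (1 + (length vss * (k + 2) + 1))) (X, T')"
    unfolding ram_emits.simps eq[symmetric] by (intro ram_exec.RSeq[OF ram_put_exec[of X, OF assms(1)]])
  have time: "length vs + 1 + (1 + (length vss * (k + 2) + 1)) = length (vs # vss) * (k + 2) + 1"
    using len by simp
  show ?case using exec[unfolded time] T'(2) by (intro exI[of _ T']) (simp only: append.simps list.map)
qed

lemma ram_body_exec:
  assumes "X 2 = 0" "\<forall>vs\<in>set vss. length vs = k" "\<And>l. l < k \<Longrightarrow> X (3 + l) < n" "\<And>x. x < n \<Longrightarrow> T0 x = z"
  shows "ram_exec n (ram_body k z vss) (X, T0) (map (\<lambda>vs. map (put X 0 vs T0) [0..<n]) vss)
    (length vss * (k + 2) + 1 + (k + 1)) (X, T0)"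
proof -
  obtain T' where T': "ram_exec n (ram_emits vss) (X, T0) (map (\<lambda>vs. map (put X 0 vs T0) [0..<n]) vss)
      (length vss * (k + 2) + 1) (X, T')" "\<forall>x. x \<notin> (\<lambda>l. X (3 + l)) ` {0..<k} \<longrightarrow> T' x = T0 x"
    using ram_emits_exec[of X vss k T0 T0 n] assms(1,2) by auto
  have "put X 0 (replicate k z) T' = put X 0 (replicate k z) T0"
    using T'(2) by (intro put_agree) auto
  also have "\<dots> = T0" using assms(3,4) by (intro put_same) auto
  finally have "ram_exec n (ram_put 0 (replicate k z)) (X, T') [] (k + 1) (X, T0)"
    using ram_put_exec[of X n 0 "replicate k z" T', OF assms(1)] by simp
  from ram_exec.RSeq[OF T'(1) this] show ?thesis by (simp add: ram_body_def)
qed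

section \<open>Nested loops over the positions\<close>

definition counters :: "nat \<Rightarrow> nat \<Rightarrow> (nat \<Rightarrow> nat) \<Rightarrow> (nat \<Rightarrow> nat) set" where
  "counters n j X = {X'. (\<forall>r. r \<notin> {3..<3 + j} \<longrightarrow> X' r = X r) \<and> (\<forall>i<j. X' (3 + i) < n)}"

lemma counters_cong: "(\<And>r. r \<notin> {3..<3 + j} \<Longrightarrow> X r = Y r) \<Longrightarrow> counters n j X = counters n j Y"
  unfolding counters_def by auto

lemma counters_Suc:
  assumes "v < n"
  shows "{X' \<in> counters n (Suc j) X. X' (3 + j) = v} = counters n j (X(3 + j := v))"
proof -
  have "X' \<in> counters n (Suc j) X \<and> X' (3 + j) = v \<longleftrightarrow> X' \<in> counters n j (X(3 + j := v))" for X'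
  proof
    assume *: "X' \<in> counters n (Suc j) X \<and> X' (3 + j) = v"
    have "X' r = (X(3 + j := v)) r" if "r \<notin> {3..<3 + j}" for r
      using * that by (cases "r = 3 + j") (auto simp: counters_def)
    then show "X' \<in> counters n j (X(3 + j := v))" using * by (auto simp: counters_def)
  next
    assume *: "X' \<in> counters n j (X(3 + j := v))"
    then have v: "X' (3 + j) = v" by (auto simp: counters_def)
    have "X' (3 + i) < n" if "i < Suc j" for i
      using * that v assms by (cases "i = j") (auto simp: counters_def)
    moreover have "X' r = X r" if "r \<notin> {3..<3 + Suc j}" for r using * that by (auto simp: counters_def)
    ultimately show "X' \<in> counters n (Suc j) X \<and> X' (3 + j) = v" using v by (auto simp: counters_def)
  qed
  then show ?thesis by auto
qed

definition emitted :: "nat \<Rightarrow> 'a list list \<Rightarrow> (nat \<Rightarrow> 'a) \<Rightarrow> (nat \<Rightarrow> nat) set \<Rightarrow> 'a list set" where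
  "emitted n vss T0 XS = (\<Union>X\<in>XS. (\<lambda>vs. map (put X 0 vs T0) [0..<n]) ` set vss)"

text \<open>Loops are numbered from the inside. Before the j innermost ones run, the counters of the
  enclosing loops must already hold positions below n.\<close>

definition ready :: "nat \<Rightarrow> nat \<Rightarrow> nat \<Rightarrow> (nat \<Rightarrow> nat) \<Rightarrow> bool" where
  "ready n k j X \<longleftrightarrow> X 0 = n \<and> X 1 = 1 \<and> X 2 = 0 \<and> (\<forall>i. j \<le> i \<and> i < k \<longrightarrow> X (3 + i) < n)"

definition nest_spec :: "nat \<Rightarrow> nat \<Rightarrow> 'a \<Rightarrow> 'a list list \<Rightarrow> (nat \<Rightarrow> 'a) \<Rightarrow> nat \<Rightarrow> nat \<Rightarrow> bool" where
  "nest_spec n k z vss T0 j b \<longleftrightarrow> (\<forall>X. ready n k j X \<longrightarrow> (\<exists>H t X'.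
     ram_exec n (ram_nest j (ram_body k z vss)) (X, T0) H t (X', T0) \<and>
     (\<forall>r. r \<notin> {3..<3 + j} \<longrightarrow> X' r = X r) \<and> set H = emitted n vss T0 (counters n j X) \<and>
     length H = length vss * n ^ j \<and> t \<le> b))"

lemma ram_while_exec:
  assumes spec: "nest_spec n k z vss T0 j b" and j: "j < k"
  shows "v \<le> n \<Longrightarrow> ready n k (Suc j) X \<Longrightarrow> X (3 + j) = v \<Longrightarrow>
    \<exists>H t X'. ram_exec n (RWhile (3 + j) (RSeq (RSub (3 + j) (3 + j) 1) (ram_nest j (ram_body k z vss)))) (X, T0) H t (X', T0) \<and>
     (\<forall>r. r \<notin> {3..<3 + Suc j} \<longrightarrow> X' r = X r) \<and> set H = emitted n vss T0 {X' \<in> counters n (Suc j) X. X' (3 + j) < v} \<and>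
     length H = v * (length vss * n ^ j) \<and> t \<le> 1 + v * (2 + b)"
proof (induction v arbitrary: X)
  case 0
  show ?case
    by (rule exI[of _ "[]"], rule exI[of _ 1], rule exI[of _ X])
      (use ram_exec.RWhile_False[of X "3 + j" n _ T0] 0 in \<open>auto simp: emitted_def\<close>)
next
  case (Suc v)
  let ?body = "RSeq (RSub (3 + j) (3 + j) 1) (ram_nest j (ram_body k z vss))"
  let ?X1 = "X(3 + j := v)"
  have sub: "ram_exec n (RSub (3 + j) (3 + j) 1) (X, T0) [] 1 (?X1, T0)"
    using ram_exec.RSub[of n "3 + j" "3 + j" 1 X T0] Suc.prems by (simp add: ready_def)
  have "ready n k j ?X1" 
    unfolding ready_def
  proof (intro conjI allI impI)
    show "?X1 (3 + i) < n" if "j \<le> i \<and> i < k" for i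
      using Suc.prems that by (cases "i = j") (auto simp: ready_def)
  qed (use Suc.prems in \<open>auto simp: ready_def\<close>)
  then obtain H1 t1 X2 where 1: "ram_exec n (ram_nest j (ram_body k z vss)) (?X1, T0) H1 t1 (X2, T0)"
    "\<And>r. r \<notin> {3..<3 + j} \<Longrightarrow> X2 r = ?X1 r" "set H1 = emitted n vss T0 (counters n j ?X1)"
    "length H1 = length vss * n ^ j" "t1 \<le> b"
    using spec unfolding nest_spec_def by blast
  have X2: "X2 r = X r" if "r \<notin> {3..<3 + Suc j}" for r using 1(2)[of r] that by auto
  have "ready n k (Suc j) X2" using Suc.prems(2) X2 by (auto simp: ready_def)
  moreover have "X2 (3 + j) = v" using 1(2)[of "3 + j"] by simp
  ultimately obtain H2 t2 X3 where 2: "ram_exec n (RWhile (3 + j) ?body) (X2, T0) H2 t2 (X3, T0)"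
    "\<And>r. r \<notin> {3..<3 + Suc j} \<Longrightarrow> X3 r = X2 r"
    "set H2 = emitted n vss T0 {X' \<in> counters n (Suc j) X2. X' (3 + j) < v}"
    "length H2 = v * (length vss * n ^ j)" "t2 \<le> 1 + v * (2 + b)"
    using Suc.IH[of X2] Suc.prems(1) by auto
  have "ram_exec n (RWhile (3 + j) ?body) (X, T0) (([] @ H1) @ H2) (1 + (1 + t1) + t2) (X3, T0)"
    using Suc.prems(3) by (intro ram_exec.RWhile_True[OF _ ram_exec.RSeq[OF sub 1(1)] 2(1)]) simp
  moreover have "set (([] @ H1) @ H2) = emitted n vss T0 {X' \<in> counters n (Suc j) X. X' (3 + j) < Suc v}"
  proof -
    have "counters n (Suc j) X2 = counters n (Suc j) X" using X2 by (intro counters_cong) auto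
    moreover have "{X' \<in> counters n (Suc j) X. X' (3 + j) < Suc v} =
        {X' \<in> counters n (Suc j) X. X' (3 + j) = v} \<union> {X' \<in> counters n (Suc j) X. X' (3 + j) < v}" by auto
    moreover have "{X' \<in> counters n (Suc j) X. X' (3 + j) = v} = counters n j ?X1"
      using Suc.prems(1) by (intro counters_Suc) auto
    ultimately show ?thesis using 1(3) 2(3) by (simp add: emitted_def)
  qed
  moreover have "X3 r = X r" if "r \<notin> {3..<3 + Suc j}" for r using 2(2)[OF that] X2[OF that] by simp
  moreover have "length (([] @ H1) @ H2) = Suc v * (length vss * n ^ j)" using 1(4) 2(4) by simp
  moreover have "1 + (1 + t1) + t2 \<le> 1 + Suc v * (2 + b)" using 1(5) 2(5) by simp
  ultimately show ?case by blast
qed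

text \<open>Two further steps per round and two per loop give the summand 4 * j. The maximum with 1
  keeps the bound true for n = 0, when a loop still takes two steps.\<close>

lemma ram_nest_exec:
  assumes vss: "\<forall>vs\<in>set vss. length vs = k" and T0: "\<forall>x<n. T0 x = z"
  shows "j \<le> k \<Longrightarrow> nest_spec n k z vss T0 j ((length vss * (k + 2) + k + 2 + 4 * j) * max 1 n ^ j)"
proof (induction j)
  case 0
  show ?case
    unfolding nest_spec_def
  proof (intro allI impI)
    fix X assume X: "ready n k 0 X"
    have "counters n 0 X = {X}" by (auto simp: counters_def)
    then show "\<exists>H t X'. ram_exec n (ram_nest 0 (ram_body k z vss)) (X, T0) H t (X', T0) \<and>
        (\<forall>r. r \<notin> {3..<3 + 0} \<longrightarrow> X' r = X r) \<and> set H = emitted n vss T0 (counters n 0 X) \<and>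
        length H = length vss * n ^ 0 \<and> t \<le> (length vss * (k + 2) + k + 2 + 4 * 0) * max 1 n ^ 0"
      using ram_body_exec[of X vss k n T0 z] X vss T0
      by (intro exI[of _ "map (\<lambda>vs. map (put X 0 vs T0) [0..<n]) vss"]
          exI[of _ "length vss * (k + 2) + 1 + (k + 1)"] exI[of _ X])
        (auto simp: ready_def emitted_def)
  qed
next
  case (Suc j)
  let ?N = "max 1 n"
  let ?b = "(length vss * (k + 2) + k + 2 + 4 * j) * ?N ^ j"
  have spec: "nest_spec n k z vss T0 j ?b" using Suc by simp
  show ?case
    unfolding nest_spec_def
  proof (intro allI impI)
    fix X assume X: "ready n k (Suc j) X"
    let ?X = "X(3 + j := n)"
    have init: "ram_exec n (RAdd (3 + j) 0 2) (X, T0) [] 1 (?X, T0)"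
      using ram_exec.RAdd[of n "3 + j" 0 2 X T0] X by (simp add: ready_def)
    have "ready n k (Suc j) ?X" using X by (auto simp: ready_def)
    then obtain H t X' where W: "ram_exec n (RWhile (3 + j) (RSeq (RSub (3 + j) (3 + j) 1)
        (ram_nest j (ram_body k z vss)))) (?X, T0) H t (X', T0)"
      "\<And>r. r \<notin> {3..<3 + Suc j} \<Longrightarrow> X' r = ?X r"
      "set H = emitted n vss T0 {X' \<in> counters n (Suc j) ?X. X' (3 + j) < n}"
      "length H = n * (length vss * n ^ j)" "t \<le> 1 + n * (2 + ?b)"
      using ram_while_exec[OF spec, of n ?X] Suc.prems by auto
    have "ram_exec n (ram_nest (Suc j) (ram_body k z vss)) (X, T0) ([] @ H) (1 + t) (X', T0)"
      unfolding ram_nest.simps ram_loop_def by (rule ram_exec.RSeq[OF init W(1)])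
    moreover have "X' r = X r" if "r \<notin> {3..<3 + Suc j}" for r using W(2)[OF that] that by auto
    moreover have "{X' \<in> counters n (Suc j) ?X. X' (3 + j) < n} = counters n (Suc j) X"
      using counters_cong[of "Suc j" ?X X n] by (auto simp: counters_def)
    then have "set ([] @ H) = emitted n vss T0 (counters n (Suc j) X)" using W(3) by simp
    moreover have "length ([] @ H) = length vss * n ^ Suc j" using W(4) by simp
    moreover have "1 + t \<le> (length vss * (k + 2) + k + 2 + 4 * Suc j) * ?N ^ Suc j"
    proof -
      have N: "1 \<le> ?N ^ Suc j" "n \<le> ?N ^ Suc j" "n * ?b \<le> (length vss * (k + 2) + k + 2 + 4 * j) * ?N ^ Suc j"
      proof -
        show "1 \<le> ?N ^ Suc j" by simp
        have "n * 1 \<le> ?N * ?N ^ j" by (intro mult_le_mono) auto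
        then show "n \<le> ?N ^ Suc j" by simp
        have "n * ?b \<le> ?N * ?b" by (intro mult_le_mono) auto
        then show "n * ?b \<le> (length vss * (k + 2) + k + 2 + 4 * j) * ?N ^ Suc j" by (simp add: algebra_simps)
      qed
      have "1 + t \<le> 2 + 2 * n + n * ?b" using W(5) by (simp add: algebra_simps)
      also have "\<dots> \<le> 2 * ?N ^ Suc j + 2 * ?N ^ Suc j +
          (length vss * (k + 2) + k + 2 + 4 * j) * ?N ^ Suc j"
        using N by (intro add_mono) auto
      also have "\<dots> = (length vss * (k + 2) + k + 2 + 4 * Suc j) * ?N ^ Suc j" by (simp add: algebra_simps)
      finally show ?thesis .
    qed
    ultimately show "\<exists>H t X'. ram_exec n (ram_nest (Suc j) (ram_body k z vss)) (X, T0) H t (X', T0) \<and>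
        (\<forall>r. r \<notin> {3..<3 + Suc j} \<longrightarrow> X' r = X r) \<and> set H = emitted n vss T0 (counters n (Suc j) X) \<and>
        length H = length vss * n ^ Suc j \<and> t \<le> (length vss * (k + 2) + k + 2 + 4 * Suc j) * ?N ^ Suc j"
      by blast
  qed
qed

lemma ram_clear_while:
  "X 1 = 1 \<Longrightarrow> X 3 = v \<Longrightarrow> ram_exec n (RWhile 3 (RSeq (RSub 3 3 1) (RWrite 3 z))) (X, T) [] (1 + 3 * v)
     (X(3 := 0), \<lambda>x. if x < v then z else T x)"
proof (induction v arbitrary: X T)
  case 0
  then have "X(3 := 0) = X" by auto
  then show ?case using ram_exec.RWhile_False[of X 3 n _ T] 0 by simp
next
  case (Suc v)
  let ?X1 = "X(3 := v)" and ?T1 = "T(v := z)"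
  have "ram_exec n (RSub 3 3 1) (X, T) [] 1 (?X1, T)"
    using ram_exec.RSub[of n 3 3 1 X T] Suc.prems by simp
  moreover have "ram_exec n (RWrite 3 z) (?X1, T) [] 1 (?X1, ?T1)"
    using ram_exec.RWrite[of n 3 z ?X1 T] by simp
  ultimately have body: "ram_exec n (RSeq (RSub 3 3 1) (RWrite 3 z)) (X, T) ([] @ []) (1 + 1) (?X1, ?T1)"
    by (rule ram_exec.RSeq)
  have rest: "ram_exec n (RWhile 3 (RSeq (RSub 3 3 1) (RWrite 3 z))) (?X1, ?T1) [] (1 + 3 * v)
      (?X1(3 := 0), \<lambda>x. if x < v then z else ?T1 x)"
    using Suc.prems by (intro Suc.IH) auto
  have "X 3 \<noteq> 0" using Suc.prems by simp
  have T: "(\<lambda>x. if x < v then z else ?T1 x) = (\<lambda>x. if x < Suc v then z else T x)"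
    by (auto simp: fun_eq_iff)
  have t: "1 + (1 + 1) + (1 + 3 * v) = 1 + 3 * Suc v" by simp
  show ?case
    using ram_exec.RWhile_True[OF \<open>X 3 \<noteq> 0\<close> body rest] unfolding T t append.simps fun_upd_upd .
qed

text \<open>When the counters run through the elements of W and the written values are the entries
  of xs there, the output is the restriction of xs to W.\<close>

theorem ram_gen_generates:
  assumes vss: "set vss = {vs. set vs \<subseteq> S \<and> length vs = k}" and z: "z \<in> S"
  shows "\<exists>H t. generates (ram_gen k z vss) n H t \<and> (\<forall>xs\<in>set H. length xs = n \<and> set xs \<subseteq> S) \<and>
    (\<forall>W xs. W \<subseteq> {..<n} \<and> card W \<le> k \<and> length xs = n \<and> set xs \<subseteq> S \<longrightarrow> restrict_tuple z n W xs \<in> set H) \<and>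
    length H = 1 + length vss * n ^ k \<and>
    t \<le> 5 + 3 * n + (length vss * (k + 2) + k + 2 + 4 * k) * max 1 n ^ k"
proof -
  define X0 :: "nat \<Rightarrow> nat" where "X0 = (\<lambda>_. 0)(0 := n, 1 := 1)"
  define T0 :: "nat \<Rightarrow> 'a" where "T0 = (\<lambda>x. if x < n then z else undefined)"
  have vss': "\<forall>vs\<in>set vss. length vs = k" using vss by auto
  have T0z: "\<And>x. x < n \<Longrightarrow> T0 x = z" by (simp add: T0_def)
  have one: "ram_exec n (RConst 1 1) ((\<lambda>_. 0)(0 := n), \<lambda>_. undefined) [] 1 (X0, \<lambda>_. undefined)"
    using ram_exec.RConst[of n 1 1 "(\<lambda>_. 0)(0 := n)" "\<lambda>_. undefined"] by (simp add: X0_def)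
  have "ram_exec n (RAdd 3 0 2) (X0, \<lambda>_. undefined) [] 1 (X0(3 := n), \<lambda>_. undefined)"
    using ram_exec.RAdd[of n 3 0 2 X0 "\<lambda>_. undefined"] by (simp add: X0_def)
  moreover have "ram_exec n (RWhile 3 (RSeq (RSub 3 3 1) (RWrite 3 z))) (X0(3 := n), \<lambda>_. undefined) []
      (1 + 3 * n) (X0(3 := 0), T0)"
    using ram_clear_while[of "X0(3 := n)" n n z "\<lambda>_. undefined"] by (simp add: X0_def T0_def)
  ultimately have "ram_exec n (ram_loop 0 (RWrite 3 z)) (X0, \<lambda>_. undefined) ([] @ []) (1 + (1 + 3 * n)) (X0(3 := 0), T0)"
    unfolding ram_loop_def add_0_right by (rule ram_exec.RSeq)
  moreover have "X0(3 := 0) = X0" by (auto simp: X0_def)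
  ultimately have two: "ram_exec n (ram_loop 0 (RWrite 3 z)) (X0, \<lambda>_. undefined) [] (2 + 3 * n) (X0, T0)" by simp
  have "ready n k k X0" by (simp add: ready_def X0_def)
  then obtain H t X' where nest: "ram_exec n (ram_nest k (ram_body k z vss)) (X0, T0) H t (X', T0)"
    "set H = emitted n vss T0 (counters n k X0)" "length H = length vss * n ^ k"
    "t \<le> (length vss * (k + 2) + k + 2 + 4 * k) * max 1 n ^ k"
    using ram_nest_exec[OF vss', of n T0 z k] T0z unfolding nest_spec_def by blast
  let ?H = "[map T0 [0..<n]] @ H"
  have "ram_exec n (RSeq REmit (ram_nest k (ram_body k z vss))) (X0, T0) ?H (1 + t) (X', T0)"
    by (rule ram_exec.RSeq[OF ram_exec.REmit nest(1)])
  from ram_exec.RSeq[OF one ram_exec.RSeq[OF two this]]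
  have gen: "generates (ram_gen k z vss) n ?H (1 + (2 + 3 * n + (1 + t)))"
    unfolding generates_def ram_gen_def by auto
  have val: "length xs = n \<and> set xs \<subseteq> S" if xs: "xs \<in> set ?H" for xs
  proof -
    have "put X 0 vs T0 i \<in> S" if "vs \<in> set vss" "i < n" for X vs i
      using that vss z T0z[of i] put_in[of T0 i S vs X 0] by simp
    then show ?thesis using xs z T0z nest(2) by (auto simp: emitted_def)
  qed
  have cov: "restrict_tuple z n W xs \<in> set ?H"
    if W: "W \<subseteq> {..<n}" "card W \<le> k" and xs: "length xs = n" "set xs \<subseteq> S" for W xs
  proof (cases "W = {}")
    case True
    then have "restrict_tuple z n W xs = map T0 [0..<n]" using T0z by (auto simp: restrict_tuple_def)
    then show ?thesis by simp
  next
    case False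
    then obtain w where w: "w \<in> W" by blast
    have finW: "finite W" using W finite_subset by blast
    \<comment> \<open>W is enumerated with repetitions, so that exactly k counters also cover sets
      with fewer than k elements.\<close>
    define ps where "ps = sorted_list_of_set W @ replicate (k - card W) w"
    have ps: "length ps = k" "set ps = W" using W w finW by (auto simp: ps_def)
    define X where "X r = (if r \<in> {3..<3 + k} then ps ! (r - 3) else X0 r)" for r
    have Xps: "X (3 + l) = ps ! l" if "l < k" for l using that by (simp add: X_def)
    have psW: "ps ! l \<in> W" if "l < k" for l using ps that nth_mem by metis
    have "X \<in> counters n k X0" using Xps psW W(1) by (fastforce simp: counters_def X_def)
    moreover define vs where "vs = map (\<lambda>l. xs ! (X (3 + l))) [0..<0 + k]"
    have "xs ! (X (3 + l)) \<in> S" if "l < k" for l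
    proof -
      have "ps ! l < length xs" using psW[OF that] W(1) xs(1) by auto
      then show ?thesis using Xps[OF that] xs(2) nth_mem by (metis subsetD)
    qed
    then have "vs \<in> set vss" using vss by (auto simp: vs_def)
    ultimately have "map (put X 0 vs T0) [0..<n] \<in> set H"
      using nest(2) by (auto simp: emitted_def)
    moreover have "(\<lambda>l. X (3 + l)) ` {0..<0 + k} = W"
    proof -
      have "(\<lambda>l. X (3 + l)) ` {0..<k} = (\<lambda>l. ps ! l) ` {0..<k}" using Xps by (intro image_cong) auto
      also have "\<dots> = W" using ps by (metis nth_image order_refl take_all)
      finally show ?thesis by simp
    qed
    then have "put X 0 vs T0 = (\<lambda>x. if x \<in> W then xs ! x else T0 x)"
      unfolding vs_def put_values by simp
    then have "map (put X 0 vs T0) [0..<n] = restrict_tuple z n W xs"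
      using T0z by (auto simp: restrict_tuple_def)
    ultimately show ?thesis by simp
  qed
  have len: "length ?H = 1 + length vss * n ^ k" using nest(3) by simp
  have time: "1 + (2 + 3 * n + (1 + t)) \<le> 5 + 3 * n + (length vss * (k + 2) + k + 2 + 4 * k) * max 1 n ^ k"
    using nest(4) by simp
  show ?thesis
  proof (intro exI conjI allI impI ballI; (elim conjE)?)
    show "generates (ram_gen k z vss) n ?H (1 + (2 + 3 * n + (1 + t)))" by (rule gen)
    show "length ?H = 1 + length vss * n ^ k" by (rule len)
    show "1 + (2 + 3 * n + (1 + t)) \<le> 5 + 3 * n + (length vss * (k + 2) + k + 2 + 4 * k) * max 1 n ^ k"
      by (rule time)
  qed (use val cov in auto)
qed

section \<open>The black-box algorithm\<close>

lemma test_time_le: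
  fixes C :: "('f, 'a) circuit"
  shows "test_time C \<le> circuit_size C"
proof -
  have "gate_time g = gate_size g" for g :: "('f, 'a) gate" by (cases g) auto
  then have "gate_time = (gate_size :: ('f, 'a) gate \<Rightarrow> nat)" by (rule ext)
  then show ?thesis by (simp add: test_time_def circuit_size_def)
qed

text \<open>Raising q^h to the logarithm of m to base q gives m^h. For m = 0 the logarithm is 0 by
  convention, as it is for m = 1; hence the maximum.\<close>

lemma exponent_eq:
  fixes q h m :: nat
  assumes "q > 1"
  shows "real (q ^ h) powr (log (real q) (real m) + 1) = real ((max 1 m * q) ^ h)"
proof (cases "m = 0")
  case True
  then show ?thesis using assms by (simp add: log_def)
next
  case False
  have "real (q ^ h) powr log (real q) (real m) = (real q powr log (real q) (real m)) powr real h"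
    using assms by (simp add: powr_powr mult.commute flip: powr_realpow)
  also have "\<dots> = real m ^ h" using assms False by (simp add: powr_realpow)
  finally show ?thesis using assms False by (simp add: powr_add power_mult_distrib max_def)
qed

theorem theorem1p1:
  fixes ar :: "'f \<Rightarrow> nat" and A :: "('f, 'a) ualg" and q h m :: nat and d :: real
  assumes "is_ualg ar A"
    and "finite (uni A)"
    and "prime q" and "h \<ge> 1" and "card (uni A) = q ^ h"
    and "supernilpotent ar A"
    and "in_cm_variety ar A"
    and "finite (range ar)" and "m = Max (range ar)"
    and "d = real (card (uni A)) powr (log (real q) (real m) + 1)"
  shows "\<exists>(p :: 'a ram) (c :: real). \<forall>C. wf_circuit ar A C \<longrightarrow>
           (\<exists>ans t. black_box_run A p C ans t \<and> (ans \<longleftrightarrow> CSAT A C) \<and>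
              real t \<le> c * real (max 1 (n_inputs C)) powr d * real (circuit_size C))"
proof -
  interpret ualgebra ar A using assms(1) by unfold_locales
  obtain sk where sn: "k_supernilpotent ar A sk" using assms(6) by (auto simp: supernilpotent_def)
  obtain H \<chi> s where co: "coords q H \<chi> s (Id_on U)" "H \<le> h"
    using coords_exist[OF assms(7) sn assms(2,3,5)] .
  obtain z where z: "z \<in> U" using assms(1) by (auto simp: is_ualg_def)
  obtain us where us: "set us = U" using finite_list[OF assms(2)] by blast
  \<comment> \<open>If all basic operations are constants then m = 0, while
    \<open>hitting_set\<close> asks for a positive bound on the arities; by
    \<open>exponent_eq\<close> the value of d is not affected.\<close>
  define m' where "m' = max 1 m"
  have m': "ar f \<le> m'" "m' \<ge> 1" for f using assms(8,9) by (auto simp: m'_def le_max_iff_disj)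
  define k where "k = (m' * q) ^ h"
  \<comment> \<open>All k-tuples over A; their number does not depend on the circuit.\<close>
  define vss where "vss = List.n_lists k us"
  have vss: "set vss = {vs. set vs \<subseteq> U \<and> length vs = k}" by (auto simp: vss_def set_n_lists us)
  define K where "K = length vss * (k + 2) + k + 2 + 4 * k"
  \<comment> \<open>The summands pay for filling the tape, for the nested loops, for testing the
    constant candidate, and for testing the candidates from the loops.\<close>
  define c where "c = 5 + K + 1 + length vss"
  have d: "d = real k" using exponent_eq[OF prime_gt_1_nat[OF assms(3)]] assms(5,10) by (simp add: k_def m'_def)
  show ?thesis
  proof (intro exI[of _ "ram_gen k z vss"] exI[of _ "real c"] allI impI)
    fix C assume wf: "wf_circuit ar A C"
    let ?n = "n_inputs C" and ?s = "circuit_size C"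
    obtain Hs t0 where gen: "generates (ram_gen k z vss) ?n Hs t0"
      and val: "\<forall>xs\<in>set Hs. length xs = ?n \<and> set xs \<subseteq> U"
      and cov: "\<forall>W xs. W \<subseteq> {..<?n} \<and> card W \<le> k \<and> length xs = ?n \<and> set xs \<subseteq> U \<longrightarrow>
        restrict_tuple z ?n W xs \<in> set Hs"
      and len: "length Hs = 1 + length vss * ?n ^ k"
      and t0: "t0 \<le> 5 + 3 * ?n + K * max 1 ?n ^ k"
      using ram_gen_generates[OF vss z, of ?n] unfolding K_def by blast
    define t where "t = t0 + (\<Sum>xs\<leftarrow>Hs. test_time C)"
    have Hs_val: "set Hs \<subseteq> valuations A ?n" using val by (auto simp: valuations_def)
    have "(\<exists>xs\<in>set Hs. is_solution A C xs) \<longleftrightarrow> CSAT A C"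
    proof
      assume "\<exists>xs\<in>set Hs. is_solution A C xs"
      then show "CSAT A C" using Hs_val by (auto simp: CSAT_def)
    next
      assume "CSAT A C"
      then obtain xs where xs: "xs \<in> valuations A ?n" "is_solution A C xs" by (auto simp: CSAT_def)
      from hitting_set[OF co(1) assms(3) co(2) m' z wf xs]
      obtain W where W: "W \<subseteq> {..<?n}" "card W \<le> k" "is_solution A C (restrict_tuple z ?n W xs)"
        unfolding k_def by blast
      then have "restrict_tuple z ?n W xs \<in> set Hs" using cov xs(1) by (auto simp: valuations_def)
      then show "\<exists>xs\<in>set Hs. is_solution A C xs" using W(3) by blast
    qed
    then have run: "black_box_run A (ram_gen k z vss) C (CSAT A C) t"
      unfolding black_box_run_def t_def using gen Hs_val by blast
    have "t \<le> c * max 1 ?n ^ k * ?s"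
    proof -
      let ?N = "max 1 ?n ^ k"
      have N: "?N \<ge> 1" "?n ^ k \<le> ?N" by (auto intro: power_mono)
      have s: "?s \<ge> ?n + 2" by (simp add: circuit_size_def)
      have "(\<Sum>xs\<leftarrow>Hs. test_time C) = length Hs * test_time C" by (simp add: sum_list_triv)
      also have "\<dots> \<le> (?N + length vss * ?N) * ?s"
        unfolding len using N test_time_le by (intro mult_le_mono add_mono) auto
      finally have 1: "(\<Sum>xs\<leftarrow>Hs. test_time C) \<le> (1 + length vss) * ?N * ?s" by (simp add: algebra_simps)
      have "5 + 3 * ?n \<le> 5 * ?s" using s by linarith
      also have "\<dots> \<le> 5 * ?N * ?s" using N(1) by simp
      finally have 2: "5 + 3 * ?n \<le> 5 * ?N * ?s" .
      have 3: "K * ?N \<le> K * ?N * ?s" using s by simp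
      have "t \<le> 5 * ?N * ?s + K * ?N * ?s + (1 + length vss) * ?N * ?s"
        using t0 1 2 3 unfolding t_def by linarith
      also have "\<dots> = c * ?N * ?s" unfolding c_def by (simp only: distrib_right add.assoc)
      finally show ?thesis .
    qed
    then have "real t \<le> real (c * max 1 ?n ^ k * ?s)" by (rule of_nat_mono)
    also have "\<dots> = real c * real (max 1 ?n) powr d * real ?s" unfolding d by (simp add: powr_realpow)
    finally have "real t \<le> real c * real (max 1 ?n) powr d * real ?s" .
    then show "\<exists>ans t. black_box_run A (ram_gen k z vss) C ans t \<and> (ans \<longleftrightarrow> CSAT A C) \<and>
        real t \<le> real c * real (max 1 ?n) powr d * real ?s"
      using run by blast
  qed
qed

end
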